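(* (i) If $k\in\mathbb{N}_0$ and $N<p\le\infty$, then $D^{k,p}\subset M^{s,p}$ for every $s\ge k-N/p$ and $D^{k,p}\subset M_0^{s,p}$ for every $s>k-N/p$. (ii) If $k\in\mathbb{N}_0$ and $1\le p\le N$, then $D^{k,p}\subset M_0^{s,p}$ for every $s>k-1$.
   Context: All function spaces are spaces of complex-valued functions or distributions on $\mathbb{R}^N$; derivatives are in the sense of distributions; $\mathcal{D}'$ is the space of distributions on $\mathbb{R}^N$; $\mathbb{N}_0=\mathbb{N}\cup\{0\}$; $|\alpha|_1:=\alpha_1+\cdots+\alpha_N$. For $k\in\mathbb{N}_0$ and $1\le p\le\infty$, $D^{k,p}:=\{u\in\mathcal{D}':\partial^\alpha u\in L^p\text{ for all }|\alpha|_1=k\}$. $B_R$ is the open Euclidean ball with center $0$ and radius $R$. For $s\in\mathbb{R}$ and $1\le q\le\infty$ (with $N/q:=0$ if $q=\infty$), $M^{s,q}:=\{u\in L^q_{loc}:\sup_{R\ge 1}R^{-s-N/q}\|u\|_{L^q(B_R)}<\infty\}$ and $M_0^{s,q}:=\{u\in L^q_{loc}:\lim_{R\to\infty}R^{-s-N/q}\|u\|_{L^q(B_R)}=0\}$. *)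

theory Defs
  imports "HOL-Probability.Probability"
begin

text \<open>
  Throughout, \<open>'n\<close> is the index type of the coordinates, so \<open>real ^ 'n\<close> is \<open>\<real>\<^sup>N\<close> with
  \<open>N = CARD('n) \<ge> 1\<close>. Exponents \<open>1 \<le> p \<le> \<infinity>\<close> have type \<^typ>\<open>ennreal\<close>, and \<open>N/p\<close> is
  \<open>enn2real (of_nat CARD('n) / p)\<close>, which is \<open>0\<close> for \<open>p = \<infinity>\<close>.
\<close>

section \<open>Test functions and distributions\<close>

definition partial_deriv :: "'n::finite \<Rightarrow> (real ^ 'n \<Rightarrow> complex) \<Rightarrow> real ^ 'n \<Rightarrow> complex" where
  "partial_deriv i f x = vector_derivative (\<lambda>t. f (x + t *\<^sub>R axis i 1)) (at 0)"

text \<open>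
  An arbitrary fixed order in which iterated partial derivatives are taken; for the smooth
  functions to which \<open>multi_deriv\<close> is applied, the order is immaterial.
\<close>

definition coord_list :: "'n::finite list" where
  "coord_list = (SOME is. distinct is \<and> set is = UNIV)"

definition multi_deriv :: "('n::finite \<Rightarrow> nat) \<Rightarrow> (real ^ 'n \<Rightarrow> complex) \<Rightarrow> real ^ 'n \<Rightarrow> complex" where
  "multi_deriv \<alpha> f = fold (\<lambda>i. partial_deriv i ^^ \<alpha> i) coord_list f"

definition mi_order :: "('n::finite \<Rightarrow> nat) \<Rightarrow> nat" where
  "mi_order \<alpha> = (\<Sum>i\<in>UNIV. \<alpha> i)"

primrec C_k :: "nat \<Rightarrow> (real ^ 'n::finite \<Rightarrow> complex) \<Rightarrow> bool" where
  "C_k 0 f \<longleftrightarrow> continuous_on UNIV f"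
| "C_k (Suc k) f \<longleftrightarrow> f differentiable_on UNIV \<and> (\<forall>i. C_k k (partial_deriv i f))"

definition test_functions :: "(real ^ 'n::finite \<Rightarrow> complex) set" where
  "test_functions = {\<phi>. (\<forall>k. C_k k \<phi>) \<and> compact (closure (support_on UNIV \<phi>))}"

text \<open>
  Distributions are the linear functionals on the test functions that are continuous, i.e. that
  satisfy on each compact set an estimate by finitely many derivatives. Being \<open>extensional\<close>, two
  of them are equal iff they agree on all test functions.
\<close>

type_synonym 'n functional = "(real ^ 'n \<Rightarrow> complex) \<Rightarrow> complex"

definition distributions :: "'n::finite functional set" where
  "distributions = {u \<in> extensional test_functions.
     (\<forall>\<phi>\<in>test_functions. \<forall>\<psi>\<in>test_functions. u (\<lambda>x. \<phi> x + \<psi> x) = u \<phi> + u \<psi>) \<and>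
     (\<forall>c. \<forall>\<phi>\<in>test_functions. u (\<lambda>x. c * \<phi> x) = c * u \<phi>) \<and>
     (\<forall>K. compact K \<longrightarrow> (\<exists>C m. \<forall>\<phi>\<in>test_functions. closure (support_on UNIV \<phi>) \<subseteq> K \<longrightarrow>
        cmod (u \<phi>) \<le> C * (\<Sum>\<alpha> | mi_order \<alpha> \<le> m. SUP x. cmod (multi_deriv \<alpha> \<phi> x))))}"

definition dist_deriv :: "('n::finite \<Rightarrow> nat) \<Rightarrow> 'n functional \<Rightarrow> 'n functional" where
  "dist_deriv \<alpha> u = (\<lambda>\<phi>\<in>test_functions. (- 1) ^ mi_order \<alpha> * u (multi_deriv \<alpha> \<phi>))"

text \<open>
  The usual embedding of locally integrable functions into the distributions. A class of locally
  integrable functions is identified with its image under \<open>dist_of\<close>.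
\<close>

definition dist_of :: "(real ^ 'n::finite \<Rightarrow> complex) \<Rightarrow> 'n functional" where
  "dist_of f = (\<lambda>\<phi>\<in>test_functions. LINT x|lebesgue. f x * \<phi> x)"


section \<open>Function spaces\<close>

text \<open>\<open>Lp_norm p A f\<close> is the norm of \<open>f\<close> in \<open>L\<^sup>p(A)\<close>, possibly infinite.\<close>

definition ennroot :: "real \<Rightarrow> ennreal \<Rightarrow> ennreal" where
  "ennroot r a = (if a = \<infinity> then \<infinity> else ennreal (enn2real a powr (1 / r)))"

definition Lp_norm :: "ennreal \<Rightarrow> (real ^ 'n::finite) set \<Rightarrow> (real ^ 'n \<Rightarrow> complex) \<Rightarrow> ennreal" where
  "Lp_norm p A f =
     (if p = \<infinity> then esssup lebesgue (\<lambda>x. ennreal (cmod (f x)) * indicator A x)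
      else ennroot (enn2real p)
             (\<integral>\<^sup>+x\<in>A. ennreal (cmod (f x) powr enn2real p) \<partial>lebesgue))"

definition Lp :: "ennreal \<Rightarrow> (real ^ 'n::finite \<Rightarrow> complex) set" where
  "Lp p = {f \<in> borel_measurable lebesgue. Lp_norm p UNIV f < \<infinity>}"

definition Lp_loc :: "ennreal \<Rightarrow> (real ^ 'n::finite \<Rightarrow> complex) set" where
  "Lp_loc p = {f \<in> borel_measurable lebesgue. \<forall>K. compact K \<longrightarrow> Lp_norm p K f < \<infinity>}"

definition growth_quot :: "real \<Rightarrow> ennreal \<Rightarrow> (real ^ 'n::finite \<Rightarrow> complex) \<Rightarrow> real \<Rightarrow> ennreal" where
  "growth_quot s q f R =
     ennreal (R powr (- s - enn2real (of_nat CARD('n) / q))) * Lp_norm q (ball 0 R) f"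

definition M_space :: "real \<Rightarrow> ennreal \<Rightarrow> (real ^ 'n::finite \<Rightarrow> complex) set" where
  "M_space s q = {f \<in> Lp_loc q. (SUP R\<in>{1..}. growth_quot s q f R) < \<infinity>}"

definition M0_space :: "real \<Rightarrow> ennreal \<Rightarrow> (real ^ 'n::finite \<Rightarrow> complex) set" where
  "M0_space s q = {f \<in> Lp_loc q. (growth_quot s q f \<longlongrightarrow> 0) at_top}"

definition D_space :: "nat \<Rightarrow> ennreal \<Rightarrow> 'n::finite functional set" where
  "D_space k p =
     {u \<in> distributions. \<forall>\<alpha>. mi_order \<alpha> = k \<longrightarrow> dist_deriv \<alpha> u \<in> dist_of ` Lp p}"

end

theory Submission
  imports Defs
begin

text \<open>
  Let \<open>u\<close> be a linear functional on the test functions whose partial derivatives \<open>f\<^sub>i\<close> are functions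
  with \<open>\<parallel>f\<^sub>i\<parallel> = O(R\<^bsup>s + N/p\<^esup>)\<close> in \<open>L\<^sup>p\<close> of the cube of half-side \<open>R\<close>, where \<open>s > -1\<close>. Replacing a test
  function \<open>\<phi>\<close> by its integral along the lines in direction \<open>i\<close>, spread out by a one-dimensional bump
  of width \<open>R\<close>, changes \<open>\<phi>\<close> by the \<open>i\<close>-th derivative of a test function, hence changes \<open>u \<phi>\<close> by an
  integral of \<open>f\<^sub>i\<close>. After all coordinates only a multiple of \<open>\<integral>\<phi>\<close> is left, so \<open>u\<close> is a function
  \<open>C\<^sub>R - G\<^sub>R\<close> with \<open>C\<^sub>R\<close> constant and \<open>G\<^sub>R\<close> an explicit integral operator applied to the \<open>f\<^sub>i\<close>, of norm
  \<open>O(R\<^bsup>s + 1 + N/p\<^esup>)\<close> on the cube of half-side \<open>R\<close>. Comparing the representations at scales \<open>R\<close> and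
  \<open>2 R\<close> gives \<open>C\<^bsub>2 R\<^esub> - C\<^sub>R = O(R\<^bsup>s + 1\<^esup>)\<close>, and because \<open>s + 1 > 0\<close> these differences sum up to
  \<open>C\<^sub>R = O(R\<^bsup>s + 1\<^esup>)\<close> along \<open>R = 2\<^sup>j\<close>. So one integration raises the growth exponent by one, and
  the theorem follows by induction on \<open>k\<close> from the growth of \<open>L\<^sup>p\<close> functions, with exponents starting at
  any \<open>s > -1\<close> with \<open>s \<ge> - N/p\<close>.
\<close>

section \<open>Smooth functions and test functions\<close>

text \<open>The bump has to be as wide as the cube on which the estimate is made. Its height is then
  a constant over \<open>R\<close>, so the averaging operators are bounded on the cube of half-side
  \<open>R\<close> by a constant independent of \<open>R\<close>, and only the integration along a
  line costs a factor \<open>R\<close>. With a bump of fixed width the bound for each averaging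
  would itself grow with the cube, and the exponent would rise by more than one per integration. The
  price is a constant \<open>C\<close> that changes with the scale, which is why neighbouring scales
  have to be compared.

  The case distinction at \<open>p = N\<close> concerns only the starting exponent. The differences
  of the constants grow like powers of \<open>2 powr (s + 1)\<close>, and their sum is of the order
  of its last term because this ratio exceeds 1, that is, because \<open>s > -1\<close>; at
  \<open>s = -1\<close> a logarithm would appear. For \<open>p > N\<close> the exponent
  \<open>-N/p\<close> lies above -1 and can be used itself, which gives the endpoint in
  \<open>M_space\<close>. For \<open>p <= N\<close> only exponents strictly above -1 can be used, so
  the endpoint is lost and the strict inequality \<open>s > k - 1\<close> remains.\<close>

definition smooth :: "(real ^ 'n::finite \<Rightarrow> complex) \<Rightarrow> bool" where
  "smooth f \<longleftrightarrow> (\<forall>k. C_k k f)"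

text \<open>A class closed under all partial derivatives needs only one derivative per member, so
  derivatives of higher order never have to be computed. It serves for ray integrals and for the
  functions built from \<open>exp (- (1 / s))\<close>.\<close>

lemma smoothI_invariant:
  fixes S :: "(real ^ 'n::finite \<Rightarrow> complex) set"
  assumes "f \<in> S"
    and diff: "\<And>f. f \<in> S \<Longrightarrow> f differentiable_on UNIV"
    and inv: "\<And>f i. f \<in> S \<Longrightarrow> partial_deriv i f \<in> S"
  shows "smooth f"
proof -
  have "C_k k f" if "f \<in> S" for k f
    using that
  proof (induction k arbitrary: f)
    case 0
    then show ?case using diff by (simp add: differentiable_imp_continuous_on)
  next
    case (Suc k)
    then show ?case using diff inv by simp
  qed
  then show ?thesis using assms(1) by (simp add: smooth_def)
qed

lemma smooth_partial_deriv: "smooth f \<Longrightarrow> smooth (partial_deriv i f)"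
  unfolding smooth_def using C_k.simps(2) by blast

lemma smooth_differentiable_on: "smooth f \<Longrightarrow> f differentiable_on UNIV"
  unfolding smooth_def using C_k.simps(2) by blast

lemma smooth_differentiable: "smooth f \<Longrightarrow> f differentiable (at x)"
  using smooth_differentiable_on[of f] by (simp add: differentiable_on_def)

lemma smooth_continuous_on: "smooth f \<Longrightarrow> continuous_on A f"
  unfolding smooth_def using C_k.simps(1) continuous_on_subset by blast

lemma partial_deriv_eqI:
  assumes "(f has_derivative D) (at x)"
  shows "partial_deriv i f x = D (axis i 1)"
proof -
  have lin: "bounded_linear D" using assms by (rule has_derivative_bounded_linear)
  have "((\<lambda>t::real. f (x + t *\<^sub>R axis i 1)) has_derivative (\<lambda>t. D (t *\<^sub>R axis i 1))) (at 0)"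
    by (rule has_derivative_compose[where g=f and f="\<lambda>t. x + t *\<^sub>R axis i 1"])
      (auto intro!: derivative_eq_intros assms)
  moreover have "(\<lambda>t. D (t *\<^sub>R axis i 1)) = (\<lambda>t. t *\<^sub>R D (axis i 1))"
    using lin by (simp add: linear_simps(5) fun_eq_iff)
  ultimately show ?thesis
    unfolding partial_deriv_def by (simp add: has_vector_derivative_def vector_derivative_at)
qed

lemma has_derivative_partial_derivs:
  assumes "f differentiable (at x)"
  shows "(f has_derivative (\<lambda>h. \<Sum>i\<in>UNIV. h $ i *\<^sub>R partial_deriv i f x)) (at x)"
proof -
  obtain D where D: "(f has_derivative D) (at x)"
    using assms differentiable_def by blast
  interpret D: bounded_linear D using D by (rule has_derivative_bounded_linear)
  have "D h = (\<Sum>i\<in>UNIV. h $ i *\<^sub>R partial_deriv i f x)" for h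
  proof -
    have "D h = D (\<Sum>i\<in>UNIV. h $ i *\<^sub>R axis i 1)"
      using basis_expansion[of h] by (simp add: scalar_mult_eq_scaleR)
    then show ?thesis by (simp add: D.sum D.scaleR partial_deriv_eqI[OF D])
  qed
  then have "D = (\<lambda>h. \<Sum>i\<in>UNIV. h $ i *\<^sub>R partial_deriv i f x)" by blast
  then show ?thesis using D by simp
qed

lemma partial_deriv_has_vector_derivative:
  assumes "f differentiable (at (x + t *\<^sub>R axis i 1))"
  shows "((\<lambda>t. f (x + t *\<^sub>R axis i 1)) has_vector_derivative
           partial_deriv i f (x + t *\<^sub>R axis i 1)) (at t)"
proof -
  note D = has_derivative_partial_derivs[OF assms]
  have "((\<lambda>t::real. f (x + t *\<^sub>R axis i 1)) has_derivative
      (\<lambda>s. \<Sum>j\<in>UNIV. (s *\<^sub>R axis i 1) $ j *\<^sub>R partial_deriv j f (x + t *\<^sub>R axis i 1))) (at t)"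
    by (rule has_derivative_compose[where g=f and f="\<lambda>t. x + t *\<^sub>R axis i 1", OF _ D])
      (auto intro!: derivative_eq_intros)
  moreover have "(\<Sum>j\<in>UNIV. (s *\<^sub>R axis i 1) $ j *\<^sub>R g j) = s *\<^sub>R g i"
    for s and g :: "_ \<Rightarrow> complex"
    by (subst sum.remove[of _ i]) (auto simp: axis_def intro!: sum.neutral)
  ultimately show ?thesis
    by (simp add: has_vector_derivative_def)
qed

lemma partial_deriv_add:
  assumes "f differentiable (at x)" "g differentiable (at x)"
  shows "partial_deriv i (\<lambda>x. f x + g x) x = partial_deriv i f x + partial_deriv i g x"
proof -
  obtain D E where D: "(f has_derivative D) (at x)" and E: "(g has_derivative E) (at x)"
    using assms differentiable_def by blast
  show ?thesis
    using partial_deriv_eqI[OF has_derivative_add[OF D E]] partial_deriv_eqI[OF D]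
      partial_deriv_eqI[OF E] by simp
qed

lemma partial_deriv_mult:
  assumes "f differentiable (at x)" "g differentiable (at x)"
  shows "partial_deriv i (\<lambda>x. f x * g x) x = f x * partial_deriv i g x + partial_deriv i f x * g x"
proof -
  obtain D E where D: "(f has_derivative D) (at x)" and E: "(g has_derivative E) (at x)"
    using assms differentiable_def by blast
  show ?thesis
    using partial_deriv_eqI[OF has_derivative_mult[OF D E]] partial_deriv_eqI[OF D]
      partial_deriv_eqI[OF E] by simp
qed

lemma partial_deriv_const: "partial_deriv i (\<lambda>x. c) = (\<lambda>x. 0)"
  by (rule ext, rule partial_deriv_eqI[of _ "\<lambda>h. 0"]) simp

lemma smooth_const: "smooth (\<lambda>x. c)"
  by (rule smoothI_invariant[where S="range (\<lambda>c x. c)"]) (auto simp: partial_deriv_const)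

lemma C_k_Suc_imp: "C_k (Suc k) f \<Longrightarrow> C_k k f"
proof (induction k arbitrary: f)
  case 0
  then show ?case by (simp add: differentiable_imp_continuous_on)
next
  case (Suc k)
  then show ?case by (meson C_k.simps(2))
qed

lemma C_k_add: "C_k k f \<Longrightarrow> C_k k g \<Longrightarrow> C_k k (\<lambda>x. f x + g x)"
proof (induction k arbitrary: f g)
  case 0
  then show ?case by (auto intro: continuous_intros)
next
  case (Suc k)
  have "partial_deriv i (\<lambda>x. f x + g x) = (\<lambda>x. partial_deriv i f x + partial_deriv i g x)" for i
    using Suc.prems by (auto simp: differentiable_on_def intro!: partial_deriv_add)
  with Suc show ?case by auto
qed

lemma C_k_mult: "C_k k f \<Longrightarrow> C_k k g \<Longrightarrow> C_k k (\<lambda>x. f x * g x)"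
proof (induction k arbitrary: f g)
  case 0
  then show ?case by (auto intro: continuous_intros)
next
  case (Suc k)
  have "partial_deriv i (\<lambda>x. f x * g x) =
      (\<lambda>x. f x * partial_deriv i g x + partial_deriv i f x * g x)" for i
    using Suc.prems by (auto simp: differentiable_on_def intro!: partial_deriv_mult)
  moreover have "C_k k f" "C_k k g" using Suc.prems C_k_Suc_imp by blast+
  ultimately show ?case using Suc by (auto intro!: C_k_add)
qed

lemma smooth_add: "smooth f \<Longrightarrow> smooth g \<Longrightarrow> smooth (\<lambda>x. f x + g x)"
  by (simp add: smooth_def C_k_add)

lemma smooth_mult: "smooth f \<Longrightarrow> smooth g \<Longrightarrow> smooth (\<lambda>x. f x * g x)"
  by (simp add: smooth_def C_k_mult)

lemma smooth_prod: "finite I \<Longrightarrow> (\<And>i. i \<in> I \<Longrightarrow> smooth (f i)) \<Longrightarrow> smooth (\<lambda>x. \<Prod>i\<in>I. f i x)"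
  by (induction I rule: finite_induct) (auto intro: smooth_const smooth_mult)

lemma partial_deriv_cmult:
  "smooth f \<Longrightarrow> partial_deriv i (\<lambda>x. c * f x) = (\<lambda>x. c * partial_deriv i f x)"
  using partial_deriv_mult[of "\<lambda>x. c" _ f] by (auto simp: smooth_differentiable partial_deriv_const)

section \<open>Cubes and compactly supported smooth functions\<close>

text \<open>Cubes replace the balls of the statement because they are products: an operator that
  samples along one coordinate can stay inside a cube, whereas the lines through a ball have varying
  length.\<close>

definition cube :: "real \<Rightarrow> (real ^ 'n::finite) set" where
  "cube L = {x. \<forall>i. \<bar>x $ i\<bar> \<le> L}"

lemma cube_mono: "L \<le> L' \<Longrightarrow> cube L \<subseteq> cube L'"
  unfolding cube_def by (auto intro: order_trans)

lemma cube_eq_cbox: "cube L = cbox (\<chi> i. - L) (\<chi> i. L)"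
  by (auto simp: cube_def mem_box_cart abs_le_iff minus_le_iff)

lemma cball_subset_cube: "cball 0 L \<subseteq> cube L"
  unfolding cube_def using component_le_norm_cart order_trans by fastforce

lemma bounded_support_imp_cube:
  assumes "bounded S"
  obtains L where "L > 0" "S \<subseteq> cube L"
proof -
  obtain L where "L > 0" "\<forall>x\<in>S. norm x \<le> L"
    using assms bounded_pos by blast
  then have "S \<subseteq> cube L" using cball_subset_cube[of L] by auto
  with \<open>L > 0\<close> show ?thesis using that by blast
qed

lemma test_functions_iff:
  "\<phi> \<in> test_functions \<longleftrightarrow> smooth \<phi> \<and> (\<exists>L>0. \<forall>x. \<phi> x \<noteq> 0 \<longrightarrow> x \<in> cube L)"
proof -
  have "bounded (support_on UNIV \<phi>) \<longleftrightarrow> (\<exists>L>0. \<forall>x. \<phi> x \<noteq> 0 \<longrightarrow> x \<in> cube L)"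
  proof
    assume "bounded (support_on UNIV \<phi>)"
    then show "\<exists>L>0. \<forall>x. \<phi> x \<noteq> 0 \<longrightarrow> x \<in> cube L"
      by (elim bounded_support_imp_cube) (auto simp: support_on_def)
  next
    assume "\<exists>L>0. \<forall>x. \<phi> x \<noteq> 0 \<longrightarrow> x \<in> cube L"
    then obtain L where "support_on UNIV \<phi> \<subseteq> cube L" by (auto simp: support_on_def)
    then show "bounded (support_on UNIV \<phi>)"
      using bounded_subset[OF bounded_cbox] unfolding cube_eq_cbox by blast
  qed
  then show ?thesis
    by (auto simp: test_functions_def smooth_def)
qed

lemma test_functionE:
  assumes "\<phi> \<in> test_functions"
  obtains L where "smooth \<phi>" "L > 0" "\<And>x. x \<notin> cube L \<Longrightarrow> \<phi> x = 0"
  using assms by (auto simp: test_functions_iff)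

lemma test_functionI: "smooth \<phi> \<Longrightarrow> (\<And>x. x \<notin> cube L \<Longrightarrow> \<phi> x = 0) \<Longrightarrow> \<phi> \<in> test_functions"
  unfolding test_functions_iff using cube_mono[of L "max L 1"]
  by (intro conjI exI[of _ "max L 1"]) auto

lemma test_function_add:
  assumes "\<phi> \<in> test_functions" "\<psi> \<in> test_functions"
  shows "(\<lambda>x. \<phi> x + \<psi> x) \<in> test_functions"
proof -
  obtain L where L: "smooth \<phi>" "L > 0" "\<And>x. x \<notin> cube L \<Longrightarrow> \<phi> x = 0"
    using assms(1) by (rule test_functionE) blast
  obtain M where M: "smooth \<psi>" "M > 0" "\<And>x. x \<notin> cube M \<Longrightarrow> \<psi> x = 0"
    using assms(2) by (rule test_functionE) blast
  have "\<phi> x + \<psi> x = 0" if "x \<notin> cube (max L M)" for x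
  proof -
    have "x \<notin> cube L" "x \<notin> cube M"
      using that cube_mono[of L "max L M"] cube_mono[of M "max L M"] by auto
    then show ?thesis using L(3) M(3) by simp
  qed
  then show ?thesis
    by (intro test_functionI[of _ "max L M"] smooth_add L M)
qed

lemma test_function_cmult:
  assumes "\<phi> \<in> test_functions"
  shows "(\<lambda>x. c * \<phi> x) \<in> test_functions"
proof -
  obtain L where L: "smooth \<phi>" "L > 0" "\<And>x. x \<notin> cube L \<Longrightarrow> \<phi> x = 0"
    using assms by (rule test_functionE) blast
  then show ?thesis by (intro test_functionI[of _ L] smooth_mult smooth_const) auto
qed

lemma test_function_diff:
  assumes "\<phi> \<in> test_functions" "\<psi> \<in> test_functions"
  shows "(\<lambda>x. \<phi> x - \<psi> x) \<in> test_functions"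
  using test_function_add[OF assms(1) test_function_cmult[OF assms(2), of "-1"]] by simp

lemma partial_deriv_support:
  assumes "smooth \<phi>" "\<And>x. x \<notin> cube L \<Longrightarrow> \<phi> x = 0" "x \<notin> cube L"
  shows "partial_deriv i \<phi> x = 0"
proof -
  \<comment> \<open>The complement of the cube is open, so \<open>\<phi>\<close> vanishes in a
    neighbourhood of \<open>x\<close> and not only at \<open>x\<close>.\<close>
  have "open (- cube L)" using closed_cbox open_Compl by (metis cube_eq_cbox)
  moreover have "((\<lambda>x. 0) has_derivative (\<lambda>x. 0)) (at x)" by simp
  ultimately have "(\<phi> has_derivative (\<lambda>x. 0)) (at x)"
    by - (rule has_derivative_transform_within_open[where g=\<phi> and s="- cube L"], use assms in auto)
  then show ?thesis using partial_deriv_eqI by fastforce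
qed

lemma test_function_partial_deriv:
  assumes "\<phi> \<in> test_functions"
  shows "partial_deriv i \<phi> \<in> test_functions"
proof -
  obtain L where L: "smooth \<phi>" "L > 0" "\<And>x. x \<notin> cube L \<Longrightarrow> \<phi> x = 0"
    using assms by (rule test_functionE) blast
  then show ?thesis
    by (intro test_functionI[of _ L] smooth_partial_deriv partial_deriv_support[of _ L]) auto
qed

section \<open>Integration along rays and multi-index derivatives\<close>

definition ray_integral :: "real set \<Rightarrow> 'n::finite \<Rightarrow> (real ^ 'n \<Rightarrow> complex) \<Rightarrow> real ^ 'n \<Rightarrow> complex" where
  "ray_integral B i \<phi> x = (LINT t:B|lborel. \<phi> (x + t *\<^sub>R axis i 1))"

text \<open>Covers the whole line (used for averaging) and the half-line up to 0 (used for
  antiderivatives) at once: within any symmetric window either set is a compact interval starting at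
  the left end of the window.\<close>

definition initial_ray :: "real set \<Rightarrow> bool" where
  "initial_ray B \<longleftrightarrow> (\<forall>M>0. \<exists>b. B \<inter> {- M..M} = {- M..b})"

lemma initial_ray_UNIV: "initial_ray UNIV"
  unfolding initial_ray_def by auto

lemma initial_ray_atMost: "initial_ray {..0}"
  unfolding initial_ray_def by (auto intro!: exI[of _ 0])

lemma ray_leaves_cube:
  assumes "\<And>x. x \<notin> cube L \<Longrightarrow> \<phi> x = 0" "\<bar>x $ i\<bar> \<le> K" "t \<notin> {- (K + L)..K + L}"
  shows "\<phi> (x + t *\<^sub>R axis i 1) = 0"
proof -
  have "\<bar>(x + t *\<^sub>R axis i 1) $ i\<bar> > L" using assms(2,3) by auto
  then have "x + t *\<^sub>R axis i 1 \<notin> cube L" unfolding cube_def using not_le by blast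
  then show ?thesis using assms(1) by blast
qed

lemma continuous_on_ray:
  fixes \<phi> :: "real ^ 'n::finite \<Rightarrow> complex"
  shows "continuous_on UNIV \<phi> \<Longrightarrow> continuous_on A (\<lambda>t. \<phi> (x + t *\<^sub>R axis i 1))"
  by (rule continuous_on_compose2[of UNIV \<phi>]) (auto intro!: continuous_intros)

text \<open>The interval depends on \<open>x\<close> only through the bound \<open>K\<close>, so it
  stays fixed while \<open>x\<close> varies in a small ball, as differentiation under the integral
  sign requires.\<close>

lemma ray_integral_eq_interval:
  assumes cont: "continuous_on UNIV \<phi>" and supp: "\<And>x. x \<notin> cube L \<Longrightarrow> \<phi> x = 0"
    and x: "\<bar>x $ i\<bar> \<le> K" and B: "B \<inter> {- (K + L)..K + L} = {- (K + L)..b}"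
  shows "ray_integral B i \<phi> x = integral {- (K + L)..b} (\<lambda>t. \<phi> (x + t *\<^sub>R axis i 1))"
proof -
  have "indicator B t *\<^sub>R \<phi> (x + t *\<^sub>R axis i 1) =
      indicator {- (K + L)..b} t *\<^sub>R \<phi> (x + t *\<^sub>R axis i 1)" for t
    using ray_leaves_cube[of L \<phi> x i K t] supp x
    unfolding B[symmetric] by (auto simp: indicator_def)
  then have "ray_integral B i \<phi> x = (LINT t:{- (K + L)..b}|lborel. \<phi> (x + t *\<^sub>R axis i 1))"
    unfolding ray_integral_def set_lebesgue_integral_def by presburger
  also have "\<dots> = integral {- (K + L)..b} (\<lambda>t. \<phi> (x + t *\<^sub>R axis i 1))"
    by (intro set_borel_integral_eq_integral borel_integrable_atLeastAtMost')
      (rule continuous_on_ray[OF cont])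
  finally show ?thesis .
qed

text \<open>The derivative as a bounded linear map, the form in which \<open>leibniz_rule\<close>
  asks for a continuous derivative of the integrand.\<close>

definition grad :: "(real ^ 'n::finite \<Rightarrow> complex) \<Rightarrow> real ^ 'n \<Rightarrow> (real ^ 'n) \<Rightarrow>\<^sub>L complex" where
  "grad \<phi> x = (\<Sum>i\<in>UNIV. blinfun_scaleR_left (partial_deriv i \<phi> x) o\<^sub>L blinfun_inner_left (axis i 1))"

lemma grad_apply: "blinfun_apply (grad \<phi> x) h = (\<Sum>i\<in>UNIV. h $ i *\<^sub>R partial_deriv i \<phi> x)"
  unfolding grad_def by (simp add: blinfun.sum_left cart_eq_inner_axis inner_commute)

lemma grad_axis: "blinfun_apply (grad \<phi> x) (axis i 1) = partial_deriv i \<phi> x"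
  unfolding grad_apply by (subst sum.remove[of _ i]) (auto simp: axis_def intro!: sum.neutral)

lemma continuous_on_grad: "smooth \<phi> \<Longrightarrow> continuous_on A (grad \<phi>)"
  unfolding grad_def
  by (intro continuous_on_sum bounded_bilinear.continuous_on[OF bounded_bilinear_blinfun_compose]
      bounded_linear.continuous_on[OF bounded_linear_blinfun_scaleR_left] continuous_on_const
      smooth_continuous_on smooth_partial_deriv)

lemma
  assumes smooth: "smooth \<phi>" and supp: "\<And>x. x \<notin> cube L \<Longrightarrow> \<phi> x = 0" "L > 0" and B: "initial_ray B"
  shows ray_integral_differentiable: "ray_integral B i \<phi> differentiable (at x)"
    and partial_deriv_ray_integral:
      "partial_deriv j (ray_integral B i \<phi>) x = ray_integral B i (partial_deriv j \<phi>) x"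
proof -
  define K where "K = \<bar>x $ i\<bar> + 1"
  have K: "K > 0" unfolding K_def by simp
  obtain b where b: "B \<inter> {- (K + L)..K + L} = {- (K + L)..b}"
    using B K \<open>L > 0\<close> unfolding initial_ray_def by (metis add_pos_pos)
  \<comment> \<open>One \<open>K\<close>, hence one interval of integration, serves all points of
    the unit ball around \<open>x\<close>.\<close>
  have yK: "\<bar>y $ i\<bar> \<le> K" if "y \<in> ball x 1" for y
  proof -
    have "\<bar>(y - x) $ i\<bar> \<le> 1"
      using that component_le_norm_cart[of "y - x" i] by (simp add: dist_norm norm_minus_commute)
    then show ?thesis unfolding K_def by simp
  qed
  let ?I = "cbox (- (K + L)) b"
  have contg: "continuous_on A (\<lambda>y. grad \<phi> (fst y + snd y *\<^sub>R axis i 1))" for A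
    by (rule continuous_on_compose2[OF continuous_on_grad[OF smooth, of UNIV]])
      (auto intro!: continuous_intros)
  have contg2: "continuous_on A (\<lambda>t. grad \<phi> (x + t *\<^sub>R axis i 1))" for A
    by (rule continuous_on_compose2[OF continuous_on_grad[OF smooth, of UNIV]])
      (auto intro!: continuous_intros)
  have der: "((\<lambda>y. \<phi> (y + t *\<^sub>R axis i 1)) has_derivative
      blinfun_apply (grad \<phi> (y + t *\<^sub>R axis i 1))) (at y within ball x 1)" for y t
  proof -
    have "(\<phi> has_derivative blinfun_apply (grad \<phi> (y + t *\<^sub>R axis i 1))) (at (y + t *\<^sub>R axis i 1))"
      using has_derivative_partial_derivs[OF smooth_differentiable[OF smooth]]
      by (simp add: grad_apply[abs_def])
    then have "((\<lambda>y. \<phi> (y + t *\<^sub>R axis i 1)) has_derivative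
      blinfun_apply (grad \<phi> (y + t *\<^sub>R axis i 1))) (at y)"
      by (rule has_derivative_compose[where g=\<phi> and f="\<lambda>y. y + t *\<^sub>R axis i 1" and f'="\<lambda>h. h", rotated])
        (auto intro!: derivative_eq_intros)
    then show ?thesis by (rule has_derivative_at_withinI)
  qed
  have "((\<lambda>y. integral ?I (\<lambda>t. \<phi> (y + t *\<^sub>R axis i 1))) has_derivative
      blinfun_apply (integral ?I (\<lambda>t. grad \<phi> (x + t *\<^sub>R axis i 1)))) (at x within ball x 1)"
    using contg
    by (intro leibniz_rule der) (auto simp: split_beta intro!: integrable_continuous_real
      continuous_on_ray smooth_continuous_on smooth)
  then have "((\<lambda>y. integral ?I (\<lambda>t. \<phi> (y + t *\<^sub>R axis i 1))) has_derivative
      blinfun_apply (integral ?I (\<lambda>t. grad \<phi> (x + t *\<^sub>R axis i 1)))) (at x)"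
    by (subst (asm) at_within_open[of x "ball x 1"]) auto
  then have D: "(ray_integral B i \<phi> has_derivative
      blinfun_apply (integral ?I (\<lambda>t. grad \<phi> (x + t *\<^sub>R axis i 1)))) (at x)"
    by (rule has_derivative_transform_within_open[where s="ball x 1"])
      (use ray_integral_eq_interval[OF smooth_continuous_on[OF smooth] supp(1) _ b] yK in auto)
  then show "ray_integral B i \<phi> differentiable (at x)" by (auto simp: differentiable_def)
  have "partial_deriv j (ray_integral B i \<phi>) x =
      integral ?I (\<lambda>t. blinfun_apply (grad \<phi> (x + t *\<^sub>R axis i 1)) (axis j 1))"
    using partial_deriv_eqI[OF D, of j] contg2[of ?I]
    by (simp add: blinfun_apply_integral integrable_continuous_real)
  also have "\<dots> = ray_integral B i (partial_deriv j \<phi>) x"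
  proof -
    have "ray_integral B i (partial_deriv j \<phi>) x =
        integral {- (K + L)..b} (\<lambda>t. partial_deriv j \<phi> (x + t *\<^sub>R axis i 1))"
      by (rule ray_integral_eq_interval[OF _ _ _ b])
        (auto intro: smooth_continuous_on smooth_partial_deriv smooth
          partial_deriv_support[OF smooth supp(1)] yK)
    then show ?thesis by (simp add: grad_axis)
  qed
  finally show "partial_deriv j (ray_integral B i \<phi>) x = ray_integral B i (partial_deriv j \<phi>) x" .
qed

text \<open>Differentiating a ray integral gives the ray integral of a derivative, so the ray
  integrals of test functions form an invariant class. They need not have compact support, hence
  only smoothness.\<close>

lemma smooth_ray_integral:
  assumes "\<phi> \<in> test_functions" "initial_ray B"
  shows "smooth (ray_integral B i \<phi>)"
proof (rule smoothI_invariant[where S="ray_integral B i ` test_functions"])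
  fix f assume "f \<in> ray_integral B i ` test_functions"
  then obtain \<psi> where f: "f = ray_integral B i \<psi>" and \<psi>: "\<psi> \<in> test_functions" by blast
  then obtain L where L: "smooth \<psi>" "L > 0" "\<And>x. x \<notin> cube L \<Longrightarrow> \<psi> x = 0"
    by (metis test_functionE)
  show "f differentiable_on UNIV"
    using ray_integral_differentiable[OF L(1,3,2) assms(2)] by (simp add: f differentiable_on_def)
  fix j
  have "partial_deriv j f = ray_integral B i (partial_deriv j \<psi>)"
    using partial_deriv_ray_integral[OF L(1,3,2) assms(2)] by (auto simp: f)
  then show "partial_deriv j f \<in> ray_integral B i ` test_functions"
    using test_function_partial_deriv[OF \<psi>] by blast
qed (use assms in blast)

lemma ray_integral_partial_deriv:
  fixes \<phi> :: "real ^ 'n::finite \<Rightarrow> complex"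
  assumes "\<phi> \<in> test_functions"
  shows "ray_integral {..0} i (partial_deriv i \<phi>) = \<phi>"
proof
  fix x :: "real ^ 'n"
  obtain L where L: "smooth \<phi>" "L > 0" "\<And>x. x \<notin> cube L \<Longrightarrow> \<phi> x = 0"
    using assms by (rule test_functionE) blast
  \<comment> \<open>The extra 1 puts the lower end of the ray at coordinate at most
    \<open>- L - 1\<close>, outside the cube, so the boundary term there vanishes.\<close>
  define K where "K = \<bar>x $ i\<bar> + 1"
  have KL: "K + L > 0" and K: "\<bar>x $ i\<bar> \<le> K" using L(2) by (auto simp: K_def)
  have "ray_integral {..0} i (partial_deriv i \<phi>) x =
      integral {- (K + L)..0} (\<lambda>t. partial_deriv i \<phi> (x + t *\<^sub>R axis i 1))"
    by (rule ray_integral_eq_interval[OF smooth_continuous_on[OF smooth_partial_deriv[OF L(1)]]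
        partial_deriv_support[OF L(1,3)] K]) (use KL in auto)
  also have "\<dots> = \<phi> (x + 0 *\<^sub>R axis i 1) - \<phi> (x + (- (K + L)) *\<^sub>R axis i 1)"
    using KL by (intro integral_unique fundamental_theorem_of_calculus
        has_vector_derivative_at_within[OF partial_deriv_has_vector_derivative]
        smooth_differentiable[OF L(1)]) auto
  also have "\<phi> (x + (- (K + L)) *\<^sub>R axis i 1) = 0"
    by (rule L(3)) (use K_def L(2) in \<open>auto simp: cube_def not_le intro!: exI[of _ i]\<close>)
  finally show "ray_integral {..0} i (partial_deriv i \<phi>) x = \<phi> x" by simp
qed

lemma partial_deriv_ray_integral_test:
  assumes "\<phi> \<in> test_functions" "initial_ray B"
  shows "partial_deriv j (ray_integral B i \<phi>) = ray_integral B i (partial_deriv j \<phi>)"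
proof -
  obtain L where L: "smooth \<phi>" "L > 0" "\<And>x. x \<notin> cube L \<Longrightarrow> \<phi> x = 0"
    using assms(1) by (rule test_functionE) blast
  show ?thesis using partial_deriv_ray_integral[OF L(1,3,2) assms(2)] by auto
qed

text \<open>Integrating along a ray commutes with all partial derivatives and inverts one of them.\<close>

lemma partial_deriv_commute:
  assumes "\<phi> \<in> test_functions"
  shows "partial_deriv i (partial_deriv j \<phi>) = partial_deriv j (partial_deriv i \<phi>)"
proof -
  let ?P = "ray_integral {..0} i"
  let ?\<chi> = "partial_deriv i \<phi>"
  have \<chi>: "?\<chi> \<in> test_functions" using assms by (rule test_function_partial_deriv)
  have "partial_deriv j \<phi> = ?P (partial_deriv j ?\<chi>)"
    using ray_integral_partial_deriv[OF assms, of i]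
      partial_deriv_ray_integral_test[OF \<chi> initial_ray_atMost, of j i] by simp
  then have "partial_deriv i (partial_deriv j \<phi>) = ?P (partial_deriv i (partial_deriv j ?\<chi>))"
    using partial_deriv_ray_integral_test[OF test_function_partial_deriv[OF \<chi>] initial_ray_atMost] by simp
  also have "\<dots> = partial_deriv j ?\<chi>"
    by (rule ray_integral_partial_deriv) (intro test_function_partial_deriv \<chi>)
  finally show ?thesis .
qed

section \<open>Multi-index derivatives\<close>

definition unit_mi :: "'n \<Rightarrow> 'n \<Rightarrow> nat" where
  "unit_mi i j = (if j = i then 1 else 0)"

lemma mi_order_unit: "mi_order (unit_mi i) = 1"
  by (simp add: mi_order_def unit_mi_def)

lemma mi_order_add: "mi_order (\<lambda>j. \<alpha> j + \<beta> j) = mi_order \<alpha> + mi_order \<beta>"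
  by (simp add: mi_order_def sum.distrib)

lemma coord_list: "distinct (coord_list :: 'n::finite list)" "set (coord_list :: 'n list) = UNIV"
proof -
  have "distinct (coord_list :: 'n list) \<and> set (coord_list :: 'n list) = UNIV"
    unfolding coord_list_def by (rule someI_ex) (use finite_distinct_list[of "UNIV :: 'n set"] in auto)
  then show "distinct (coord_list :: 'n list)" "set (coord_list :: 'n list) = UNIV" by auto
qed

lemma test_function_partial_deriv_funpow:
  "\<phi> \<in> test_functions \<Longrightarrow> (partial_deriv i ^^ m) \<phi> \<in> test_functions"
  by (induction m) (auto intro: test_function_partial_deriv)

lemma test_function_fold_partial_deriv:
  "\<phi> \<in> test_functions \<Longrightarrow> fold (\<lambda>i. partial_deriv i ^^ \<alpha> i) is \<phi> \<in> test_functions"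
  by (induction "is" arbitrary: \<phi>) (auto intro: test_function_partial_deriv_funpow)

lemma test_function_multi_deriv: "\<phi> \<in> test_functions \<Longrightarrow> multi_deriv \<alpha> \<phi> \<in> test_functions"
  unfolding multi_deriv_def by (rule test_function_fold_partial_deriv)

lemma partial_deriv_funpow_commute:
  "\<phi> \<in> test_functions \<Longrightarrow>
    (partial_deriv j ^^ m) (partial_deriv i \<phi>) = partial_deriv i ((partial_deriv j ^^ m) \<phi>)"
  by (induction m) (auto simp: partial_deriv_commute test_function_partial_deriv_funpow)

lemma partial_deriv_fold_commute:
  "\<phi> \<in> test_functions \<Longrightarrow>
    fold (\<lambda>i. partial_deriv i ^^ \<alpha> i) is (partial_deriv i \<phi>) =
    partial_deriv i (fold (\<lambda>i. partial_deriv i ^^ \<alpha> i) is \<phi>)"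
  by (induction "is" arbitrary: \<phi>)
    (auto simp: partial_deriv_funpow_commute test_function_partial_deriv_funpow)

text \<open>Because the list is distinct, the additional derivative occurs exactly once; commuting
  partial derivatives then move it to the outside.\<close>

lemma fold_partial_deriv_unit:
  assumes "distinct is" "\<phi> \<in> test_functions"
  shows "fold (\<lambda>j. partial_deriv j ^^ (\<alpha> j + unit_mi i j)) is \<phi> =
    (if i \<in> set is then partial_deriv i (fold (\<lambda>j. partial_deriv j ^^ \<alpha> j) is \<phi>)
     else fold (\<lambda>j. partial_deriv j ^^ \<alpha> j) is \<phi>)"
  using assms
  by (induction "is" arbitrary: \<phi>)
    (auto simp: unit_mi_def test_function_partial_deriv_funpow partial_deriv_fold_commute
      test_function_partial_deriv)

lemma multi_deriv_add_unit:
  "\<phi> \<in> test_functions \<Longrightarrow> multi_deriv (\<lambda>j. \<alpha> j + unit_mi i j) \<phi> = partial_deriv i (multi_deriv \<alpha> \<phi>)"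
  unfolding multi_deriv_def by (simp add: fold_partial_deriv_unit coord_list)

lemma multi_deriv_zero: "multi_deriv (\<lambda>_. 0) \<phi> = \<phi>"
proof -
  have "fold (\<lambda>i f. f) is \<phi> = \<phi>" for "is" :: "'a list" by (induction "is") auto
  then show ?thesis by (simp add: multi_deriv_def id_def)
qed

lemma multi_deriv_unit:
  "\<phi> \<in> test_functions \<Longrightarrow> multi_deriv (unit_mi i) \<phi> = partial_deriv i \<phi>"
  using multi_deriv_add_unit[of \<phi> "\<lambda>_. 0" i] by (simp add: multi_deriv_zero)

section \<open>Bump functions and the fundamental lemma of the calculus of variations\<close>

text \<open>All derivatives of \<open>exp (- (1 / s))\<close>, extended by 0, have this shape; the
  polynomial in \<open>1 / s\<close> makes the family closed under differentiation.\<close>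

definition poly_exp :: "real poly \<Rightarrow> real \<Rightarrow> real" where
  "poly_exp p s = (if s > 0 then poly p (1 / s) * exp (- (1 / s)) else 0)"

lemma tendsto_poly_times_exp_minus:
  fixes p :: "real poly"
  shows "((\<lambda>y. poly p y * exp (- y)) \<longlongrightarrow> 0) at_top"
proof -
  have "((\<lambda>y. \<Sum>i\<le>degree p. coeff p i * (y ^ i / exp y)) \<longlongrightarrow> (\<Sum>i\<le>degree p. coeff p i * 0)) at_top"
    by (intro tendsto_intros tendsto_power_div_exp_0)
  then show ?thesis
    by (simp add: poly_altdef sum_distrib_right exp_minus divide_inverse mult.assoc)
qed

text \<open>With \<open>y = 1 / s\<close> one has \<open>d/ds = - y^2 d/dy\<close>, which turns
  \<open>p y exp (-y)\<close> into \<open>y^2 (p - p') y exp (-y)\<close>; the factor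
  \<open>[:0, 0, 1:]\<close> is \<open>y^2\<close>. At 0 both one-sided difference quotients tend to
  0, since the exponential beats every polynomial.\<close>

lemma poly_exp_has_field_derivative:
  "(poly_exp p has_field_derivative poly_exp ([:0, 0, 1:] * (p - pderiv p)) s) (at s)"
proof -
  consider "s > 0" | "s < 0" | "s = 0" by linarith
  then show ?thesis
  proof cases
    case 1
    have "((\<lambda>s. poly p (1 / s) * exp (- (1 / s))) has_field_derivative
        poly_exp ([:0, 0, 1:] * (p - pderiv p)) s) (at s)"
      using 1 by (auto intro!: derivative_eq_intros simp: poly_exp_def field_simps power2_eq_square)
    then show ?thesis
      by (rule DERIV_cong_ev[THEN iffD1, rotated -1, OF _ refl _ refl])
        (use 1 in \<open>auto simp: poly_exp_def intro!: eventually_mono[OF order_tendstoD(1)[OF tendsto_ident_at 1]]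
          eventually_nhds_in_open[of "{0<..}", THEN eventually_mono]\<close>)
  next
    case 2
    have "((\<lambda>s. 0) has_field_derivative poly_exp ([:0, 0, 1:] * (p - pderiv p)) s) (at s)"
      using 2 by (auto simp: poly_exp_def)
    then show ?thesis
      by (rule DERIV_cong_ev[THEN iffD1, rotated -1, OF _ refl _ refl])
        (use 2 in \<open>auto simp: poly_exp_def intro!: eventually_nhds_in_open[of "{..<0}", THEN eventually_mono]\<close>)
  next
    case 3
    have "((\<lambda>h. poly_exp p h / h) \<longlongrightarrow> 0) (at_right 0)"
    proof -
      \<comment> \<open>Dividing by \<open>h\<close> multiplies the polynomial in
        \<open>1 / h\<close> by its variable, which gives \<open>[:0, 1:] * p\<close>.\<close>
      have "((\<lambda>h. poly ([:0, 1:] * p) (inverse h) * exp (- inverse h)) \<longlongrightarrow> 0) (at_right (0::real))"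
        by (rule filterlim_compose[OF tendsto_poly_times_exp_minus filterlim_inverse_at_top_right])
      then show ?thesis
        by (rule Lim_transform_eventually)
          (auto simp: poly_exp_def divide_inverse eventually_at_right_less intro!: eventually_at_rightI[of 0 1])
    qed
    moreover have "((\<lambda>h. poly_exp p h / h) \<longlongrightarrow> 0) (at_left 0)"
      by (rule Lim_transform_eventually[OF tendsto_const])
        (auto simp: poly_exp_def intro!: eventually_at_leftI[of "-1"])
    ultimately have "((\<lambda>h. poly_exp p h / h) \<longlongrightarrow> 0) (at 0)"
      by (simp add: filterlim_at_split)
    then show ?thesis using 3 by (simp add: has_field_derivative_iff poly_exp_def)
  qed
qed

definition smooth_step :: "real \<Rightarrow> real" where
  "smooth_step s = (if s > 0 then exp (- (1 / s)) else 0)"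

lemma smooth_step_eq_poly_exp: "smooth_step = poly_exp 1"
  by (auto simp: smooth_step_def poly_exp_def)

lemma smooth_step_bounds: "0 \<le> smooth_step s" "smooth_step s \<le> 1"
  by (auto simp: smooth_step_def)

lemma smooth_step_eq_0: "s \<le> 0 \<Longrightarrow> smooth_step s = 0"
  by (auto simp: smooth_step_def)

lemma continuous_on_smooth_step: "continuous_on A smooth_step"
  unfolding smooth_step_eq_poly_exp
  using poly_exp_has_field_derivative DERIV_isCont continuous_at_imp_continuous_on by blast

lemma smooth_step_measurable [measurable]: "smooth_step \<in> borel_measurable borel"
  by (rule borel_measurable_continuous_onI) (rule continuous_on_smooth_step)

text \<open>Under dilation positive arguments are driven to the value 1 while nonpositive ones keep
  the value 0, so products of dilated steps approximate indicators of open boxes from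
  inside.\<close>

lemma tendsto_smooth_step: "c > 0 \<Longrightarrow> (\<lambda>m. smooth_step (real m * c)) \<longlonglongrightarrow> 1"
proof -
  assume c: "c > 0"
  have "(\<lambda>m. exp (- (inverse (real m) * (1 / c)))) \<longlonglongrightarrow> exp (- (0 * (1 / c)))"
    by (intro tendsto_intros lim_inverse_n)
  then have "(\<lambda>m. exp (- (inverse (real m) * (1 / c)))) \<longlonglongrightarrow> 1" by simp
  then show ?thesis
    by (rule Lim_transform_eventually)
      (use c in \<open>auto simp: smooth_step_def field_simps intro!: eventually_mono[OF eventually_gt_at_top[of 0]]\<close>)
qed

text \<open>The scalar \<open>c\<close> in the invariant class absorbs the factors of the chain
  rule, including the factor 0 for derivatives in the other coordinate directions.\<close>

lemma smooth_poly_exp_coordinate: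
  "smooth (\<lambda>x :: real ^ 'n::finite. complex_of_real (poly_exp p (a + b * x $ i)))"
proof (rule smoothI_invariant[where
      S="range (\<lambda>(c, p). \<lambda>x :: real ^ 'n. complex_of_real (c * poly_exp p (a + b * x $ i)))"])
  have D: "((\<lambda>x :: real ^ 'n. complex_of_real (c * poly_exp p (a + b * x $ i))) has_derivative
      (\<lambda>h. complex_of_real (h $ i * (c * b * poly_exp ([:0, 0, 1:] * (p - pderiv p)) (a + b * x $ i)))))
      (at x)" for c p x
  proof -
    have "((\<lambda>x :: real ^ 'n. poly_exp p (a + b * x $ i)) has_derivative
        (\<lambda>h. poly_exp ([:0, 0, 1:] * (p - pderiv p)) (a + b * x $ i) * (b * h $ i))) (at x)"
      by (rule has_derivative_compose[where g="poly_exp p" and f="\<lambda>x :: real ^ 'n. a + b * x $ i",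
            OF _ poly_exp_has_field_derivative[unfolded has_field_derivative_def]])
        (auto intro!: derivative_eq_intros bounded_linear_imp_has_derivative bounded_linear_vec_nth)
    then have "((\<lambda>x :: real ^ 'n. complex_of_real (c * poly_exp p (a + b * x $ i))) has_derivative
        (\<lambda>h. complex_of_real (c * (poly_exp ([:0, 0, 1:] * (p - pderiv p)) (a + b * x $ i) * (b * h $ i))))) (at x)"
      by (intro has_derivative_of_real has_derivative_mult_right)
    then show ?thesis by (simp add: mult_ac)
  qed
  fix f assume "f \<in> range (\<lambda>(c, p). \<lambda>x :: real ^ 'n. complex_of_real (c * poly_exp p (a + b * x $ i)))"
  then obtain c p where f: "f = (\<lambda>x. complex_of_real (c * poly_exp p (a + b * x $ i)))" by auto
  show "f differentiable_on UNIV"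
    using D unfolding f differentiable_on_def differentiable_def by blast
  fix j
  have "partial_deriv j f = (\<lambda>x. complex_of_real
      ((axis j 1 $ i * (c * b)) * poly_exp ([:0, 0, 1:] * (p - pderiv p)) (a + b * x $ i)))"
    unfolding f by (rule ext, subst partial_deriv_eqI[OF D]) (simp add: mult.assoc)
  then show "partial_deriv j f \<in>
      range (\<lambda>(c, p). \<lambda>x :: real ^ 'n. complex_of_real (c * poly_exp p (a + b * x $ i)))"
    by (auto intro!: image_eqI[of _ _ "(axis j 1 $ i * (c * b), [:0, 0, 1:] * (p - pderiv p))"])
qed (auto intro!: image_eqI[of _ _ "(1, p)"])

lemma smooth_smooth_step_coordinate:
  "smooth (\<lambda>x :: real ^ 'n::finite. complex_of_real (smooth_step (a + b * x $ i)))"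
  unfolding smooth_step_eq_poly_exp by (rule smooth_poly_exp_coordinate)

definition bump_mass :: real where
  "bump_mass = (LINT s|lborel. smooth_step (1 + s) * smooth_step (1 - s))"

lemma integrable_bump: "integrable lborel (\<lambda>s. smooth_step (1 + s) * smooth_step (1 - s))"
proof -
  have "set_integrable lborel {-1..1} (\<lambda>s. smooth_step (1 + s) * smooth_step (1 - s))"
    by (intro borel_integrable_atLeastAtMost' continuous_on_mult
        continuous_on_compose2[OF continuous_on_smooth_step[of UNIV]] continuous_intros) auto
  moreover have "indicator {-1..1} s *\<^sub>R (smooth_step (1 + s) * smooth_step (1 - s)) =
      smooth_step (1 + s) * smooth_step (1 - s)" for s
    by (auto simp: indicator_def smooth_step_def)
  ultimately show ?thesis unfolding set_integrable_def by (simp only:)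
qed

text \<open>A nonnegative integrand with integral 0 vanishes almost everywhere, but this one is
  positive on an interval of length 2.\<close>

lemma bump_mass_pos: "bump_mass > 0"
proof (rule ccontr)
  assume "\<not> bump_mass > 0"
  moreover have "bump_mass \<ge> 0"
    unfolding bump_mass_def by (intro integral_nonneg_AE AE_I2) (simp add: smooth_step_bounds)
  ultimately have "(LINT s|lborel. smooth_step (1 + s) * smooth_step (1 - s)) = 0"
    by (simp add: bump_mass_def)
  then have "AE s in lborel. smooth_step (1 + s) * smooth_step (1 - s) = 0"
    using integral_nonneg_eq_0_iff_AE[OF integrable_bump] by (simp add: smooth_step_bounds)
  then have "AE s in lborel. s \<notin> {-1<..<1::real}"
    by eventually_elim (auto simp: smooth_step_def split: if_splits)
  then have "emeasure lborel {-1<..<1::real} = 0"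
    by (subst (asm) AE_iff_measurable[OF _ refl]) (auto simp: greaterThanLessThan_def greaterThan_def lessThan_def Collect_conj_eq)
  then show False by simp
qed

text \<open>A probability density supported in \<open>[-R, R]\<close>. Its height of order
  \<open>1 / R\<close> later cancels the length \<open>2 * R\<close> of the line segments over which
  it averages.\<close>

definition bump :: "real \<Rightarrow> real \<Rightarrow> real" where
  "bump R s = smooth_step (1 + s / R) * smooth_step (1 - s / R) / (R * bump_mass)"

lemma bump_measurable [measurable]: "bump R \<in> borel_measurable borel"
  unfolding bump_def by measurable

lemma bump_bounds:
  assumes "R > 0"
  shows "0 \<le> bump R s" "bump R s \<le> 1 / (R * bump_mass)"
  using assms bump_mass_pos smooth_step_bounds[of "1 + s / R"] smooth_step_bounds[of "1 - s / R"]
  by (auto simp: bump_def divide_simps mult_le_one)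

lemma bump_support: "R > 0 \<Longrightarrow> \<bar>s\<bar> > R \<Longrightarrow> bump R s = 0"
  by (auto simp: bump_def smooth_step_def abs_real_def field_simps split: if_splits)

lemma
  assumes "R > 0"
  shows integrable_scaled_bump: "integrable lborel (bump R)"
    and integral_bump: "(LINT s|lborel. bump R s) = 1"
proof -
  have eq: "bump R = (\<lambda>s. smooth_step (1 + (0 + (1 / R) * s)) * smooth_step (1 - (0 + (1 / R) * s)) / (R * bump_mass))"
    by (rule ext) (simp add: bump_def)
  show "integrable lborel (bump R)" unfolding eq
    using assms by (intro integrable_divide_zero lborel_integrable_real_affine integrable_bump) auto
  have "bump_mass = \<bar>1 / R\<bar> * (LINT s|lborel. smooth_step (1 + (0 + (1 / R) * s)) * smooth_step (1 - (0 + (1 / R) * s)))"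
    unfolding bump_mass_def using assms
    by (subst lborel_integral_real_affine[of "1 / R" _ 0]) auto
  then have "(LINT s|lborel. smooth_step (1 + (0 + (1 / R) * s)) * smooth_step (1 - (0 + (1 / R) * s))) = R * bump_mass"
    using assms by (simp add: field_simps)
  then show "(LINT s|lborel. bump R s) = 1" unfolding eq
    using assms bump_mass_pos by simp
qed

lemma smooth_bump_coordinate: "smooth (\<lambda>x :: real ^ 'n::finite. complex_of_real (bump R (x $ i)))"
proof -
  have "smooth (\<lambda>x :: real ^ 'n. complex_of_real (1 / (R * bump_mass)) *
      (complex_of_real (smooth_step (1 + (1 / R) * x $ i)) *
       complex_of_real (smooth_step (1 + (- (1 / R)) * x $ i))))"
    by (intro smooth_mult smooth_const smooth_smooth_step_coordinate)
  then show ?thesis by (simp add: bump_def mult.commute)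
qed

section \<open>The fundamental lemma of the calculus of variations\<close>

text \<open>Borel rather than Lebesgue measurability, because the kernel operators apply Fubini's
  theorem to products with \<open>lborel\<close>.\<close>

definition locally_integrable :: "(real ^ 'n::finite \<Rightarrow> complex) \<Rightarrow> bool" where
  "locally_integrable g \<longleftrightarrow> g \<in> borel_measurable borel \<and> (\<forall>L. set_integrable lborel (cube L) g)"

lemma cube_measurable [measurable]: "cube L \<in> sets borel"
  by (simp add: cube_eq_cbox)

lemma box_bump_test_function:
  assumes "m > 0"
  shows "(\<lambda>x :: real ^ 'n::finite. \<Prod>i\<in>UNIV. complex_of_real (smooth_step (m * (x $ i - a $ i))) *
    complex_of_real (smooth_step (m * (b $ i - x $ i)))) \<in> test_functions"
proof -
  obtain L where L: "box a b \<subseteq> cube L" by (rule bounded_support_imp_cube[OF bounded_box])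
  have "smooth (\<lambda>x :: real ^ 'n. complex_of_real (smooth_step (m * (x $ i - a $ i))))" for i
    using smooth_smooth_step_coordinate[of "- m * a $ i" m i] by (simp add: algebra_simps)
  moreover have "smooth (\<lambda>x :: real ^ 'n. complex_of_real (smooth_step (m * (b $ i - x $ i))))" for i
    using smooth_smooth_step_coordinate[of "m * b $ i" "-m" i] by (simp add: algebra_simps)
  moreover have "(\<Prod>i\<in>UNIV. complex_of_real (smooth_step (m * (x $ i - a $ i))) *
    complex_of_real (smooth_step (m * (b $ i - x $ i)))) = 0" if "x \<notin> cube L" for x :: "real ^ 'n"
  proof -
    have "x \<notin> box a b" using that L by blast
    then obtain i where "x $ i \<le> a $ i \<or> b $ i \<le> x $ i" by (auto simp: mem_box_cart not_less)
    then have "smooth_step (m * (x $ i - a $ i)) = 0 \<or> smooth_step (m * (b $ i - x $ i)) = 0"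
      using assms by (auto intro!: smooth_step_eq_0 mult_nonneg_nonpos)
    then show ?thesis by (intro prod_zero) auto
  qed
  ultimately show ?thesis
    by (intro test_functionI[of _ L] smooth_prod smooth_mult) auto
qed

text \<open>Products of dilated steps are test functions bounded by 1 that vanish off the box and
  converge to its indicator; dominated convergence, with \<open>g\<close> cut off to a cube as
  majorant, carries orthogonality to the limit.\<close>

lemma integral_box_eq_0:
  fixes g :: "real ^ 'n::finite \<Rightarrow> complex"
  assumes g: "locally_integrable g" and orth: "\<And>\<phi>. \<phi> \<in> test_functions \<Longrightarrow> (LINT x|lborel. g x * \<phi> x) = 0"
  shows "(LINT x:box a b|lborel. g x) = 0"
proof -
  have [measurable]: "g \<in> borel_measurable borel" using g by (simp add: locally_integrable_def)
  obtain L where L: "box a b \<subseteq> cube L" by (rule bounded_support_imp_cube[OF bounded_box])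
  define \<phi> where "\<phi> m x = (\<Prod>i\<in>UNIV. complex_of_real (smooth_step (real m * (x $ i - a $ i))) *
    complex_of_real (smooth_step (real m * (b $ i - x $ i))))" for m x
  have \<phi>0: "\<phi> m x = 0" if x: "x \<notin> box a b" for m x
  proof -
    obtain i where "\<not> (a $ i < x $ i \<and> x $ i < b $ i)" using x unfolding mem_box_cart by blast
    then have "x $ i \<le> a $ i \<or> b $ i \<le> x $ i" by linarith
    then have "smooth_step (m * (x $ i - a $ i)) = 0 \<or> smooth_step (m * (b $ i - x $ i)) = 0"
      by (auto intro!: smooth_step_eq_0 mult_nonneg_nonpos)
    then show ?thesis unfolding \<phi>_def by (intro prod_zero) auto
  qed
  have \<phi>1: "cmod (\<phi> m x) \<le> 1" for m x
    unfolding \<phi>_def norm_mult prod_norm[symmetric]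
    by (intro prod_le_1) (auto simp: smooth_step_bounds mult_le_one)
  have \<phi>lim: "(\<lambda>m. \<phi> m x) \<longlonglongrightarrow> indicator (box a b) x" for x
  proof (cases "x \<in> box a b")
    case True
    then have "(\<lambda>m. \<phi> m x) \<longlonglongrightarrow> (\<Prod>i\<in>(UNIV::'n set). complex_of_real 1 * complex_of_real 1)"
      unfolding \<phi>_def by (intro tendsto_prod tendsto_mult tendsto_of_real tendsto_smooth_step)
        (auto simp: mem_box_cart)
    then show ?thesis using True by simp
  qed (simp add: \<phi>0)
  have "(\<lambda>m. LINT x|lborel. g x * \<phi> m x) \<longlonglongrightarrow> (LINT x|lborel. indicator (box a b) x *\<^sub>R g x)"
  proof (rule integral_dominated_convergence[where w="\<lambda>x. cmod (indicator (cube L) x *\<^sub>R g x)"])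
    show "integrable lborel (\<lambda>x. cmod (indicator (cube L) x *\<^sub>R g x))"
      using g integrable_norm unfolding locally_integrable_def set_integrable_def by blast
    show "AE x in lborel. (\<lambda>m. g x * \<phi> m x) \<longlonglongrightarrow> indicator (box a b) x *\<^sub>R g x"
    proof (rule AE_I2)
      fix x
      show "(\<lambda>m. g x * \<phi> m x) \<longlonglongrightarrow> indicator (box a b) x *\<^sub>R g x"
        using tendsto_mult[OF tendsto_const[of "g x"] \<phi>lim[of x]] by (auto simp: indicator_def)
    qed
    show "AE x in lborel. cmod (g x * \<phi> m x) \<le> cmod (indicator (cube L) x *\<^sub>R g x)" for m
    proof (rule AE_I2)
      fix x
      show "cmod (g x * \<phi> m x) \<le> cmod (indicator (cube L) x *\<^sub>R g x)"
        using L \<phi>0[of x m] \<phi>1[of m x] by (cases "x \<in> box a b") (auto simp: norm_mult mult_left_le)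
    qed
  qed (auto simp: \<phi>_def)
  moreover have "(LINT x|lborel. g x * \<phi> m x) = 0" if "m > 0" for m
    using orth[OF box_bump_test_function[of "real m" a b]] that by (simp add: \<phi>_def)
  then have "(\<lambda>m. LINT x|lborel. g x * \<phi> m x) \<longlonglongrightarrow> 0"
    by (intro tendsto_eventually eventually_mono[OF eventually_gt_at_top[of 0]]) auto
  ultimately show ?thesis
    unfolding set_lebesgue_integral_def using LIMSEQ_unique by blast
qed

text \<open>The positive and the negative part of \<open>h\<close> are densities of two measures
  that agree on open boxes. These form an intersection-stable generator of the Borel sets, so the
  measures and hence the densities agree.\<close>

lemma AE_eq_0_if_integral_box_eq_0:
  fixes h :: "real ^ 'n::finite \<Rightarrow> real"
  assumes h [measurable]: "h \<in> borel_measurable borel"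
    and int: "\<And>a b. set_integrable lborel (box a b) h"
    and zero: "\<And>a b. (LINT x:box a b|lborel. h x) = 0"
  shows "AE x in lborel. h x = 0"
proof -
  define \<mu> \<nu> where "\<mu> = density lborel (\<lambda>x. ennreal (h x))" and "\<nu> = density lborel (\<lambda>x. ennreal (- h x))"
  have em: "emeasure \<mu> (box a b) = emeasure \<nu> (box a b) \<and> emeasure \<mu> (box a b) \<noteq> \<infinity>" for a b
  proof -
    let ?f = "\<lambda>x. indicator (box a b) x * h x"
    have f: "integrable lborel ?f" using int by (simp add: set_integrable_def)
    have e1: "emeasure \<mu> (box a b) = (\<integral>\<^sup>+x. ennreal (?f x) \<partial>lborel)"
      unfolding \<mu>_def by (subst emeasure_density) (auto intro!: nn_integral_cong simp: indicator_def)
    have e2: "emeasure \<nu> (box a b) = (\<integral>\<^sup>+x. ennreal (- ?f x) \<partial>lborel)"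
      unfolding \<nu>_def by (subst emeasure_density) (auto intro!: nn_integral_cong simp: indicator_def)
    have fin: "(\<integral>\<^sup>+x. ennreal (?f x) \<partial>lborel) < \<infinity>" "(\<integral>\<^sup>+x. ennreal (- ?f x) \<partial>lborel) < \<infinity>"
      using f by (auto simp: real_integrable_def top.not_eq_extremum)
    have "enn2real (\<integral>\<^sup>+x. ennreal (?f x) \<partial>lborel) = enn2real (\<integral>\<^sup>+x. ennreal (- ?f x) \<partial>lborel)"
      using zero[of a b] real_lebesgue_integral_def[OF f] by (simp add: set_lebesgue_integral_def)
    then have "(\<integral>\<^sup>+x. ennreal (?f x) \<partial>lborel) = (\<integral>\<^sup>+x. ennreal (- ?f x) \<partial>lborel)"
      using fin by (metis ennreal_enn2real infinity_ennreal_def)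
    then show ?thesis using e1 e2 fin by auto
  qed
  have "\<mu> = \<nu>"
  proof (rule measure_eqI_generator_eq)
    let ?E = "range (\<lambda>(a, b). box a b :: (real ^ 'n) set)"
    show "Int_stable ?E" by (auto simp: Int_stable_def box_Int_box)
    show "?E \<subseteq> Pow UNIV" "sets \<mu> = sigma_sets UNIV ?E" "sets \<nu> = sigma_sets UNIV ?E"
      by (simp_all add: borel_eq_box \<mu>_def \<nu>_def)
    let ?A = "\<lambda>n::nat. box (- (real n *\<^sub>R One)) (real n *\<^sub>R One) :: (real ^ 'n) set"
    show "range ?A \<subseteq> ?E" "(\<Union>i. ?A i) = UNIV" unfolding UN_box_eq_UNIV by auto
    show "emeasure \<mu> (?A i) \<noteq> \<infinity>" for i using em by blast
    show "emeasure \<mu> X = emeasure \<nu> X" if "X \<in> ?E" for X using that em by auto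
  qed
  then have "AE x in lborel. ennreal (h x) = ennreal (- h x)"
    unfolding \<mu>_def \<nu>_def by (subst (asm) sigma_finite_measure.density_unique_iff[OF sigma_finite_lborel]) auto
  then show ?thesis
  proof eventually_elim
    \<comment> \<open>Since \<open>ennreal\<close> truncates negative numbers to 0, the equation
      compares the positive part with the negative part, at most one of which is nonzero.\<close>
    fix x assume "ennreal (h x) = ennreal (- h x)"
    then show "h x = 0" by (cases "h x \<ge> 0") (auto simp: ennreal_neg ennreal_eq_0_iff)
  qed
qed

text \<open>Makes the functions that represent one functional at different scales coincide almost
  everywhere.\<close>

lemma AE_eq_0_if_orthogonal_test_functions:
  fixes g :: "real ^ 'n::finite \<Rightarrow> complex"
  assumes g: "locally_integrable g"
    and orth: "\<And>\<phi>. \<phi> \<in> test_functions \<Longrightarrow> (LINT x|lborel. g x * \<phi> x) = 0"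
  shows "AE x in lborel. g x = 0"
proof -
  have [measurable]: "g \<in> borel_measurable borel" using g by (simp add: locally_integrable_def)
  have int: "set_integrable lborel (box a b) g" for a b
  proof -
    obtain L where "box a b \<subseteq> cube L" by (rule bounded_support_imp_cube[OF bounded_box])
    then show ?thesis
      using g set_integrable_subset[of lborel "cube L" g "box a b"] by (auto simp: locally_integrable_def)
  qed
  note zero = integral_box_eq_0[OF g orth]
  have "AE x in lborel. Re (g x) = 0"
  proof (rule AE_eq_0_if_integral_box_eq_0)
    fix a b :: "real ^ 'n"
    show "set_integrable lborel (box a b) (\<lambda>x. Re (g x))"
      using integrable_Re[OF int[of a b, unfolded set_integrable_def]] by (simp add: set_integrable_def)
    show "(LINT x:box a b|lborel. Re (g x)) = 0"
      using integral_Re[OF int[of a b, unfolded set_integrable_def]] zero[of a b]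
      by (simp add: set_lebesgue_integral_def)
  qed measurable
  moreover have "AE x in lborel. Im (g x) = 0"
  proof (rule AE_eq_0_if_integral_box_eq_0)
    fix a b :: "real ^ 'n"
    show "set_integrable lborel (box a b) (\<lambda>x. Im (g x))"
      using integrable_Im[OF int[of a b, unfolded set_integrable_def]] by (simp add: set_integrable_def)
    show "(LINT x:box a b|lborel. Im (g x)) = 0"
      using integral_Im[OF int[of a b, unfolded set_integrable_def]] zero[of a b]
      by (simp add: set_lebesgue_integral_def)
  qed measurable
  ultimately show ?thesis by eventually_elim (simp add: complex_eq_iff)
qed

section \<open>Local \<open>L\<^sup>p\<close> bounds and one-coordinate kernel operators\<close>

definition coord_shift :: "'n::finite \<Rightarrow> real \<Rightarrow> real ^ 'n \<Rightarrow> real ^ 'n" where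
  "coord_shift i t x = x + t *\<^sub>R axis i 1"

lemma coord_shift_nth: "coord_shift i t x $ j = (if j = i then x $ i + t else x $ j)"
  by (auto simp: coord_shift_def axis_def)

lemma coord_shift_measurable [measurable (raw)]:
  assumes [measurable]: "f \<in> borel_measurable M" "g \<in> borel_measurable M"
  shows "(\<lambda>z. coord_shift i (f z) (g z)) \<in> borel_measurable M"
  unfolding coord_shift_def by measurable

lemma vec_nth_measurable [measurable (raw)]:
  fixes f :: "'a \<Rightarrow> real ^ 'n::finite"
  assumes [measurable]: "f \<in> borel_measurable M"
  shows "(\<lambda>z. f z $ i) \<in> borel_measurable M"
  by (rule measurable_compose[OF assms]) (simp add: borel_measurable_continuous_onI continuous_on_component)

lemma coord_shift_in_cube:
  "coord_shift i t x \<in> cube \<rho> \<Longrightarrow> \<bar>x $ i\<bar> \<le> \<rho> \<Longrightarrow> x \<in> cube \<rho> \<and> \<bar>x $ i + t\<bar> \<le> \<rho>"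
  unfolding cube_def mem_Collect_eq coord_shift_nth by (metis (full_types))

lemma in_cube_coord_shift: "x \<in> cube \<rho> \<Longrightarrow> \<bar>x $ i + t\<bar> \<le> \<rho> \<Longrightarrow> coord_shift i t x \<in> cube \<rho>"
  unfolding cube_def mem_Collect_eq coord_shift_nth by simp

abbreviation lborel_line :: "((real ^ 'n::finite) \<times> real) measure" where
  "lborel_line \<equiv> lborel \<Otimes>\<^sub>M lborel"

text \<open>The involution that exchanges a point with its shifted copy. It preserves the product
  measure and thereby transposes the kernel operators.\<close>

definition shear :: "'n::finite \<Rightarrow> (real ^ 'n) \<times> real \<Rightarrow> (real ^ 'n) \<times> real" where
  "shear i z = (coord_shift i (snd z) (fst z), - snd z)"

lemma shear_measurable [measurable]: "shear i \<in> lborel_line \<rightarrow>\<^sub>M lborel_line"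
  unfolding shear_def by measurable

lemma nn_integral_lborel_coord_shift:
  assumes [measurable]: "f \<in> borel_measurable borel"
  shows "(\<integral>\<^sup>+x. f (coord_shift i t x) \<partial>lborel) = (\<integral>\<^sup>+x. f x \<partial>lborel)"
  by (subst (2) lborel_distr_plus[of "t *\<^sub>R axis i 1", symmetric])
    (simp add: nn_integral_distr coord_shift_def add.commute)

lemma nn_integral_lborel_uminus:
  assumes [measurable]: "f \<in> borel_measurable borel"
  shows "(\<integral>\<^sup>+t. f (- t) \<partial>lborel) = (\<integral>\<^sup>+t. f (t::real) \<partial>lborel)"
  by (subst (2) nn_integral_real_affine[where c="-1" and t=0]) auto

text \<open>With \<open>t\<close> as the outer variable the map is a translation on each slice,
  followed by a reflection in \<open>t\<close>.\<close>

lemma nn_integral_shear: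
  assumes [measurable]: "g \<in> borel_measurable lborel_line"
  shows "(\<integral>\<^sup>+z. g (shear i z) \<partial>lborel_line) = (\<integral>\<^sup>+z. g z \<partial>lborel_line)"
proof -
  have "(\<integral>\<^sup>+z. g (shear i z) \<partial>lborel_line) = (\<integral>\<^sup>+t. \<integral>\<^sup>+x. g (coord_shift i t x, - t) \<partial>lborel \<partial>lborel)"
    by (subst lborel_pair.nn_integral_snd[symmetric]) (auto simp: shear_def)
  also have "\<dots> = (\<integral>\<^sup>+t. \<integral>\<^sup>+x. g (x, - t) \<partial>lborel \<partial>lborel)"
    by (intro nn_integral_cong nn_integral_lborel_coord_shift[where f="\<lambda>x. g (x, _)"]) measurable
  also have "\<dots> = (\<integral>\<^sup>+t. \<integral>\<^sup>+x. g (x, t) \<partial>lborel \<partial>lborel)"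
    by (intro nn_integral_lborel_uminus[where f="\<lambda>t. \<integral>\<^sup>+x. g (x, t) \<partial>lborel"]) measurable
  finally show ?thesis by (simp add: lborel_pair.nn_integral_snd)
qed

lemma distr_shear: "distr lborel_line lborel_line (shear i) = lborel_line"
proof (rule measure_eqI)
  fix S assume S: "S \<in> sets (distr lborel_line lborel_line (shear i))"
  then have [measurable]: "S \<in> sets lborel_line" by simp
  have "emeasure (distr lborel_line lborel_line (shear i)) S =
      (\<integral>\<^sup>+z. indicator S z \<partial>distr lborel_line lborel_line (shear i))"
    by (rule nn_integral_indicator[OF S, symmetric])
  also have "\<dots> = (\<integral>\<^sup>+z. indicator S (shear i z) \<partial>lborel_line)"
    by (subst nn_integral_distr) auto
  also have "\<dots> = (\<integral>\<^sup>+z. indicator S z \<partial>lborel_line)" by (rule nn_integral_shear) measurable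
  also have "\<dots> = emeasure lborel_line S" by (rule nn_integral_indicator) fact
  finally show "emeasure (distr lborel_line lborel_line (shear i)) S = emeasure lborel_line S" .
qed simp

lemma
  fixes G :: "_ \<Rightarrow> complex"
  assumes [measurable]: "G \<in> borel_measurable lborel_line"
  shows integrable_shear: "integrable lborel_line (\<lambda>z. G (shear i z)) \<longleftrightarrow> integrable lborel_line G"
    and integral_shear: "(LINT z|lborel_line. G (shear i z)) = (LINT z|lborel_line. G z)"
proof -
  show "integrable lborel_line (\<lambda>z. G (shear i z)) \<longleftrightarrow> integrable lborel_line G"
    by (subst (2) distr_shear[of i, symmetric]) (simp add: integrable_distr_eq)
  show "(LINT z|lborel_line. G (shear i z)) = (LINT z|lborel_line. G z)"
    by (subst (2) distr_shear[of i, symmetric]) (simp add: integral_distr)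
qed


text \<open>In \<open>\<kappa> s t\<close> the first argument is the coordinate of the point where
  \<open>f\<close> is sampled, the second the displacement leading there. In
  \<open>kernel_adj\<close> the roles are exchanged: \<open>f\<close> sits at \<open>x\<close>, and
  the displacement from the argument of \<open>\<phi>\<close> back to \<open>x\<close> is
  \<open>- t\<close>.\<close>

definition kernel_op ::
    "'n::finite \<Rightarrow> (real \<Rightarrow> real \<Rightarrow> real) \<Rightarrow> (real ^ 'n \<Rightarrow> complex) \<Rightarrow> real ^ 'n \<Rightarrow> complex" where
  "kernel_op i \<kappa> f x = (LINT t|lborel. f (coord_shift i t x) * complex_of_real (\<kappa> (x $ i + t) t))"

definition kernel_adj ::
    "'n::finite \<Rightarrow> (real \<Rightarrow> real \<Rightarrow> real) \<Rightarrow> (real ^ 'n \<Rightarrow> complex) \<Rightarrow> real ^ 'n \<Rightarrow> complex" where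
  "kernel_adj i \<kappa> \<phi> x = (LINT t|lborel. \<phi> (coord_shift i t x) * complex_of_real (\<kappa> (x $ i) (- t)))"

text \<open>
  The support condition makes \<open>kernel_op i \<kappa> f\<close> on a cube depend only on \<open>f\<close> on the same cube,
  so that its \<open>L\<^sup>p\<close> norm there loses no more than the side length of the cube; dually,
  \<open>kernel_adj i \<kappa>\<close> does not enlarge the supporting cube of a function.
\<close>

locale coord_kernel =
  fixes i :: "'n::finite" and \<kappa> :: "real \<Rightarrow> real \<Rightarrow> real" and c R :: real
  assumes kernel_measurable [measurable]: "case_prod \<kappa> \<in> borel_measurable (borel \<Otimes>\<^sub>M borel)"
    and kernel_bound: "\<bar>\<kappa> s t\<bar> \<le> c"
    and R_pos: "R > 0"
    and kernel_support: "R \<le> \<rho> \<Longrightarrow> \<bar>s - t\<bar> \<le> \<rho> \<Longrightarrow> \<kappa> s t \<noteq> 0 \<Longrightarrow> \<bar>s\<bar> \<le> \<rho>"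
begin

abbreviation "op \<equiv> kernel_op i \<kappa>"

abbreviation "adj \<equiv> kernel_adj i \<kappa>"

lemma c_nonneg: "c \<ge> 0"
  using kernel_bound[of 0 0] by linarith

lemma kernel_measurable' [measurable (raw)]:
  assumes [measurable]: "f \<in> borel_measurable M" "g \<in> borel_measurable M"
  shows "(\<lambda>z. \<kappa> (f z) (g z)) \<in> borel_measurable M"
  using measurable_compose[OF measurable_Pair[OF assms] kernel_measurable] by simp

lemma op_measurable:
  assumes [measurable]: "f \<in> borel_measurable borel"
  shows "op f \<in> borel_measurable borel"
  unfolding kernel_op_def by measurable

lemma adj_integrand_support:
  assumes "R \<le> \<rho>" "\<And>x. x \<notin> cube \<rho> \<Longrightarrow> \<phi> x = 0" "\<phi> (coord_shift i t x) \<noteq> 0" "\<kappa> (x $ i) (- t) \<noteq> 0"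
  shows "x \<in> cube \<rho>" "\<bar>t\<bar> \<le> 2 * \<rho>"
proof -
  have 1: "coord_shift i t x \<in> cube \<rho>" using assms(2,3) by blast
  then have "\<bar>coord_shift i t x $ i\<bar> \<le> \<rho>" unfolding cube_def by blast
  \<comment> \<open>\<open>x $ i - (- t)\<close> is the coordinate of the point where
    \<open>\<phi>\<close> is evaluated; this matches the premise \<open>s - t\<close> of
    \<open>kernel_support\<close>.\<close>
  then have 2: "\<bar>x $ i - (- t)\<bar> \<le> \<rho>" by (simp add: coord_shift_nth)
  then have 3: "\<bar>x $ i\<bar> \<le> \<rho>" by (rule kernel_support[OF assms(1) _ assms(4)])
  show "x \<in> cube \<rho>" using coord_shift_in_cube[OF 1 3] by blast
  show "\<bar>t\<bar> \<le> 2 * \<rho>" using 2 3 by linarith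
qed

lemma adj_support:
  assumes "R \<le> \<rho>" "\<And>x. x \<notin> cube \<rho> \<Longrightarrow> \<phi> x = 0" "x \<notin> cube \<rho>"
  shows "adj \<phi> x = 0"
proof -
  have eq: "\<phi> (coord_shift i t x) * complex_of_real (\<kappa> (x $ i) (- t)) = 0" for t
    using adj_integrand_support(1)[where \<phi>=\<phi>, OF assms(1,2)] assms(3) by (metis mult_eq_0_iff of_real_0)
  show ?thesis unfolding kernel_adj_def eq by simp
qed

lemma op_integrand_support:
  assumes "R \<le> \<rho>" "x \<in> cube \<rho>" "\<kappa> (x $ i + t) t \<noteq> 0"
  shows "\<bar>x $ i + t\<bar> \<le> \<rho>"
  using kernel_support[OF assms(1) _ assms(3)] assms(2) by (auto simp: cube_def)

text \<open>Both sides are iterated integrals of the same function on the product space, before and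
  after \<open>shear\<close>. Fubini applies because the support condition confines the integrand
  \<open>G\<close> to \<open>cube \<rho>\<close> times a bounded interval.\<close>

lemma integral_mult_adj:
  assumes f: "locally_integrable f"
    and \<phi> [measurable]: "\<phi> \<in> borel_measurable borel" and bd: "\<And>x. cmod (\<phi> x) \<le> b"
    and supp: "\<And>x. x \<notin> cube L \<Longrightarrow> \<phi> x = 0"
  shows "(LINT x|lborel. f x * adj \<phi> x) = (LINT x|lborel. op f x * \<phi> x)"
proof -
  have [measurable]: "f \<in> borel_measurable borel" using f by (simp add: locally_integrable_def)
  \<comment> \<open>The support condition on the kernel holds only from size \<open>R\<close> on, so
    the cube containing the support is enlarged if necessary.\<close>
  define \<rho> where "\<rho> = max L R"
  have \<rho>: "R \<le> \<rho>" "\<rho> > 0" using R_pos by (auto simp: \<rho>_def)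
  have supp\<rho>: "\<And>x. x \<notin> cube \<rho> \<Longrightarrow> \<phi> x = 0" using supp cube_mono[of L \<rho>] by (auto simp: \<rho>_def)
  have b: "b \<ge> 0" using bd[of 0] norm_ge_zero order_trans by blast
  define G where "G z = f (fst z) * \<phi> (coord_shift i (snd z) (fst z)) *
    complex_of_real (\<kappa> (fst z $ i) (- snd z))" for z
  have Gm [measurable]: "G \<in> borel_measurable lborel_line" unfolding G_def by measurable
  have fi: "integrable lborel (\<lambda>x. indicator (cube \<rho>) x *\<^sub>R f x)"
    using f by (simp add: locally_integrable_def set_integrable_def)
  have G: "integrable lborel_line G"
  proof (rule integrableI_bounded)
    have Gle: "norm (G z) \<le> cmod (indicator (cube \<rho>) (fst z) *\<^sub>R f (fst z)) * (b * c) * indicator {- (2 * \<rho>)..2 * \<rho>} (snd z)"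
      for z
    proof (cases "G z = 0")
      case True
      then show ?thesis using b c_nonneg by (auto simp: indicator_def)
    next
      case False
      then have "\<phi> (coord_shift i (snd z) (fst z)) \<noteq> 0" "\<kappa> (fst z $ i) (- snd z) \<noteq> 0"
        by (auto simp: G_def)
      note * = adj_integrand_support[where \<phi>=\<phi>, OF \<rho>(1) supp\<rho> this]
      have "cmod (\<phi> (coord_shift i (snd z) (fst z))) * \<bar>\<kappa> (fst z $ i) (- snd z)\<bar> \<le> b * c"
        by (intro mult_mono bd kernel_bound b) simp
      then have "cmod (f (fst z)) * (cmod (\<phi> (coord_shift i (snd z) (fst z))) * \<bar>\<kappa> (fst z $ i) (- snd z)\<bar>)
          \<le> cmod (f (fst z)) * (b * c)"
        by (intro mult_left_mono) auto
      moreover have "snd z \<in> {- (2 * \<rho>)..2 * \<rho>}" using *(2) by (auto simp: abs_le_iff)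
      ultimately show ?thesis using *(1) by (simp add: G_def norm_mult mult.assoc)
    qed
    have "(\<integral>\<^sup>+z. ennreal (norm (G z)) \<partial>lborel_line) \<le>
      (\<integral>\<^sup>+z. ennreal (cmod (indicator (cube \<rho>) (fst z) *\<^sub>R f (fst z)) * (b * c)) *
         indicator {- (2 * \<rho>)..2 * \<rho>} (snd z) \<partial>lborel_line)"
    proof (rule nn_integral_mono)
      fix z
      show "ennreal (norm (G z)) \<le> ennreal (cmod (indicator (cube \<rho>) (fst z) *\<^sub>R f (fst z)) * (b * c)) *
         indicator {- (2 * \<rho>)..2 * \<rho>} (snd z)"
        using Gle[of z] by (cases "snd z \<in> {- (2 * \<rho>)..2 * \<rho>}") (auto intro: ennreal_leI)
    qed
    also have "\<dots> = (\<integral>\<^sup>+x. \<integral>\<^sup>+t. ennreal (cmod (indicator (cube \<rho>) x *\<^sub>R f x) * (b * c)) *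
         indicator {- (2 * \<rho>)..2 * \<rho>} t \<partial>lborel \<partial>lborel)"
      by (subst lborel.nn_integral_fst[symmetric]) auto
    also have "\<dots> = (\<integral>\<^sup>+x. ennreal (cmod (indicator (cube \<rho>) x *\<^sub>R f x)) * ennreal (b * c) * ennreal (4 * \<rho>) \<partial>lborel)"
      using \<rho>(2) b c_nonneg by (intro nn_integral_cong) (simp add: nn_integral_cmult ennreal_mult')
    also have "\<dots> = (\<integral>\<^sup>+x. ennreal (cmod (indicator (cube \<rho>) x *\<^sub>R f x)) \<partial>lborel) * ennreal (b * c) * ennreal (4 * \<rho>)"
      by (simp add: nn_integral_multc)
    also have "\<dots> < \<infinity>"
      using fi by (simp add: integrable_iff_bounded ennreal_mult_less_top)
    finally show "(\<integral>\<^sup>+z. ennreal (norm (G z)) \<partial>lborel_line) < \<infinity>" .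
  qed measurable
  have Gs: "G (shear i (x, t)) = f (coord_shift i t x) * complex_of_real (\<kappa> (x $ i + t) t) * \<phi> x" for x t
  proof -
    have "coord_shift i (- t) (coord_shift i t x) = x" by (simp add: coord_shift_def)
    then show ?thesis by (simp add: G_def shear_def) (simp add: coord_shift_nth)
  qed
  have "(LINT x|lborel. f x * adj \<phi> x) = (LINT x|lborel. LINT t|lborel. G (x, t))"
    by (simp add: kernel_adj_def G_def mult.assoc)
  also have "\<dots> = (LINT z|lborel_line. G z)"
    using lborel_pair.integral_fst'[OF G] by simp
  also have "\<dots> = (LINT z|lborel_line. G (shear i z))" by (simp add: integral_shear)
  also have "\<dots> = (LINT x|lborel. LINT t|lborel. G (shear i (x, t)))"
    using lborel_pair.integral_fst'[OF integrable_shear[THEN iffD2, OF Gm G]] by simp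
  also have "\<dots> = (LINT x|lborel. LINT t|lborel. f (coord_shift i t x) * complex_of_real (\<kappa> (x $ i + t) t) * \<phi> x)"
    by (simp only: Gs)
  also have "\<dots> = (LINT x|lborel. op f x * \<phi> x)" by (simp add: kernel_op_def)
  finally show ?thesis .
qed

end


section \<open>Norm bounds on sets\<close>

text \<open>Norm bounds as inequalities between integrals, without roots and over
  \<open>lborel\<close>, so that Tonelli's theorem and convexity apply directly.\<close>

definition Lp_bound :: "ennreal \<Rightarrow> (real ^ 'n::finite) set \<Rightarrow> (real ^ 'n \<Rightarrow> complex) \<Rightarrow> real \<Rightarrow> bool" where
  "Lp_bound p A f B \<longleftrightarrow>
     (if p = \<infinity> then AE x in lborel. x \<in> A \<longrightarrow> cmod (f x) \<le> B
      else (\<integral>\<^sup>+x\<in>A. ennreal (cmod (f x) powr enn2real p) \<partial>lborel) \<le> ennreal (B powr enn2real p))"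

lemma exponent_cases:
  fixes p :: ennreal
  assumes "1 \<le> p"
  obtains (infinite) "p = \<infinity>" | (finite) r where "p = ennreal r" "r \<ge> 1"
proof (cases p)
  case (real r)
  then have "ennreal 1 \<le> ennreal r" using assms by simp
  then have "r \<ge> 1" using real(1) by (subst (asm) ennreal_le_iff) auto
  then show ?thesis using that(2) real by blast
qed (use that(1) in simp)

lemma ennroot_le_iff:
  assumes "r > 0" "B \<ge> 0"
  shows "ennroot r a \<le> ennreal B \<longleftrightarrow> a \<le> ennreal (B powr r)"
proof (cases a)
  case (real x)
  have "x powr (1 / r) \<le> B \<longleftrightarrow> x \<le> B powr r"
  proof
    assume "x powr (1 / r) \<le> B"
    then have "(x powr (1 / r)) powr r \<le> B powr r" using assms by (intro powr_mono2) auto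
    then show "x \<le> B powr r" using assms real by (simp add: powr_powr)
  next
    assume "x \<le> B powr r"
    then have "x powr (1 / r) \<le> (B powr r) powr (1 / r)" using assms real by (intro powr_mono2) auto
    then show "x powr (1 / r) \<le> B" using assms by (simp add: powr_powr)
  qed
  then show ?thesis using real assms by (simp add: ennroot_def)
qed (auto simp: ennroot_def top_unique)

text \<open>Completing the measure changes neither nonnegative integrals nor almost-everywhere
  statements. This links the working predicate to the norms in the statement.\<close>

lemma Lp_norm_le_iff:
  assumes p: "1 \<le> p" and f [measurable]: "f \<in> borel_measurable lebesgue"
    and A [measurable]: "A \<in> sets borel" and B: "B \<ge> 0"
  shows "Lp_norm p A f \<le> ennreal B \<longleftrightarrow> Lp_bound p A f B"
  using p
proof (cases rule: exponent_cases)
  case infinite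
  have A' [measurable]: "A \<in> sets lebesgue" using A by simp
  have m: "(\<lambda>x. ennreal (cmod (f x)) * indicator A x) \<in> borel_measurable lebesgue" by measurable
  have "esssup lebesgue (\<lambda>x. ennreal (cmod (f x)) * indicator A x) \<le> ennreal B \<longleftrightarrow>
      (AE x in lebesgue. ennreal (cmod (f x)) * indicator A x \<le> ennreal B)"
  proof
    assume "esssup lebesgue (\<lambda>x. ennreal (cmod (f x)) * indicator A x) \<le> ennreal B"
    then show "AE x in lebesgue. ennreal (cmod (f x)) * indicator A x \<le> ennreal B"
      using esssup_AE[of "\<lambda>x. ennreal (cmod (f x)) * indicator A x" lebesgue]
      by (auto elim!: eventually_mono)
  qed (rule esssup_I[OF m])
  also have "\<dots> \<longleftrightarrow> (AE x in lborel. x \<in> A \<longrightarrow> cmod (f x) \<le> B)"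
    unfolding AE_completion_iff using B by (intro AE_cong) (auto simp: indicator_def)
  finally show ?thesis using infinite by (simp add: Lp_norm_def Lp_bound_def)
next
  case (finite r)
  then show ?thesis using B
    by (simp add: Lp_norm_def Lp_bound_def ennroot_le_iff nn_integral_completion)
qed

lemma Lp_bound_mono_AE:
  assumes "1 \<le> p" and le: "AE x in lborel. x \<in> A \<longrightarrow> cmod (g x) \<le> a * cmod (f x)" and "a \<ge> 0"
    and "Lp_bound p A f B" and [measurable]: "f \<in> borel_measurable borel" "A \<in> sets borel" and "B \<ge> 0"
  shows "Lp_bound p A g (a * B)"
  using assms(1)
proof (cases rule: exponent_cases)
  case infinite
  have "AE x in lborel. x \<in> A \<longrightarrow> cmod (f x) \<le> B" using assms(4) infinite by (simp add: Lp_bound_def)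
  then have "AE x in lborel. x \<in> A \<longrightarrow> cmod (g x) \<le> a * B"
    using le by eventually_elim (use \<open>a \<ge> 0\<close> in \<open>meson mult_left_mono order_trans\<close>)
  then show ?thesis using infinite by (simp add: Lp_bound_def)
next
  case (finite r)
  have "(\<integral>\<^sup>+x\<in>A. ennreal (cmod (g x) powr r) \<partial>lborel) \<le>
      (\<integral>\<^sup>+x. ennreal (a powr r) * (ennreal (cmod (f x) powr r) * indicator A x) \<partial>lborel)"
  proof (rule nn_integral_mono_AE)
    show "AE x in lborel. ennreal (cmod (g x) powr r) * indicator A x \<le>
        ennreal (a powr r) * (ennreal (cmod (f x) powr r) * indicator A x)"
      using le
    proof eventually_elim
      fix x assume *: "x \<in> A \<longrightarrow> cmod (g x) \<le> a * cmod (f x)"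
      then have "x \<in> A \<Longrightarrow> cmod (g x) powr r \<le> a powr r * cmod (f x) powr r"
        using powr_mono2[of r "cmod (g x)" "a * cmod (f x)"] finite \<open>a \<ge> 0\<close> by (simp add: powr_mult)
      then show "ennreal (cmod (g x) powr r) * indicator A x \<le>
        ennreal (a powr r) * (ennreal (cmod (f x) powr r) * indicator A x)"
        by (auto simp: indicator_def simp flip: ennreal_mult)
    qed
  qed
  also have "\<dots> = ennreal (a powr r) * (\<integral>\<^sup>+x\<in>A. ennreal (cmod (f x) powr r) \<partial>lborel)"
    by (rule nn_integral_cmult) measurable
  also have "\<dots> \<le> ennreal (a powr r) * ennreal (B powr r)"
    using assms(4) finite by (intro mult_left_mono) (auto simp: Lp_bound_def)
  also have "\<dots> = ennreal ((a * B) powr r)"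
    using assms by (simp add: powr_mult flip: ennreal_mult)
  finally show ?thesis using finite by (simp add: Lp_bound_def)
qed

lemma Lp_bound_subset:
  assumes "Lp_bound p A f B" "A' \<subseteq> A"
  shows "Lp_bound p A' f B"
proof (cases "p = \<infinity>")
  case True
  have "AE x in lborel. x \<in> A \<longrightarrow> cmod (f x) \<le> B" using assms True by (simp add: Lp_bound_def)
  then have "AE x in lborel. x \<in> A' \<longrightarrow> cmod (f x) \<le> B"
    by eventually_elim (use assms(2) in blast)
  then show ?thesis using True by (simp add: Lp_bound_def)
next
  case False
  have "(\<integral>\<^sup>+x\<in>A'. ennreal (cmod (f x) powr enn2real p) \<partial>lborel) \<le>
      (\<integral>\<^sup>+x\<in>A. ennreal (cmod (f x) powr enn2real p) \<partial>lborel)"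
    using assms(2) by (intro nn_integral_mono) (auto simp: indicator_def)
  then show ?thesis using assms(1) False by (simp add: Lp_bound_def)
qed

lemma Lp_bound_mono:
  assumes "Lp_bound p A f B" "0 \<le> B" "B \<le> B'"
  shows "Lp_bound p A f B'"
proof (cases "p = \<infinity>")
  case True
  have "AE x in lborel. x \<in> A \<longrightarrow> cmod (f x) \<le> B" using assms True by (simp add: Lp_bound_def)
  then have "AE x in lborel. x \<in> A \<longrightarrow> cmod (f x) \<le> B'"
    by eventually_elim (use assms(3) in auto)
  then show ?thesis using True by (simp add: Lp_bound_def)
next
  case False
  have "B powr enn2real p \<le> B' powr enn2real p" using assms by (intro powr_mono2) auto
  then show ?thesis using assms(1) False
    by (simp add: Lp_bound_def) (meson ennreal_leI order_trans)
qed

lemma Lp_bound_zero: "B \<ge> 0 \<Longrightarrow> Lp_bound p A (\<lambda>x. 0) B"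
  by (simp add: Lp_bound_def)

text \<open>A crude substitute for Minkowski's inequality: \<open>a + b <= 2 max a b\<close> costs
  \<open>2 powr r\<close>, and the two summands cost a factor 2, which is at most another
  \<open>2 powr r\<close>; hence the 4. Constants are harmless, as the number of additions does not
  depend on the scale.\<close>

lemma Lp_bound_add:
  assumes p: "1 \<le> p" and f: "Lp_bound p A f B" and g: "Lp_bound p A g B'"
    and [measurable]: "f \<in> borel_measurable borel" "g \<in> borel_measurable borel" "A \<in> sets borel"
    and B: "B \<ge> 0" "B' \<ge> 0"
  shows "Lp_bound p A (\<lambda>x. f x + g x) (4 * (B + B'))"
  using p
proof (cases rule: exponent_cases)
  case infinite
  have "AE x in lborel. x \<in> A \<longrightarrow> cmod (f x) \<le> B" "AE x in lborel. x \<in> A \<longrightarrow> cmod (g x) \<le> B'"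
    using f g infinite by (simp_all add: Lp_bound_def)
  then have "AE x in lborel. x \<in> A \<longrightarrow> cmod (f x + g x) \<le> 4 * (B + B')"
    by eventually_elim (use B norm_triangle_ineq in \<open>smt (verit)\<close>)
  then show ?thesis using infinite by (simp add: Lp_bound_def)
next
  case (finite r)
  have pt: "cmod (f x + g x) powr r \<le> 2 powr r * (cmod (f x) powr r + cmod (g x) powr r)" for x
  proof -
    have "cmod (f x + g x) \<le> 2 * max (cmod (f x)) (cmod (g x))"
      using norm_triangle_ineq[of "f x" "g x"] by linarith
    then have "cmod (f x + g x) powr r \<le> 2 powr r * max (cmod (f x)) (cmod (g x)) powr r"
      using finite powr_mono2[of r "cmod (f x + g x)" "2 * max (cmod (f x)) (cmod (g x))"]
      by (simp add: powr_mult)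
    also have "\<dots> \<le> 2 powr r * (cmod (f x) powr r + cmod (g x) powr r)"
      by (intro mult_left_mono) (auto simp: max_def)
    finally show ?thesis .
  qed
  have "(\<integral>\<^sup>+x\<in>A. ennreal (cmod (f x + g x) powr r) \<partial>lborel) \<le>
      (\<integral>\<^sup>+x. ennreal (2 powr r) * (ennreal (cmod (f x) powr r) * indicator A x +
         ennreal (cmod (g x) powr r) * indicator A x) \<partial>lborel)"
  proof (rule nn_integral_mono)
    fix x
    show "ennreal (cmod (f x + g x) powr r) * indicator A x \<le>
        ennreal (2 powr r) * (ennreal (cmod (f x) powr r) * indicator A x +
         ennreal (cmod (g x) powr r) * indicator A x)"
      using pt[of x] by (auto simp: indicator_def simp flip: ennreal_plus ennreal_mult)
  qed
  also have "\<dots> = ennreal (2 powr r) * ((\<integral>\<^sup>+x\<in>A. ennreal (cmod (f x) powr r) \<partial>lborel) +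
      (\<integral>\<^sup>+x\<in>A. ennreal (cmod (g x) powr r) \<partial>lborel))"
    by (simp add: nn_integral_cmult nn_integral_add)
  also have "\<dots> \<le> ennreal (2 powr r) * (ennreal (B powr r) + ennreal (B' powr r))"
    using f g finite by (intro mult_left_mono add_mono) (auto simp: Lp_bound_def)
  also have "\<dots> = ennreal (2 powr r * (B powr r + B' powr r))"
    by (simp flip: ennreal_plus ennreal_mult)
  also have "\<dots> \<le> ennreal ((4 * (B + B')) powr r)"
  proof (rule ennreal_leI)
    have "B powr r \<le> (B + B') powr r" "B' powr r \<le> (B + B') powr r"
      using B finite by (auto intro!: powr_mono2)
    then have "2 powr r * (B powr r + B' powr r) \<le> 2 powr r * (2 * (B + B') powr r)"
      by (intro mult_left_mono) auto
    also have "\<dots> \<le> 2 powr r * (2 powr r * (B + B') powr r)"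
      using finite powr_mono[of 1 r 2] by (intro mult_left_mono mult_right_mono) auto
    also have "\<dots> = (2 * 2) powr r * (B + B') powr r" by (simp only: powr_mult mult.assoc)
    also have "\<dots> = ((2 * 2) * (B + B')) powr r" by (simp only: powr_mult)
    finally show "2 powr r * (B powr r + B' powr r) \<le> (4 * (B + B')) powr r" by simp
  qed
  finally show ?thesis using finite by (simp add: Lp_bound_def)
qed

lemma powr_above_tangent:
  fixes r m y :: real
  assumes "r \<ge> 1" "m > 0" "y \<ge> 0"
  shows "m powr r + r * m powr (r - 1) * (y - m) \<le> y powr r"
proof (cases "y = 0")
  case True
  have "m powr r + r * m powr (r - 1) * (- m) = (1 - r) * m powr r"
  proof -
    have "m powr r = m powr (r - 1) * m" using powr_mult_base[of m "r - 1"] assms(2) by (simp add: mult.commute)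
    then show ?thesis by (simp add: algebra_simps)
  qed
  then show ?thesis using assms True by (simp add: mult_nonpos_nonneg)
next
  case False
  have "r * m powr (r - 1) * (y - m) \<le> y powr r - m powr r"
    by (rule convex_on_imp_above_tangent[OF powr_convex[OF assms(1)]])
      (use assms False in \<open>auto intro!: derivative_eq_intros simp: interior_open\<close>)
  then show ?thesis by simp
qed

lemma le_one_plus_powr: "r \<ge> 1 \<Longrightarrow> 0 \<le> y \<Longrightarrow> y \<le> 1 + y powr (r::real)"
  using powr_mono[of 1 r y] by (cases "y \<ge> 1") (auto intro: add_increasing2)

text \<open>Jensen's inequality on an interval of length \<open>l\<close>, obtained by integrating
  the tangent of \<open>y powr r\<close> at the mean \<open>m\<close> of
  \<open>cmod (F t)\<close>.\<close>

lemma interval_Jensen: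
  fixes F :: "real \<Rightarrow> complex"
  assumes [measurable]: "F \<in> borel_measurable borel" and r: "r \<ge> 1" and l: "l > 0"
    and supp: "\<And>t. t \<notin> {a..a + l} \<Longrightarrow> F t = 0"
  shows "ennreal (cmod (LINT t|lborel. F t) powr r) \<le>
    ennreal (l powr (r - 1)) * (\<integral>\<^sup>+t. ennreal (cmod (F t) powr r) \<partial>lborel)"
proof (cases "(\<integral>\<^sup>+t. ennreal (cmod (F t) powr r) \<partial>lborel) < \<infinity>")
  case False
  then have "(\<integral>\<^sup>+t. ennreal (cmod (F t) powr r) \<partial>lborel) = \<infinity>" by (simp flip: less_top)
  then show ?thesis using l by (simp add: ennreal_mult_top)
next
  case True
  define I where "I = {a..a + l}"
  have intI: "integrable lborel (indicat_real I)" and LI: "(LINT t|lborel. indicat_real I t) = l"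
    using l by (auto simp: I_def)
  have powr_int: "integrable lborel (\<lambda>t. cmod (F t) powr r)"
    using True by (intro integrableI_bounded) auto
  have F: "integrable lborel (\<lambda>t. cmod (F t))"
  proof (rule Bochner_Integration.integrable_bound)
    show "integrable lborel (\<lambda>t. indicat_real I t + cmod (F t) powr r)"
      using intI powr_int by (rule Bochner_Integration.integrable_add)
    show "AE t in lborel. norm (cmod (F t)) \<le> norm (indicat_real I t + cmod (F t) powr r)"
      using le_one_plus_powr[OF r] supp by (intro AE_I2) (auto simp: I_def indicator_def)
  qed measurable
  define m where "m = (LINT t|lborel. cmod (F t)) / l"
  have le: "cmod (LINT t|lborel. F t) \<le> l * m" using l by (simp add: m_def)
  have "(l * m) powr r \<le> l powr (r - 1) * (LINT t|lborel. cmod (F t) powr r)"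
  proof (cases "m = 0")
    case True
    then show ?thesis by simp
  next
    case False
    then have m: "m > 0" using l by (simp add: m_def less_le)
    \<comment> \<open>The integral of the tangent line at \<open>m\<close> over the interval is
      exactly \<open>l * m powr r\<close>, because \<open>m\<close> is the mean. The slope term
      needs no cut-off, as \<open>F\<close> vanishes outside.\<close>
    have "l * m powr r = (m powr r - r * m powr (r - 1) * m) * l + r * m powr (r - 1) * (l * m)"
      by (simp add: algebra_simps)
    also have "\<dots> = (LINT t|lborel. (m powr r - r * m powr (r - 1) * m) * indicat_real I t +
        r * m powr (r - 1) * cmod (F t))"
      using intI F LI l by (simp add: m_def)
    also have "\<dots> \<le> (LINT t|lborel. cmod (F t) powr r)"
    proof (rule integral_mono)
      fix t
      show "(m powr r - r * m powr (r - 1) * m) * indicat_real I t + r * m powr (r - 1) * cmod (F t)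
          \<le> cmod (F t) powr r"
        using powr_above_tangent[OF r m, of "cmod (F t)"] supp[of t]
        by (cases "t \<in> I") (auto simp: I_def algebra_simps)
    qed (use intI F powr_int in auto)
    finally have "l powr (r - 1) * (l * m powr r) \<le> l powr (r - 1) * (LINT t|lborel. cmod (F t) powr r)"
      by (intro mult_left_mono) auto
    moreover have "l powr (r - 1) * (l * m powr r) = (l * m) powr r"
      using l m by (simp add: powr_diff powr_mult)
    ultimately show ?thesis by simp
  qed
  moreover have "cmod (LINT t|lborel. F t) powr r \<le> (l * m) powr r"
    using le r by (intro powr_mono2) auto
  ultimately have "ennreal (cmod (LINT t|lborel. F t) powr r) \<le>
      ennreal (l powr (r - 1) * (LINT t|lborel. cmod (F t) powr r))"
    by (intro ennreal_leI) linarith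
  also have "\<dots> = ennreal (l powr (r - 1)) * (\<integral>\<^sup>+t. ennreal (cmod (F t) powr r) \<partial>lborel)"
    using powr_int by (simp add: ennreal_mult nn_integral_eq_integral)
  finally show ?thesis .
qed

text \<open>On a set of finite measure \<open>1 + cmod (f x) powr r\<close> is an integrable
  majorant, which avoids Hoelder's inequality.\<close>

lemma Lp_bound_set_integrable:
  fixes f :: "real ^ 'n::finite \<Rightarrow> complex"
  assumes p: "1 \<le> p" and f: "Lp_bound p (cube L) f B" and [measurable]: "f \<in> borel_measurable borel"
    and B: "B \<ge> 0"
  shows "set_integrable lborel (cube L) f"
proof -
  have ind: "integrable lborel (indicat_real (cube L :: (real ^ 'n) set))"
    by (simp add: cube_eq_cbox integrable_indicator_iff emeasure_lborel_cbox_finite[unfolded infinity_ennreal_def])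
  show ?thesis
    using p
  proof (cases rule: exponent_cases)
    case infinite
    have *: "AE x in lborel. x \<in> cube L \<longrightarrow> cmod (f x) \<le> B" using f infinite by (simp add: Lp_bound_def)
    show ?thesis unfolding set_integrable_def
    proof (rule Bochner_Integration.integrable_bound)
      show "integrable lborel (\<lambda>x :: real ^ 'n. B * indicat_real (cube L) x)" using ind by simp
      show "AE x in lborel. norm (indicat_real (cube L) x *\<^sub>R f x) \<le> norm (B * indicat_real (cube L) x)"
        using * by eventually_elim (use B in \<open>auto simp: indicator_def\<close>)
    qed measurable
  next
    case (finite r)
    have "(\<integral>\<^sup>+x. ennreal (indicat_real (cube L) x * cmod (f x) powr r) \<partial>lborel) \<le> ennreal (B powr r)"
      using f finite by (simp add: Lp_bound_def ennreal_mult' ennreal_indicator mult.commute)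
    then have "(\<integral>\<^sup>+x. ennreal (indicat_real (cube L) x * cmod (f x) powr r) \<partial>lborel) < \<infinity>"
      by (rule le_less_trans) simp
    then have powr_int: "integrable lborel (\<lambda>x. indicat_real (cube L) x * cmod (f x) powr r)"
      by (intro integrableI_bounded) auto
    show ?thesis unfolding set_integrable_def
    proof (rule Bochner_Integration.integrable_bound)
      show "integrable lborel (\<lambda>x. indicat_real (cube L) x + indicat_real (cube L) x * cmod (f x) powr r)"
        using ind powr_int by (rule Bochner_Integration.integrable_add)
      show "AE x in lborel. norm (indicat_real (cube L) x *\<^sub>R f x) \<le>
          norm (indicat_real (cube L) x + indicat_real (cube L) x * cmod (f x) powr r)"
        using le_one_plus_powr finite by (intro AE_I2) (auto simp: indicator_def)
    qed measurable
  qed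
qed

definition Lp_growth :: "ennreal \<Rightarrow> (real ^ 'n::finite \<Rightarrow> complex) \<Rightarrow> (real \<Rightarrow> real) \<Rightarrow> bool" where
  "Lp_growth p f w \<longleftrightarrow> f \<in> borel_measurable borel \<and> (\<forall>R\<ge>1. 0 \<le> w R \<and> Lp_bound p (cube R) f (w R))"

lemma Lp_growth_locally_integrable:
  assumes "1 \<le> p" "Lp_growth p f w"
  shows "locally_integrable f"
  unfolding locally_integrable_def
proof (intro conjI allI)
  show [measurable]: "f \<in> borel_measurable borel" using assms(2) by (simp add: Lp_growth_def)
  fix L :: real
  have "set_integrable lborel (cube (max L 1)) f"
    using assms by (intro Lp_bound_set_integrable[of p _ _ "w (max L 1)"]) (auto simp: Lp_growth_def)
  then show "set_integrable lborel (cube L) f"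
    by (rule set_integrable_subset) (use cube_mono[of L "max L 1"] in auto)
qed

context coord_kernel
begin

text \<open>For finite exponents Jensen along a segment of length \<open>2 * \<rho>\<close> gives
  \<open>(2 * \<rho>) powr (r - 1)\<close>, and integrating out the displacement after
  \<open>shear\<close> supplies the missing factor \<open>2 * \<rho>\<close>. For
  \<open>p = \<infinity>\<close> the integrand is bounded on such a segment.\<close>

lemma op_Lp_bound:
  assumes p: "1 \<le> p" and \<rho>: "R \<le> \<rho>" and f [measurable]: "f \<in> borel_measurable borel"
    and bd: "Lp_bound p (cube \<rho>) f B" and B: "B \<ge> 0"
  shows "Lp_bound p (cube \<rho>) (op f) (2 * \<rho> * c * B)"
proof -
  have \<rho>0: "\<rho> > 0" using \<rho> R_pos by linarith
  define F where "F x t = f (coord_shift i t x) * complex_of_real (\<kappa> (x $ i + t) t)" for x t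
  have Fm [measurable]: "F x \<in> borel_measurable borel" for x unfolding F_def by measurable
  have F0: "F x t = 0" if "x \<in> cube \<rho>" "t \<notin> {- \<rho> - x $ i..- \<rho> - x $ i + 2 * \<rho>}" for x t
    using op_integrand_support[OF \<rho> that(1), of t] that(2) by (auto simp: F_def abs_le_iff)
  have Fle: "cmod (F x t) \<le> c * cmod (f (coord_shift i t x))" for x t
  proof -
    have "\<bar>\<kappa> (x $ i + t) t\<bar> * cmod (f (coord_shift i t x)) \<le> c * cmod (f (coord_shift i t x))"
      by (intro mult_right_mono kernel_bound) simp
    then show ?thesis by (simp add: F_def norm_mult mult.commute)
  qed
  have opF: "op f x = (LINT t|lborel. F x t)" for x by (simp add: kernel_op_def F_def)
  show ?thesis
    using p
  proof (cases rule: exponent_cases)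
    case infinite
    \<comment> \<open>The bound fails on a null set \<open>N\<close>. Tonelli with
      \<open>shear\<close> shows that for almost every \<open>x\<close> the line through
      \<open>x\<close> meets \<open>N\<close> in a null set only.\<close>
    define N where "N = {y \<in> cube \<rho>. \<not> cmod (f y) \<le> B}"
    have N [measurable]: "N \<in> sets borel" unfolding N_def by measurable
    have "AE x in lborel. x \<notin> N" using bd infinite by (auto simp: Lp_bound_def N_def)
    then have "(\<integral>\<^sup>+x. indicator N x \<partial>lborel) = 0"
      by (subst nn_integral_0_iff_AE) (auto simp: indicator_def)
    then have "(\<integral>\<^sup>+z. indicator N (fst z) \<partial>lborel_line) = 0"
      by (subst lborel_pair.nn_integral_snd[symmetric]) auto
    then have "(\<integral>\<^sup>+z. indicator N (fst (shear i z)) \<partial>lborel_line) = 0"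
      by (subst nn_integral_shear[where g="\<lambda>z. indicator N (fst z)"]) auto
    then have "AE z in lborel_line. coord_shift i (snd z) (fst z) \<notin> N"
      by (subst (asm) nn_integral_0_iff_AE) (auto simp: shear_def indicator_def split: if_splits)
    from lborel_pair.AE_pair[OF this]
    have "AE x in lborel. AE t in lborel. coord_shift i t x \<notin> N" by simp
    then have "AE x in lborel. x \<in> cube \<rho> \<longrightarrow> cmod (op f x) \<le> 2 * \<rho> * c * B"
    proof eventually_elim
      fix x assume AEt: "AE t in lborel. coord_shift i t x \<notin> N"
      show "x \<in> cube \<rho> \<longrightarrow> cmod (op f x) \<le> 2 * \<rho> * c * B"
      proof
        assume x: "x \<in> cube \<rho>"
        let ?g = "\<lambda>t. c * B * indicat_real {- \<rho> - x $ i..- \<rho> - x $ i + 2 * \<rho>} t"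
        have gi: "integrable lborel ?g" by (intro integrable_mult_right integrable_real_indicator) (auto simp: emeasure_lborel_Icc_eq)
        have ae: "AE t in lborel. cmod (F x t) \<le> ?g t"
          using AEt
        proof eventually_elim
          fix t assume t: "coord_shift i t x \<notin> N"
          show "cmod (F x t) \<le> ?g t"
          proof (cases "t \<in> {- \<rho> - x $ i..- \<rho> - x $ i + 2 * \<rho>}")
            case True
            then have "\<bar>x $ i + t\<bar> \<le> \<rho>" by auto
            then have "coord_shift i t x \<in> cube \<rho>" by (rule in_cube_coord_shift[OF x])
            then have "cmod (f (coord_shift i t x)) \<le> B" using t by (simp add: N_def)
            then have "c * cmod (f (coord_shift i t x)) \<le> c * B" using c_nonneg by (rule mult_left_mono)
            then show ?thesis using Fle[of x t] True by simp
          qed (use F0[OF x] in simp)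
        qed
        have "integrable lborel (F x)"
          by (rule Bochner_Integration.integrable_bound[OF gi])
            (use ae in \<open>auto elim!: eventually_mono\<close>)
        then have "cmod (op f x) \<le> (LINT t|lborel. ?g t)"
          unfolding opF using gi ae by (intro order_trans[OF integral_norm_bound] integral_mono_AE) auto
        also have "\<dots> = 2 * \<rho> * c * B" using \<rho>0 by simp
        finally show "cmod (op f x) \<le> 2 * \<rho> * c * B" .
      qed
    qed
    then show ?thesis using infinite by (simp add: Lp_bound_def)
  next
    case (finite r)
    have r: "r \<ge> 1" by (rule finite)
    let ?C = "(2 * \<rho>) powr (r - 1) * c powr r"
    let ?g = "\<lambda>z. indicator (cube \<rho>) (fst z) * indicator {- \<rho>..\<rho>} (fst z $ i + snd z) *
      ennreal (cmod (f (coord_shift i (snd z) (fst z))) powr r)"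
    have gm [measurable]: "?g \<in> borel_measurable lborel_line" by measurable
    have pt: "ennreal (cmod (op f x) powr r) * indicator (cube \<rho>) x \<le>
        ennreal ?C * (\<integral>\<^sup>+t. ?g (x, t) \<partial>lborel)" for x
    proof (cases "x \<in> cube \<rho>")
      case x: True
      have "ennreal (cmod (op f x) powr r) \<le>
          ennreal ((2 * \<rho>) powr (r - 1)) * (\<integral>\<^sup>+t. ennreal (cmod (F x t) powr r) \<partial>lborel)"
        unfolding opF using F0[OF x] \<rho>0 by (intro interval_Jensen[OF Fm r]) auto
      also have "\<dots> \<le> ennreal ((2 * \<rho>) powr (r - 1)) * (\<integral>\<^sup>+t. ennreal (c powr r) * ?g (x, t) \<partial>lborel)"
      proof (intro mult_left_mono nn_integral_mono)
        fix t
        show "ennreal (cmod (F x t) powr r) \<le> ennreal (c powr r) * ?g (x, t)"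
        proof (cases "t \<in> {- \<rho> - x $ i..- \<rho> - x $ i + 2 * \<rho>}")
          case True
          have "cmod (F x t) powr r \<le> c powr r * cmod (f (coord_shift i t x)) powr r"
            using powr_mono2[OF _ _ Fle[of x t], of r] r c_nonneg by (simp add: powr_mult)
          then have "ennreal (cmod (F x t) powr r) \<le> ennreal (c powr r) * ennreal (cmod (f (coord_shift i t x)) powr r)"
            by (simp flip: ennreal_mult)
          then show ?thesis using x True by (auto simp: indicator_def)
        qed (use F0[OF x] in simp)
      qed simp
      also have "\<dots> = ennreal ?C * (\<integral>\<^sup>+t. ?g (x, t) \<partial>lborel)"
        by (subst nn_integral_cmult) (auto simp: ennreal_mult mult.assoc)
      finally show ?thesis using x by simp
    qed simp
    have "(\<integral>\<^sup>+x\<in>cube \<rho>. ennreal (cmod (op f x) powr r) \<partial>lborel) \<le>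
        (\<integral>\<^sup>+x. ennreal ?C * (\<integral>\<^sup>+t. ?g (x, t) \<partial>lborel) \<partial>lborel)"
      by (intro nn_integral_mono pt)
    also have "\<dots> = ennreal ?C * (\<integral>\<^sup>+x. \<integral>\<^sup>+t. ?g (x, t) \<partial>lborel \<partial>lborel)"
      by (rule nn_integral_cmult) measurable
    also have "(\<integral>\<^sup>+x. \<integral>\<^sup>+t. ?g (x, t) \<partial>lborel \<partial>lborel) = (\<integral>\<^sup>+z. ?g z \<partial>lborel_line)"
      by (rule lborel.nn_integral_fst[OF gm])
    \<comment> \<open>After the shear \<open>f\<close> is evaluated at the base point, and the
      displacement only ranges over an interval of length \<open>2 * \<rho>\<close>.\<close>
    also have "\<dots> = (\<integral>\<^sup>+z. ?g (shear i z) \<partial>lborel_line)"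
      by (rule nn_integral_shear[OF gm, symmetric])
    also have "\<dots> \<le> (\<integral>\<^sup>+z. (ennreal (cmod (f (fst z)) powr r) * indicator (cube \<rho>) (fst z)) *
        indicator {- \<rho> - fst z $ i..\<rho> - fst z $ i} (snd z) \<partial>lborel_line)"
    proof (rule nn_integral_mono)
      fix z :: "(real ^ 'n) \<times> real"
      have "coord_shift i (- snd z) (coord_shift i (snd z) (fst z)) = fst z"
        by (simp add: coord_shift_def)
      moreover have "coord_shift i (snd z) (fst z) $ i + - snd z = fst z $ i"
        by (simp add: coord_shift_nth)
      ultimately show "?g (shear i z) \<le> (ennreal (cmod (f (fst z)) powr r) * indicator (cube \<rho>) (fst z)) *
        indicator {- \<rho> - fst z $ i..\<rho> - fst z $ i} (snd z)"
        using coord_shift_in_cube[of i "snd z" "fst z" \<rho>]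
        by (auto simp: shear_def indicator_def abs_le_iff)
    qed
    also have "\<dots> = (\<integral>\<^sup>+x. \<integral>\<^sup>+t. (ennreal (cmod (f x) powr r) * indicator (cube \<rho>) x) *
        indicator {- \<rho> - x $ i..\<rho> - x $ i} t \<partial>lborel \<partial>lborel)"
    proof (subst lborel.nn_integral_fst[symmetric])
      have "(\<lambda>z. ennreal (cmod (f (fst z)) powr r) * indicator (cube \<rho>) (fst z) *
          (if - \<rho> - fst z $ i \<le> snd z \<and> snd z \<le> \<rho> - fst z $ i then 1 else 0)) \<in> borel_measurable lborel_line"
        by measurable
      then show "(\<lambda>z. ennreal (cmod (f (fst z)) powr r) * indicator (cube \<rho>) (fst z) *
          indicator {- \<rho> - fst z $ i..\<rho> - fst z $ i} (snd z)) \<in> borel_measurable lborel_line"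
        by (simp add: indicator_def)
    qed simp
    also have "\<dots> = (\<integral>\<^sup>+x. ennreal (cmod (f x) powr r) * indicator (cube \<rho>) x * ennreal (2 * \<rho>) \<partial>lborel)"
      using \<rho>0 by (intro nn_integral_cong) (simp add: nn_integral_cmult)
    also have "\<dots> = (\<integral>\<^sup>+x\<in>cube \<rho>. ennreal (cmod (f x) powr r) \<partial>lborel) * ennreal (2 * \<rho>)"
      by (rule nn_integral_multc) measurable
    also have "\<dots> \<le> ennreal (B powr r) * ennreal (2 * \<rho>)"
      using bd finite by (intro mult_right_mono) (auto simp: Lp_bound_def)
    finally have "(\<integral>\<^sup>+x\<in>cube \<rho>. ennreal (cmod (op f x) powr r) \<partial>lborel) \<le>
        ennreal ?C * (ennreal (B powr r) * ennreal (2 * \<rho>))"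
      by (simp add: mult_left_mono)
    also have "\<dots> = ennreal (?C * (B powr r * (2 * \<rho>)))"
      using \<rho>0 by (simp add: ennreal_mult)
    also have "?C * (B powr r * (2 * \<rho>)) = (2 * \<rho> * c * B) powr r"
      using \<rho>0 c_nonneg B by (simp add: powr_mult powr_diff)
    finally show ?thesis using finite by (simp add: Lp_bound_def)
  qed
qed

end

section \<open>Primitives of linear functionals\<close>

text \<open>As an operator on \<open>f\<close> it averages along the lines in direction
  \<open>i\<close>; its transpose puts the line integral of \<open>\<phi>\<close> in front of a
  bump.\<close>

definition bump_kernel :: "real \<Rightarrow> real \<Rightarrow> real \<Rightarrow> real" where
  "bump_kernel R s t = bump R s"

text \<open>The distribution function of the density \<open>bump R\<close>, written as an integral
  over displacements to match \<open>ray_integral\<close>.\<close>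

definition bump_cdf :: "real \<Rightarrow> real \<Rightarrow> real" where
  "bump_cdf R s = (LINT \<tau>|lborel. indicat_real {..0} \<tau> * bump R (s + \<tau>))"

text \<open>The indicator alone would integrate \<open>\<phi>\<close> along a half-line, and the
  result need not vanish beyond the support. Subtracting the distribution function of the bump
  removes the total mass, so the transpose preserves compact support.\<close>

definition step_kernel :: "real \<Rightarrow> real \<Rightarrow> real \<Rightarrow> real" where
  "step_kernel R s t = indicat_real {0..} t - bump_cdf R s"

lemma coord_kernel_bump:
  assumes "R > 0"
  shows "coord_kernel (bump_kernel R) (1 / (R * bump_mass)) R"
proof
  show "case_prod (bump_kernel R) \<in> borel_measurable (borel \<Otimes>\<^sub>M borel)"
    unfolding bump_kernel_def by measurable
  show "\<bar>bump_kernel R s t\<bar> \<le> 1 / (R * bump_mass)" for s t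
    using bump_bounds[OF assms, of s] by (simp add: bump_kernel_def)
  show "\<bar>s\<bar> \<le> \<rho>" if "R \<le> \<rho>" "bump_kernel R s t \<noteq> 0" for s t \<rho>
    using bump_support[OF assms, of s] that by (cases "\<bar>s\<bar> > R") (auto simp: bump_kernel_def)
qed (rule assms)

lemma
  assumes "R > 0"
  shows integrable_shifted_bump: "integrable lborel (\<lambda>\<tau>. bump R (s + \<tau>))"
    and integral_shifted_bump: "(LINT \<tau>|lborel. bump R (s + \<tau>)) = 1"
  using lborel_integrable_real_affine[OF integrable_scaled_bump[OF assms], of 1 s]
    lborel_integral_real_affine[of 1 "bump R" s] integral_bump[OF assms] by simp_all

lemma integrable_cut_bump:
  assumes "R > 0"
  shows "integrable lborel (\<lambda>\<tau>. indicat_real {..0} \<tau> * bump R (s + \<tau>))"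
  using integrable_mult_indicator[OF _ integrable_shifted_bump[OF assms, of s], of "{..0}"] by simp

lemma bump_cdf_bounds:
  assumes "R > 0"
  shows "0 \<le> bump_cdf R s" "bump_cdf R s \<le> 1"
proof -
  show "0 \<le> bump_cdf R s"
    unfolding bump_cdf_def using bump_bounds[OF assms] by (intro integral_nonneg_AE AE_I2) auto
  have "bump_cdf R s \<le> (LINT \<tau>|lborel. bump R (s + \<tau>))"
    unfolding bump_cdf_def using bump_bounds[OF assms]
    by (intro integral_mono integrable_cut_bump integrable_shifted_bump assms) (auto simp: indicator_def)
  then show "bump_cdf R s \<le> 1" using integral_shifted_bump[OF assms] by simp
qed

lemma bump_cdf_right:
  assumes "R > 0" "s > R"
  shows "bump_cdf R s = 1"
proof -
  have eq: "indicat_real {..0} \<tau> * bump R (s + \<tau>) = bump R (s + \<tau>)" for \<tau>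
    using bump_support[OF assms(1), of "s + \<tau>"] assms by (cases "\<tau> \<le> 0") auto
  show ?thesis unfolding bump_cdf_def eq by (rule integral_shifted_bump[OF assms(1)])
qed

lemma bump_cdf_left:
  assumes "R > 0" "s < - R"
  shows "bump_cdf R s = 0"
proof -
  have eq: "indicat_real {..0} \<tau> * bump R (s + \<tau>) = 0" for \<tau>
    using bump_support[OF assms(1), of "s + \<tau>"] assms by (cases "\<tau> \<le> 0") auto
  show ?thesis unfolding bump_cdf_def eq by simp
qed

lemma bump_cdf_measurable [measurable]: "bump_cdf R \<in> borel_measurable borel"
  unfolding bump_cdf_def by measurable

lemma coord_kernel_step:
  assumes "R > 0"
  shows "coord_kernel (step_kernel R) 1 R"
proof
  show "case_prod (step_kernel R) \<in> borel_measurable (borel \<Otimes>\<^sub>M borel)"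
    unfolding step_kernel_def by measurable
  show "\<bar>step_kernel R s t\<bar> \<le> 1" for s t
    using bump_cdf_bounds[OF assms, of s] by (auto simp: step_kernel_def indicator_def)
  show "\<bar>s\<bar> \<le> \<rho>" if *: "R \<le> \<rho>" "\<bar>s - t\<bar> \<le> \<rho>" "step_kernel R s t \<noteq> 0" for s t \<rho>
  proof (rule ccontr)
    assume "\<not> \<bar>s\<bar> \<le> \<rho>"
    \<comment> \<open>Beyond the cube on the right the distribution function is 1, on the left 0.
      There the kernel is nonzero only for \<open>t < 0\<close> on the right and
      \<open>t >= 0\<close> on the left, and then \<open>s - t\<close> is no nearer to the cube than
      \<open>s\<close>.\<close>
    then consider "s > \<rho>" | "s < - \<rho>" by linarith
    then show False
    proof cases
      case 1
      then show False using * bump_cdf_right[OF assms, of s] by (auto simp: step_kernel_def indicator_def)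
    next
      case 2
      then show False using * bump_cdf_left[OF assms, of s] by (auto simp: step_kernel_def indicator_def)
    qed
  qed
qed (rule assms)

lemma smooth_measurable: "smooth \<phi> \<Longrightarrow> \<phi> \<in> borel_measurable borel"
  by (intro borel_measurable_continuous_onI smooth_continuous_on)

lemma test_function_bounded:
  fixes \<phi> :: "real ^ 'n::finite \<Rightarrow> complex"
  assumes "\<phi> \<in> test_functions"
  obtains b where "\<And>x. cmod (\<phi> x) \<le> b"
proof -
  obtain L where L: "smooth \<phi>" "L > 0" "\<And>x. x \<notin> cube L \<Longrightarrow> \<phi> x = 0"
    using assms by (rule test_functionE) blast
  have "compact (\<phi> ` cube L)"
    unfolding cube_eq_cbox by (intro compact_continuous_image smooth_continuous_on L compact_cbox)
  then obtain b where b: "\<forall>y\<in>\<phi> ` cube L. norm y \<le> b"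
    using compact_imp_bounded bounded_iff by blast
  have "cmod (\<phi> x) \<le> max b 0" for x
    using b L(3)[of x] by (cases "x \<in> cube L") auto
  then show ?thesis using that by blast
qed

lemma integral_mult_kernel_adj:
  assumes "coord_kernel \<kappa> c R" "locally_integrable f" "\<phi> \<in> test_functions"
  shows "(LINT x|lborel. f x * kernel_adj i \<kappa> \<phi> x) = (LINT x|lborel. kernel_op i \<kappa> f x * \<phi> x)"
proof -
  obtain L where L: "smooth \<phi>" "L > 0" "\<And>x. x \<notin> cube L \<Longrightarrow> \<phi> x = 0"
    using assms(3) by (rule test_functionE) blast
  obtain b where b: "\<And>x. cmod (\<phi> x) \<le> b" using assms(3) by (rule test_function_bounded) blast
  show ?thesis
    by (rule coord_kernel.integral_mult_adj[OF assms(1,2) smooth_measurable[OF L(1)] b L(3)])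
qed

lemma integrable_locally_integrable_mult_test:
  assumes g: "locally_integrable g" and "\<phi> \<in> test_functions"
  shows "integrable lborel (\<lambda>x. g x * \<phi> x)"
proof -
  obtain L where L: "smooth \<phi>" "L > 0" "\<And>x. x \<notin> cube L \<Longrightarrow> \<phi> x = 0"
    using assms(2) by (rule test_functionE) blast
  obtain b where b: "\<And>x. cmod (\<phi> x) \<le> b" using assms(2) by (rule test_function_bounded) blast
  have [measurable]: "g \<in> borel_measurable borel" "\<phi> \<in> borel_measurable borel"
    using g smooth_measurable[OF L(1)] by (auto simp: locally_integrable_def)
  show ?thesis
  proof (rule Bochner_Integration.integrable_bound)
    show "integrable lborel (\<lambda>x. complex_of_real b * (indicator (cube L) x *\<^sub>R g x))"
      using g by (intro integrable_mult_right) (simp add: locally_integrable_def set_integrable_def)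
    show "AE x in lborel. norm (g x * \<phi> x) \<le> norm (complex_of_real b * (indicator (cube L) x *\<^sub>R g x))"
    proof (rule AE_I2)
      fix x
      have "cmod (\<phi> x) \<le> \<bar>b\<bar>" using b[of x] by linarith
      then show "norm (g x * \<phi> x) \<le> norm (complex_of_real b * (indicator (cube L) x *\<^sub>R g x))"
        using L(3)[of x] by (cases "x \<in> cube L") (auto simp: norm_mult mult.commute mult_right_mono)
    qed
  qed measurable
qed

lemma locally_integrable_const: "locally_integrable (\<lambda>x. c)"
proof -
  have "emeasure lborel (cube L :: (real ^ 'n) set) < \<infinity>" for L
    unfolding cube_eq_cbox by (rule emeasure_lborel_cbox_finite)
  then show ?thesis
    by (auto simp: locally_integrable_def set_integrable_def intro!: integrable_scaleR_left integrable_real_indicator)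
qed

lemma locally_integrable_add:
  assumes "locally_integrable f" "locally_integrable g"
  shows "locally_integrable (\<lambda>x. f x + g x)"
  using assms unfolding locally_integrable_def by (auto intro: set_integral_add)

lemma locally_integrable_diff:
  assumes "locally_integrable f" "locally_integrable g"
  shows "locally_integrable (\<lambda>x. f x - g x)"
  using assms unfolding locally_integrable_def by (auto intro: set_integral_diff)

text \<open>Allows \<open>op_Lp_bound\<close> with exponent 1 to prove that kernel operators
  preserve local integrability.\<close>

lemma locally_integrable_iff_Lp_bound:
  "locally_integrable g \<longleftrightarrow> g \<in> borel_measurable borel \<and> (\<forall>L. \<exists>B\<ge>0. Lp_bound 1 (cube L) g B)"
proof (intro iffI conjI allI)
  assume g: "locally_integrable g"
  fix L
  have "(\<integral>\<^sup>+x. ennreal (norm (indicator (cube L) x *\<^sub>R g x)) \<partial>lborel) < \<infinity>"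
    using g by (auto simp: locally_integrable_def set_integrable_def integrable_iff_bounded)
  then obtain B where B: "B \<ge> 0" "(\<integral>\<^sup>+x. ennreal (norm (indicator (cube L) x *\<^sub>R g x)) \<partial>lborel) = ennreal B"
    by (cases "\<integral>\<^sup>+x. ennreal (norm (indicator (cube L) x *\<^sub>R g x)) \<partial>lborel") auto
  then have "Lp_bound 1 (cube L) g B"
    by (simp add: Lp_bound_def ennreal_mult' ennreal_indicator mult.commute)
  then show "\<exists>B\<ge>0. Lp_bound 1 (cube L) g B" using B by blast
next
  assume "g \<in> borel_measurable borel \<and> (\<forall>L. \<exists>B\<ge>0. Lp_bound 1 (cube L) g B)"
  then show "locally_integrable g"
    unfolding locally_integrable_def using Lp_bound_set_integrable[of 1] by blast
qed (auto simp: locally_integrable_def)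

lemma locally_integrable_kernel_op:
  assumes \<kappa>: "coord_kernel \<kappa> c R" and f: "locally_integrable f"
  shows "locally_integrable (kernel_op i \<kappa> f)"
proof -
  interpret coord_kernel i \<kappa> c R by (rule \<kappa>)
  have fm: "f \<in> borel_measurable borel" using f by (simp add: locally_integrable_def)
  show ?thesis unfolding locally_integrable_iff_Lp_bound
  proof (intro conjI allI)
    fix L
    define \<rho> where "\<rho> = max L R"
    obtain B where B: "B \<ge> 0" "Lp_bound 1 (cube \<rho>) f B"
      using f locally_integrable_iff_Lp_bound by blast
    have "Lp_bound 1 (cube \<rho>) (kernel_op i \<kappa> f) (2 * \<rho> * c * B)"
      by (rule op_Lp_bound) (use B fm in \<open>auto simp: \<rho>_def\<close>)
    then have "Lp_bound 1 (cube L) (kernel_op i \<kappa> f) (2 * \<rho> * c * B)"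
      by (rule Lp_bound_subset) (use cube_mono[of L \<rho>] in \<open>auto simp: \<rho>_def\<close>)
    moreover have "2 * \<rho> * c * B \<ge> 0" using R_pos c_nonneg B by (auto simp: \<rho>_def)
    ultimately show "\<exists>B\<ge>0. Lp_bound 1 (cube L) (kernel_op i \<kappa> f) B" by blast
  qed (rule op_measurable[OF fm])
qed

section \<open>Flattening test functions one coordinate at a time\<close>

text \<open>Keeps the integral of \<open>\<phi>\<close> along every line in direction
  \<open>i\<close>. Hence \<open>\<phi>\<close> minus its flattening has mean zero on these lines,
  which makes it the derivative of a test function.\<close>

definition flatten :: "real \<Rightarrow> 'n::finite \<Rightarrow> (real ^ 'n \<Rightarrow> complex) \<Rightarrow> real ^ 'n \<Rightarrow> complex" where
  "flatten R i = kernel_adj i (bump_kernel R)"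

lemma flatten_eq: "flatten R i \<phi> x = complex_of_real (bump R (x $ i)) * (LINT t|lborel. \<phi> (coord_shift i t x))"
  by (simp add: flatten_def kernel_adj_def bump_kernel_def mult.commute)

lemma test_function_flatten:
  assumes "R > 0" "\<phi> \<in> test_functions"
  shows "flatten R i \<phi> \<in> test_functions"
proof -
  interpret coord_kernel i "bump_kernel R" "1 / (R * bump_mass)" R by (rule coord_kernel_bump[OF assms(1)])
  obtain L where L: "smooth \<phi>" "L > 0" "\<And>x. x \<notin> cube L \<Longrightarrow> \<phi> x = 0"
    using assms(2) by (rule test_functionE) blast
  have supp: "x \<notin> cube (max L R) \<Longrightarrow> \<phi> x = 0" for x using L(3) cube_mono[of L "max L R"] by auto
  show ?thesis
  proof (rule test_functionI)
    have "flatten R i \<phi> = (\<lambda>x. complex_of_real (bump R (x $ i)) * ray_integral UNIV i \<phi> x)"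
      by (auto simp: flatten_eq ray_integral_def coord_shift_def set_lebesgue_integral_def)
    then show "smooth (flatten R i \<phi>)"
      using smooth_mult[OF smooth_bump_coordinate smooth_ray_integral[OF assms(2) initial_ray_UNIV]] by simp
    show "flatten R i \<phi> x = 0" if "x \<notin> cube (max L R)" for x
      unfolding flatten_def by (rule adj_support[OF _ supp that]) auto
  qed
qed

lemma integrable_along_line:
  assumes "\<phi> \<in> test_functions"
  shows "integrable lborel (\<lambda>t. \<phi> (coord_shift i t x))"
proof -
  obtain L where L: "smooth \<phi>" "L > 0" "\<And>x. x \<notin> cube L \<Longrightarrow> \<phi> x = 0"
    using assms by (rule test_functionE) blast
  let ?K = "\<bar>x $ i\<bar>"
  have "set_integrable lborel {- (?K + L)..?K + L} (\<lambda>t. \<phi> (coord_shift i t x))"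
    unfolding coord_shift_def
    by (intro borel_integrable_atLeastAtMost' continuous_on_ray smooth_continuous_on L(1))
  moreover have "indicator {- (?K + L)..?K + L} t *\<^sub>R \<phi> (coord_shift i t x) = \<phi> (coord_shift i t x)" for t
    using ray_leaves_cube[of L \<phi> x i ?K t] L(3) by (cases "t \<in> {- (?K + L)..?K + L}") (auto simp: coord_shift_def)
  ultimately show ?thesis unfolding set_integrable_def by (simp only:)
qed

lemma integral_along_line_shift:
  fixes \<phi> :: "real ^ 'n::finite \<Rightarrow> complex"
  shows "(LINT t|lborel. \<phi> (coord_shift i t (coord_shift i \<tau> x))) = (LINT t|lborel. \<phi> (coord_shift i t x))"
proof -
  have "coord_shift i t (coord_shift i \<tau> x) = coord_shift i (\<tau> + 1 * t) x" for t
    by (simp add: coord_shift_def scaleR_add_left add.assoc)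
  then show ?thesis
    using lborel_integral_real_affine[of 1 "\<lambda>t. \<phi> (coord_shift i t x)" \<tau>] by simp
qed

text \<open>The full line integral of \<open>\<phi>\<close> is constant along the line and leaves
  the integral; what remains of the flattened part is the distribution function of the bump.\<close>

lemma ray_integral_sub_flatten:
  assumes R: "R > 0" and \<phi>: "\<phi> \<in> test_functions"
  shows "ray_integral {..0} i (\<lambda>x. \<phi> x - flatten R i \<phi> x) = kernel_adj i (step_kernel R) \<phi>"
proof
  fix x
  let ?M = "LINT t|lborel. \<phi> (coord_shift i t x)"
  have i1: "integrable lborel (\<lambda>t. indicator {..0::real} t *\<^sub>R \<psi> (coord_shift i t x))"
    if "\<psi> \<in> test_functions" for \<psi>
    by (rule integrable_mult_indicator) (use integrable_along_line[OF that] in auto)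
  have fl: "indicator {..0} t *\<^sub>R flatten R i \<phi> (coord_shift i t x) =
      complex_of_real (indicat_real {..0} t * bump R (x $ i + t)) * ?M" for t
    by (simp add: flatten_eq integral_along_line_shift coord_shift_nth scaleR_conv_of_real mult.assoc)
  have "ray_integral {..0} i (\<lambda>x. \<phi> x - flatten R i \<phi> x) x =
      (LINT t|lborel. indicator {..0} t *\<^sub>R \<phi> (coord_shift i t x) -
        indicator {..0} t *\<^sub>R flatten R i \<phi> (coord_shift i t x))"
    by (simp add: ray_integral_def set_lebesgue_integral_def coord_shift_def scaleR_diff_right)
  also have "\<dots> = (LINT t|lborel. indicator {..0} t *\<^sub>R \<phi> (coord_shift i t x)) -
      (LINT t|lborel. complex_of_real (indicat_real {..0} t * bump R (x $ i + t)) * ?M)"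
    using i1[OF \<phi>] i1[OF test_function_flatten[OF R \<phi>, of i]]
    by (subst Bochner_Integration.integral_diff) (simp_all only: fl)
  also have "(LINT t|lborel. complex_of_real (indicat_real {..0} t * bump R (x $ i + t)) * ?M) =
      complex_of_real (bump_cdf R (x $ i)) * ?M"
    unfolding bump_cdf_def by (simp only: integral_mult_left_zero integral_complex_of_real)
  also have "complex_of_real (bump_cdf R (x $ i)) * ?M =
      (LINT t|lborel. complex_of_real (bump_cdf R (x $ i)) * \<phi> (coord_shift i t x))"
    by simp
  also have "(LINT t|lborel. indicator {..0} t *\<^sub>R \<phi> (coord_shift i t x)) - \<dots> =
      (LINT t|lborel. indicator {..0} t *\<^sub>R \<phi> (coord_shift i t x) -
         complex_of_real (bump_cdf R (x $ i)) * \<phi> (coord_shift i t x))"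
    using i1[OF \<phi>] integrable_along_line[OF \<phi>]
    by (intro Bochner_Integration.integral_diff[symmetric] integrable_mult_right)
  also have "\<dots> = kernel_adj i (step_kernel R) \<phi> x"
    unfolding kernel_adj_def
    by (intro Bochner_Integration.integral_cong refl)
      (auto simp: step_kernel_def indicator_def algebra_simps)
  finally show "ray_integral {..0} i (\<lambda>x. \<phi> x - flatten R i \<phi> x) x = kernel_adj i (step_kernel R) \<phi> x" .
qed

text \<open>Two descriptions of one function are combined: the ray integral gives smoothness, the
  kernel gives compact support.\<close>

lemma test_function_step_adj:
  assumes R: "R > 0" and \<phi>: "\<phi> \<in> test_functions"
  shows "kernel_adj i (step_kernel R) \<phi> \<in> test_functions"
proof -
  interpret coord_kernel i "step_kernel R" 1 R by (rule coord_kernel_step[OF assms(1)])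
  obtain L where L: "smooth \<phi>" "L > 0" "\<And>x. x \<notin> cube L \<Longrightarrow> \<phi> x = 0"
    using \<phi> by (rule test_functionE) blast
  have supp: "x \<notin> cube (max L R) \<Longrightarrow> \<phi> x = 0" for x using L(3) cube_mono[of L "max L R"] by auto
  show ?thesis
  proof (rule test_functionI)
    show "smooth (kernel_adj i (step_kernel R) \<phi>)"
      unfolding ray_integral_sub_flatten[OF assms, symmetric]
      by (intro smooth_ray_integral test_function_diff test_function_flatten assms initial_ray_atMost)
    show "kernel_adj i (step_kernel R) \<phi> x = 0" if "x \<notin> cube (max L R)" for x
      by (rule adj_support[OF _ supp that]) auto
  qed
qed

lemma partial_deriv_step_adj:
  assumes R: "R > 0" and \<phi>: "\<phi> \<in> test_functions"
  shows "partial_deriv i (kernel_adj i (step_kernel R) \<phi>) = (\<lambda>x. \<phi> x - flatten R i \<phi> x)"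
  using partial_deriv_ray_integral_test[OF _ initial_ray_atMost, of "\<lambda>x. \<phi> x - flatten R i \<phi> x" i i]
    ray_integral_partial_deriv[of "\<lambda>x. \<phi> x - flatten R i \<phi> x" i]
    test_function_diff[OF \<phi> test_function_flatten[OF R \<phi>, of i]]
  by (simp add: ray_integral_sub_flatten[OF R \<phi>])

text \<open>Transposition applied to the constant 1, which averaging against a probability density
  reproduces.\<close>

lemma integral_flatten:
  assumes R: "R > 0" and \<phi>: "\<phi> \<in> test_functions"
  shows "(LINT x|lborel. flatten R i \<phi> x) = (LINT x|lborel. \<phi> x)"
proof -
  have "kernel_op i (bump_kernel R) (\<lambda>x. 1) x = 1" for x
    using integral_shifted_bump[OF R, of "x $ i"] by (simp add: kernel_op_def bump_kernel_def)
  then show ?thesis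
    using integral_mult_kernel_adj[OF coord_kernel_bump[OF R] locally_integrable_const \<phi>, of 1 i]
    by (simp add: flatten_def)
qed

definition flatten_all :: "real \<Rightarrow> 'n::finite list \<Rightarrow> (real ^ 'n \<Rightarrow> complex) \<Rightarrow> real ^ 'n \<Rightarrow> complex" where
  "flatten_all R is \<phi> = fold (flatten R) is \<phi>"

lemma test_function_flatten_all:
  "R > 0 \<Longrightarrow> \<phi> \<in> test_functions \<Longrightarrow> flatten_all R is \<phi> \<in> test_functions"
  unfolding flatten_all_def by (induction "is" arbitrary: \<phi>) (auto intro: test_function_flatten)

lemma integral_flatten_all:
  "R > 0 \<Longrightarrow> \<phi> \<in> test_functions \<Longrightarrow> (LINT x|lborel. flatten_all R is \<phi> x) = (LINT x|lborel. \<phi> x)"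
  unfolding flatten_all_def
  by (induction "is" arbitrary: \<phi>) (auto simp: test_function_flatten integral_flatten)

lemma coord_shift_commute: "coord_shift i s (coord_shift j t x) = coord_shift j t (coord_shift i s x)"
  by (simp add: coord_shift_def add_ac)

text \<open>The invariant of the fold: over the set \<open>S\<close> of coordinates already treated
  there is a product of bumps, times a function independent of these coordinates.\<close>

lemma flatten_all_shape:
  fixes \<phi> :: "real ^ 'n::finite \<Rightarrow> complex"
  assumes "distinct is" "S \<inter> set is = {}"
    and "\<And>x. \<phi> x = (\<Prod>i\<in>S. complex_of_real (bump R (x $ i))) * m x"
    and "\<And>i t x. i \<in> S \<Longrightarrow> m (coord_shift i t x) = m x"
  obtains m' where
    "\<And>x. flatten_all R is \<phi> x = (\<Prod>i\<in>S \<union> set is. complex_of_real (bump R (x $ i))) * m' x"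
    "\<And>i t x. i \<in> S \<union> set is \<Longrightarrow> m' (coord_shift i t x) = m' x"
  using assms
proof (induction "is" arbitrary: S \<phi> m thesis)
  case Nil
  then show ?case by (auto simp: flatten_all_def)
next
  case (Cons i "is")
  \<comment> \<open>Integrating out coordinate \<open>i\<close> leaves the bumps over
    \<open>S\<close> untouched because \<open>i\<close> is not in \<open>S\<close>, and it keeps the
    invariance in the earlier coordinates because shifts commute.\<close>
  define m1 where "m1 x = (LINT t|lborel. m (coord_shift i t x))" for x
  have iS: "i \<notin> S" using Cons.prems(3) by auto
  have shape: "flatten R i \<phi> x = (\<Prod>j\<in>insert i S. complex_of_real (bump R (x $ j))) * m1 x" for x
  proof -
    have "\<phi> (coord_shift i t x) = (\<Prod>j\<in>S. complex_of_real (bump R (x $ j))) * m (coord_shift i t x)" for t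
      unfolding Cons.prems(4) using iS
      by (intro arg_cong2[where f="(*)"] prod.cong) (auto simp: coord_shift_nth)
    then show ?thesis using iS by (simp add: flatten_eq m1_def)
  qed
  have inv: "m1 (coord_shift j t x) = m1 x" if "j \<in> insert i S" for j t x
  proof (cases "j = i")
    case True
    then show ?thesis unfolding m1_def by (simp add: integral_along_line_shift)
  next
    case False
    then show ?thesis using that Cons.prems(5)[of j] unfolding m1_def coord_shift_commute[of i _ j] by simp
  qed
  have "distinct is" "insert i S \<inter> set is = {}" using Cons.prems(2,3) by auto
  from Cons.IH[OF _ this shape inv]
  obtain m' where "\<And>x. flatten_all R is (flatten R i \<phi>) x = (\<Prod>i\<in>insert i S \<union> set is. complex_of_real (bump R (x $ i))) * m' x"
    "\<And>j t x. j \<in> insert i S \<union> set is \<Longrightarrow> m' (coord_shift j t x) = m' x" by blast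
  then show ?case by (intro Cons.prems(1)[of m']) (auto simp: flatten_all_def)
qed

lemma shift_invariant_imp_const:
  fixes m :: "real ^ 'n::finite \<Rightarrow> 'b"
  assumes "\<And>i t x. m (coord_shift i t x) = m x"
  shows "m x = m 0"
proof -
  have "m (\<chi> j. if j \<in> A then x $ j else 0) = m 0" if "finite A" for A
    using that
  proof (induction A rule: finite_induct)
    case empty
    then show ?case by (simp add: zero_vec_def)
  next
    case (insert i A)
    have "(\<chi> j. if j \<in> insert i A then x $ j else 0) =
        coord_shift i (x $ i) (\<chi> j. if j \<in> A then x $ j else 0)"
      using insert.hyps by (auto simp: vec_eq_iff coord_shift_nth)
    then show ?case using insert.IH assms by simp
  qed
  from this[of UNIV] show ?thesis by simp
qed

lemma flatten_all_coord_list: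
  obtains c where
    "\<And>x. flatten_all R coord_list \<phi> x = c * (\<Prod>i\<in>UNIV. complex_of_real (bump R (x $ i)))"
proof -
  obtain m' where m': "\<And>x. flatten_all R coord_list \<phi> x =
      (\<Prod>i\<in>{} \<union> set coord_list. complex_of_real (bump R (x $ i))) * m' x"
    "\<And>i t x. i \<in> {} \<union> set coord_list \<Longrightarrow> m' (coord_shift i t x) = m' x"
    by (rule flatten_all_shape[of coord_list "{}" \<phi> R \<phi>]) (auto simp: coord_list)
  have "m' x = m' 0" for x
    by (rule shift_invariant_imp_const) (use m'(2) in \<open>simp add: coord_list\<close>)
  then have "\<And>x. flatten_all R coord_list \<phi> x = m' 0 * (\<Prod>i\<in>UNIV. complex_of_real (bump R (x $ i)))"
    using m'(1) by (simp add: coord_list mult.commute)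
  then show ?thesis using that by blast
qed

text \<open>The induction on \<open>k\<close> passes from \<open>u\<close> to its first derivatives;
  linearity is the property carried along.\<close>

definition linear_functional :: "'n::finite functional \<Rightarrow> bool" where
  "linear_functional u \<longleftrightarrow>
     (\<forall>\<phi>\<in>test_functions. \<forall>\<psi>\<in>test_functions. u (\<lambda>x. \<phi> x + \<psi> x) = u \<phi> + u \<psi>) \<and>
     (\<forall>c. \<forall>\<phi>\<in>test_functions. u (\<lambda>x. c * \<phi> x) = c * u \<phi>)"

lemma linear_functional_cmult:
  "linear_functional u \<Longrightarrow> \<phi> \<in> test_functions \<Longrightarrow> u (\<lambda>x. c * \<phi> x) = c * u \<phi>"
  by (simp add: linear_functional_def)

lemma linear_functional_diff:
  assumes "linear_functional u" "\<phi> \<in> test_functions" "\<psi> \<in> test_functions"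
  shows "u (\<lambda>x. \<phi> x - \<psi> x) = u \<phi> - u \<psi>"
proof -
  have "u (\<lambda>x. \<phi> x + - 1 * \<psi> x) = u \<phi> + - 1 * u \<psi>"
    using assms test_function_cmult[OF assms(3), of "- 1"] unfolding linear_functional_def by metis
  then show ?thesis by simp
qed

text \<open>Otherwise the constant 1 would be orthogonal to all test functions and vanish almost
  everywhere.\<close>

lemma exists_test_function_integral_neq_0:
  obtains \<phi> :: "real ^ 'n::finite \<Rightarrow> complex" where "\<phi> \<in> test_functions" "(LINT x|lborel. \<phi> x) \<noteq> 0"
proof (rule ccontr)
  assume "\<not> thesis"
  then have "(LINT x|lborel. 1 * \<phi> x) = 0" if "\<phi> \<in> test_functions" for \<phi> :: "real ^ 'n \<Rightarrow> complex"
    using \<open>\<And>\<phi>. \<phi> \<in> test_functions \<Longrightarrow> integral\<^sup>L lborel \<phi> \<noteq> 0 \<Longrightarrow> thesis\<close> that by auto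
  then have "AE x :: real ^ 'n in lborel. (1::complex) = 0"
    by (intro AE_eq_0_if_orthogonal_test_functions[OF locally_integrable_const])
  then have "emeasure lborel (UNIV :: (real ^ 'n) set) = 0"
    by (subst (asm) AE_iff_measurable[of UNIV]) auto
  then show False by simp
qed

text \<open>Flattening every coordinate leaves only multiples of one fixed product of bumps, and the
  multiple is determined by the integral. Comparing with one \<open>\<phi>0\<close> of nonzero
  integral gives the constant.\<close>

lemma linear_functional_flatten_all:
  fixes u :: "'n::finite functional"
  assumes R: "R > 0" and u: "linear_functional u"
  obtains C where "\<And>\<phi>. \<phi> \<in> test_functions \<Longrightarrow> u (flatten_all R coord_list \<phi>) = C * (LINT x|lborel. \<phi> x)"
proof -
  let ?F = "flatten_all R (coord_list :: 'n list)"
  define \<Theta> where "\<Theta> x = (\<Prod>i\<in>UNIV. complex_of_real (bump R (x $ i)))" for x :: "real ^ 'n"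
  obtain \<phi>0 :: "real ^ 'n \<Rightarrow> complex" where \<phi>0: "\<phi>0 \<in> test_functions" "(LINT x|lborel. \<phi>0 x) \<noteq> 0"
    by (rule exists_test_function_integral_neq_0)
  obtain c0 where c0: "\<And>x. ?F \<phi>0 x = c0 * \<Theta> x"
    using flatten_all_coord_list[of R \<phi>0] unfolding \<Theta>_def by blast
  have I0: "(LINT x|lborel. \<phi>0 x) = c0 * (LINT x|lborel. \<Theta> x)"
    using integral_flatten_all[OF R \<phi>0(1), of coord_list] by (simp add: c0)
  then have nz: "c0 \<noteq> 0" "(LINT x|lborel. \<Theta> x) \<noteq> 0" using \<phi>0(2) by auto
  show ?thesis
  proof (rule that[of "u (?F \<phi>0) / (LINT x|lborel. \<phi>0 x)"])
    fix \<phi> :: "real ^ 'n \<Rightarrow> complex" assume \<phi>: "\<phi> \<in> test_functions"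
    obtain c where c: "\<And>x. ?F \<phi> x = c * \<Theta> x"
      using flatten_all_coord_list[of R \<phi>] unfolding \<Theta>_def by blast
    have I: "(LINT x|lborel. \<phi> x) = c * (LINT x|lborel. \<Theta> x)"
      using integral_flatten_all[OF R \<phi>, of coord_list] by (simp add: c)
    have "?F \<phi> = (\<lambda>x. (c / c0) * ?F \<phi>0 x)" using nz by (auto simp: c c0)
    then have "u (?F \<phi>) = u (\<lambda>x. (c / c0) * ?F \<phi>0 x)" by (rule arg_cong)
    also have "\<dots> = (c / c0) * u (?F \<phi>0)"
      by (rule linear_functional_cmult[OF u test_function_flatten_all[OF R \<phi>0(1)]])
    finally have "u (?F \<phi>) = (c / c0) * u (?F \<phi>0)" .
    then show "u (?F \<phi>) = u (?F \<phi>0) / (LINT x|lborel. \<phi>0 x) * (LINT x|lborel. \<phi> x)"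
      using nz by (simp add: I I0)
  qed
qed

text \<open>The operator called \<open>G\<close> in the overview. The recursion transposes that of
  \<open>flatten_all\<close>: the coordinate flattened first contributes the averaging applied
  last.\<close>

primrec remainder :: "real \<Rightarrow> ('n::finite \<Rightarrow> real ^ 'n \<Rightarrow> complex) \<Rightarrow> 'n list \<Rightarrow> real ^ 'n \<Rightarrow> complex" where
  "remainder R f [] = (\<lambda>x. 0)"
| "remainder R f (i # is) =
     (\<lambda>x. kernel_op i (step_kernel R) (f i) x + kernel_op i (bump_kernel R) (remainder R f is) x)"

lemma locally_integrable_remainder:
  assumes "R > 0" "\<And>i. locally_integrable (f i)"
  shows "locally_integrable (remainder R f is)"
  by (induction "is")
    (auto intro!: locally_integrable_add locally_integrable_kernel_op[OF coord_kernel_step]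
      locally_integrable_kernel_op[OF coord_kernel_bump] locally_integrable_const assms)

lemma dist_deriv_unit:
  assumes "\<phi> \<in> test_functions"
  shows "dist_deriv (unit_mi i) u \<phi> = - u (partial_deriv i \<phi>)"
  using assms by (simp add: dist_deriv_def mi_order_unit multi_deriv_unit)

lemma dist_of_eq_lborel:
  assumes "\<phi> \<in> test_functions" "f \<in> borel_measurable borel"
  shows "dist_of f \<phi> = (LINT x|lborel. f x * \<phi> x)"
proof -
  have "smooth \<phi>" using assms(1) by (elim test_functionE)
  then have [measurable]: "\<phi> \<in> borel_measurable borel" by (rule smooth_measurable)
  show ?thesis using assms by (simp add: dist_of_def integral_completion)
qed

text \<open>In each coordinate \<open>\<phi>\<close> minus its flattening is the derivative of a
  test function, so \<open>u\<close> acts on it through \<open>f i\<close>; transposition moves the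
  kernels onto \<open>f i\<close> and onto the remainder of the later coordinates.\<close>

lemma functional_eq_flatten_all_minus_remainder:
  assumes R: "R > 0" and u: "linear_functional u" and f: "\<And>i. locally_integrable (f i)"
    and deriv: "\<And>i. dist_deriv (unit_mi i) u = dist_of (f i)" and \<phi>: "\<phi> \<in> test_functions"
  shows "u \<phi> = u (flatten_all R is \<phi>) - (LINT x|lborel. remainder R f is x * \<phi> x)"
  using \<phi>
proof (induction "is" arbitrary: \<phi>)
  case Nil
  then show ?case by (simp add: flatten_all_def)
next
  case (Cons i "is")
  note \<phi> = Cons.prems
  let ?\<psi> = "kernel_adj i (step_kernel R) \<phi>" and ?E = "flatten R i \<phi>"
  have E: "?E \<in> test_functions" by (rule test_function_flatten[OF R \<phi>])
  have \<psi>: "?\<psi> \<in> test_functions" by (rule test_function_step_adj[OF R \<phi>])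
  have "u \<phi> - u ?E = u (partial_deriv i ?\<psi>)"
    by (simp add: partial_deriv_step_adj[OF R \<phi>] linear_functional_diff[OF u \<phi> E])
  also have "\<dots> = - dist_of (f i) ?\<psi>"
    using dist_deriv_unit[OF \<psi>, of i u] deriv by simp
  also have "\<dots> = - (LINT x|lborel. f i x * ?\<psi> x)"
    using f by (simp add: dist_of_eq_lborel[OF \<psi>] locally_integrable_def)
  also have "\<dots> = - (LINT x|lborel. kernel_op i (step_kernel R) (f i) x * \<phi> x)"
    by (simp add: integral_mult_kernel_adj[OF coord_kernel_step[OF R] f \<phi>])
  finally have 1: "u \<phi> = u ?E - (LINT x|lborel. kernel_op i (step_kernel R) (f i) x * \<phi> x)"
    by (simp add: diff_eq_eq)
  have 2: "u ?E = u (flatten_all R is ?E) - (LINT x|lborel. remainder R f is x * ?E x)"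
    by (rule Cons.IH[OF E])
  have 3: "(LINT x|lborel. remainder R f is x * ?E x) =
      (LINT x|lborel. kernel_op i (bump_kernel R) (remainder R f is) x * \<phi> x)"
    unfolding flatten_def
    by (rule integral_mult_kernel_adj[OF coord_kernel_bump[OF R] locally_integrable_remainder[OF R f] \<phi>])
  have 4: "(LINT x|lborel. remainder R f (i # is) x * \<phi> x) =
      (LINT x|lborel. kernel_op i (step_kernel R) (f i) x * \<phi> x) +
      (LINT x|lborel. kernel_op i (bump_kernel R) (remainder R f is) x * \<phi> x)"
    unfolding remainder.simps distrib_right
    by (intro Bochner_Integration.integral_add integrable_locally_integrable_mult_test \<phi>
        locally_integrable_kernel_op[OF coord_kernel_step[OF R]] f
        locally_integrable_kernel_op[OF coord_kernel_bump[OF R]] locally_integrable_remainder[OF R])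
  show ?case unfolding 4 using 1 2 3 by (simp add: flatten_all_def)
qed

lemma functional_representation:
  fixes u :: "'n::finite functional"
  assumes R: "R > 0" and u: "linear_functional u" and f: "\<And>i. locally_integrable (f i)"
    and deriv: "\<And>i. dist_deriv (unit_mi i) u = dist_of (f i)"
  obtains C where "\<And>\<phi>. \<phi> \<in> test_functions \<Longrightarrow>
    u \<phi> = (LINT x|lborel. (C - remainder R f coord_list x) * \<phi> x)"
proof -
  obtain C where C: "\<And>\<phi>. \<phi> \<in> test_functions \<Longrightarrow> u (flatten_all R coord_list \<phi>) = C * (LINT x|lborel. \<phi> x)"
    using linear_functional_flatten_all[OF R u] by blast
  show ?thesis
  proof (rule that[of C])
    fix \<phi> :: "real ^ 'n \<Rightarrow> complex" assume \<phi>: "\<phi> \<in> test_functions"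
    have "u \<phi> = (LINT x|lborel. C * \<phi> x) - (LINT x|lborel. remainder R f coord_list x * \<phi> x)"
      using functional_eq_flatten_all_minus_remainder[OF R u f deriv \<phi>, of coord_list] C[OF \<phi>] by simp
    also have "\<dots> = (LINT x|lborel. (C - remainder R f coord_list x) * \<phi> x)"
      unfolding left_diff_distrib
      by (intro Bochner_Integration.integral_diff[symmetric] integrable_locally_integrable_mult_test \<phi>
          locally_integrable_const locally_integrable_remainder R f)
    finally show "u \<phi> = (LINT x|lborel. (C - remainder R f coord_list x) * \<phi> x)" .
  qed
qed

section \<open>Growth of primitives\<close>

text \<open>Here 4 is the constant of \<open>Lp_bound_add\<close>, and \<open>\<sigma>\<close>
  stands for the bound \<open>2 * R * (1 / (R * bump_mass)) = 2 / bump_mass\<close> of one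
  averaging, from which \<open>R\<close> has cancelled.\<close>

primrec remainder_const :: "real \<Rightarrow> nat \<Rightarrow> real" where
  "remainder_const \<sigma> 0 = 0"
| "remainder_const \<sigma> (Suc k) = 4 * (1 + \<sigma> * remainder_const \<sigma> k)"

lemma remainder_const_nonneg: "\<sigma> \<ge> 0 \<Longrightarrow> remainder_const \<sigma> k \<ge> 0"
  by (induction k) auto

lemma remainder_measurable:
  assumes "R > 0" "\<And>i. f i \<in> borel_measurable borel"
  shows "remainder R f is \<in> borel_measurable borel"
  by (induction "is")
    (auto intro!: borel_measurable_add coord_kernel.op_measurable[OF coord_kernel_step]
      coord_kernel.op_measurable[OF coord_kernel_bump] assms)

lemma remainder_Lp_bound:
  assumes p: "1 \<le> p" and R: "R > 0" and f: "\<And>i. f i \<in> borel_measurable borel"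
    and bd: "\<And>i. Lp_bound p (cube R) (f i) B" and B: "B \<ge> 0"
  shows "Lp_bound p (cube R) (remainder R f is) (remainder_const (2 / bump_mass) (length is) * (2 * R * B))"
proof (induction "is")
  case Nil
  then show ?case by (simp add: Lp_bound_zero)
next
  case (Cons i "is")
  let ?r = "remainder_const (2 / bump_mass) (length is)"
  have r: "?r \<ge> 0" using bump_mass_pos by (intro remainder_const_nonneg) simp
  have "Lp_bound p (cube R) (kernel_op i (step_kernel R) (f i)) (2 * R * 1 * B)"
    by (rule coord_kernel.op_Lp_bound[OF coord_kernel_step[OF R] p _ f bd B]) simp
  moreover have "Lp_bound p (cube R) (kernel_op i (bump_kernel R) (remainder R f is))
      (2 * R * (1 / (R * bump_mass)) * (?r * (2 * R * B)))"
    using R B r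
    by (intro coord_kernel.op_Lp_bound[OF coord_kernel_bump[OF R] p _ remainder_measurable[OF R f] Cons.IH]) auto
  ultimately have "Lp_bound p (cube R) (remainder R f (i # is))
      (4 * (2 * R * 1 * B + 2 * R * (1 / (R * bump_mass)) * (?r * (2 * R * B))))"
    unfolding remainder.simps using R B r bump_mass_pos
    by (intro Lp_bound_add[OF p] coord_kernel.op_measurable[OF coord_kernel_step[OF R] f]
        coord_kernel.op_measurable[OF coord_kernel_bump[OF R] remainder_measurable[OF R f]]) auto
  moreover have "4 * (2 * R * 1 * B + 2 * R * (1 / (R * bump_mass)) * (?r * (2 * R * B))) =
      remainder_const (2 / bump_mass) (length (i # is)) * (2 * R * B)"
    using R bump_mass_pos by (simp add: field_simps)
  ultimately show ?case by simp
qed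

lemma emeasure_cube:
  assumes "R \<ge> 0"
  shows "emeasure lborel (cube R :: (real ^ 'n::finite) set) = ennreal ((2 * R) ^ CARD('n))"
proof -
  have "emeasure lborel (cube R :: (real ^ 'n) set) =
      ennreal (\<Prod>b\<in>Basis. ((\<chi> i. R) - (\<chi> i. - R) :: real ^ 'n) \<bullet> b)"
    unfolding cube_eq_cbox using assms
    by (subst emeasure_lborel_cbox) (auto simp: Basis_vec_def inner_axis)
  also have "(\<Prod>b\<in>Basis. ((\<chi> i. R) - (\<chi> i. - R) :: real ^ 'n) \<bullet> b) = (\<Prod>b\<in>(Basis :: (real ^ 'n) set). 2 * R)"
    by (intro prod.cong refl) (auto simp: Basis_vec_def inner_axis)
  finally show ?thesis by simp
qed

lemma powr_le_cancel_base:
  fixes x y r :: real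
  assumes "0 \<le> x" "0 \<le> y" "r > 0"
  shows "x powr r \<le> y powr r \<longleftrightarrow> x \<le> y"
  using assms powr_mono2[of r x y] powr_less_mono2[of r y x] by (auto simp: not_le[symmetric])

lemma dim_over_exponent:
  "enn2real (of_nat CARD('n::finite) / \<infinity>) = 0"
  "r > 0 \<Longrightarrow> enn2real (of_nat CARD('n) / ennreal r) = real CARD('n) / r"
  by (simp_all add: divide_ennreal_def) (simp add: divide_ennreal ennreal_of_nat_eq_real_of_nat
    flip: divide_ennreal_def)

text \<open>Used in both directions: to read off the size of a constant from its norm on a cube, and
  to return from the size to the norm.\<close>

lemma Lp_bound_const_iff:
  fixes d :: complex
  assumes p: "1 \<le> p" and R: "R > 0" and B: "B \<ge> 0"
  shows "Lp_bound p (cube R :: (real ^ 'n::finite) set) (\<lambda>x. d) B \<longleftrightarrow>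
    cmod d * (2 * R) powr enn2real (of_nat CARD('n) / p) \<le> B"
  using p
proof (cases rule: exponent_cases)
  case infinite
  have "(AE x :: real ^ 'n in lborel. x \<in> cube R \<longrightarrow> cmod d \<le> B) \<longleftrightarrow> cmod d \<le> B"
  proof
    assume *: "AE x :: real ^ 'n in lborel. x \<in> cube R \<longrightarrow> cmod d \<le> B"
    show "cmod d \<le> B"
    proof (rule ccontr)
      assume "\<not> cmod d \<le> B"
      with * have "AE x :: real ^ 'n in lborel. x \<notin> cube R" by simp
      then have "emeasure lborel (cube R :: (real ^ 'n) set) = 0"
        by (subst (asm) AE_iff_measurable[of "cube R"]) auto
      then show False using R by (simp add: emeasure_cube)
    qed
  qed simp
  then show ?thesis using infinite R by (simp add: Lp_bound_def dim_over_exponent(1)[unfolded infinity_ennreal_def])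
next
  case (finite r)
  let ?\<nu> = "real CARD('n) / r"
  have "(\<integral>\<^sup>+x\<in>(cube R :: (real ^ 'n) set). ennreal (cmod d powr r) \<partial>lborel) =
      ennreal (cmod d powr r * (2 * R) ^ CARD('n))"
    using R by (simp add: nn_integral_cmult_indicator emeasure_cube ennreal_mult)
  also have "cmod d powr r * (2 * R) ^ CARD('n) = (cmod d * (2 * R) powr ?\<nu>) powr r"
    using R finite by (simp add: powr_mult powr_powr powr_realpow)
  finally show ?thesis
    using finite B R powr_le_cancel_base[of "cmod d * (2 * R) powr ?\<nu>" B r]
    by (simp add: Lp_bound_def dim_over_exponent)
qed

text \<open>The constant \<open>A\<close> is chosen so that \<open>K <= A (q - 1)\<close>; then
  adding \<open>K q^j\<close> to \<open>A q^j\<close> stays below \<open>A q^(j+1)\<close>, and no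
  sum has to be evaluated.\<close>

lemma geometric_bound:
  fixes C :: "nat \<Rightarrow> complex" and q K :: real
  assumes "q > 1" "K \<ge> 0" and step: "\<And>j. cmod (C (Suc j) - C j) \<le> K * q ^ j"
  shows "cmod (C j) \<le> (cmod (C 0) + K / (q - 1)) * q ^ j"
proof (induction j)
  case 0
  then show ?case using assms by simp
next
  case (Suc j)
  let ?A = "cmod (C 0) + K / (q - 1)"
  have "?A * (q - 1) = cmod (C 0) * (q - 1) + K" using assms(1) by (simp add: distrib_right)
  then have "K \<le> ?A * (q - 1)" using assms(1) by simp
  then have "K * q ^ j \<le> (?A * (q - 1)) * q ^ j" using assms(1) by (intro mult_right_mono) auto
  moreover have "cmod (C (Suc j)) \<le> cmod (C j) + cmod (C (Suc j) - C j)"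
    using norm_triangle_ineq[of "C j" "C (Suc j) - C j"] by simp
  ultimately have "cmod (C (Suc j)) \<le> ?A * q ^ j + (?A * (q - 1)) * q ^ j"
    using Suc.IH step[of j] by linarith
  also have "?A * q ^ j + (?A * (q - 1)) * q ^ j = (?A + ?A * (q - 1)) * q ^ j"
    by (simp only: distrib_right)
  also have "?A + ?A * (q - 1) = ?A * q"
    by (simp only: right_diff_distrib mult_1_right add_diff_cancel_left' add.commute diff_add_cancel)
  finally show ?case by (simp add: mult.assoc)
qed

lemma dyadic_bracket:
  fixes \<rho> :: real
  assumes "\<rho> \<ge> 1"
  obtains j :: nat where "\<rho> \<le> 2 ^ j" "2 ^ j \<le> 2 * \<rho>"
proof -
  define j where "j = (LEAST j. \<rho> \<le> 2 ^ j)"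
  have ex: "\<exists>j. \<rho> \<le> 2 ^ j" using real_arch_pow[of 2 \<rho>] by (auto intro: less_imp_le)
  then have j: "\<rho> \<le> 2 ^ j" unfolding j_def by (rule LeastI_ex)
  have "2 ^ j \<le> 2 * \<rho>"
  proof (cases j)
    case 0
    then show ?thesis using assms by simp
  next
    case (Suc i)
    then have "\<not> \<rho> \<le> 2 ^ i" using not_less_Least[of i "\<lambda>j. \<rho> \<le> 2 ^ j"] by (simp add: j_def)
    then show ?thesis using Suc by simp
  qed
  then show ?thesis using j that by blast
qed

lemma growth_of_antiderivative:
  fixes u :: "'n::finite functional" and p :: ennreal
  defines "\<nu> \<equiv> enn2real (of_nat CARD('n) / p)"
  assumes p: "1 \<le> p" and s: "s > -1" and u: "linear_functional u"
    and f: "\<And>i. f i \<in> borel_measurable borel"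
    and deriv: "\<And>i. dist_deriv (unit_mi i) u = dist_of (f i)"
    and bd: "\<And>i \<rho>. \<rho> \<ge> 1 \<Longrightarrow> Lp_bound p (cube \<rho>) (f i) (B * \<rho> powr (s + \<nu>))" and B: "B \<ge> 0"
  obtains g B' where "g \<in> borel_measurable borel" "B' \<ge> 0"
    "\<And>\<phi>. \<phi> \<in> test_functions \<Longrightarrow> u \<phi> = (LINT x|lborel. g x * \<phi> x)"
    "\<And>\<rho>. \<rho> \<ge> 1 \<Longrightarrow> Lp_bound p (cube \<rho>) g (B' * \<rho> powr (s + 1 + \<nu>))"
proof -
  have \<nu>: "\<nu> \<ge> 0" by (simp add: \<nu>_def)
  have fl: "locally_integrable (f i)" for i
    by (rule Lp_growth_locally_integrable[OF p, of _ "\<lambda>\<rho>. B * \<rho> powr (s + \<nu>)"])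
      (use f bd B in \<open>auto simp: Lp_growth_def\<close>)
  define G where "G j = remainder (2 ^ j) f coord_list" for j :: nat
  have Gm [measurable]: "G j \<in> borel_measurable borel" for j
    unfolding G_def by (intro remainder_measurable f) simp
  have Gl: "locally_integrable (G j)" for j
    unfolding G_def by (intro locally_integrable_remainder fl) simp
  have "\<exists>C. \<forall>\<phi>\<in>test_functions. u \<phi> = (LINT x|lborel. (C - G j x) * \<phi> x)" for j
    unfolding G_def by (rule functional_representation[OF _ u fl deriv, of "2 ^ j"]) auto
  then obtain C where C: "\<And>j \<phi>. \<phi> \<in> test_functions \<Longrightarrow> u \<phi> = (LINT x|lborel. (C j - G j x) * \<phi> x)"
    by metis
  \<comment> \<open>The weight \<open>\<rho> powr (s + 1 + \<nu>)\<close> at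
    \<open>\<rho> = 2 ^ j\<close>, written as a power in \<open>j\<close>.\<close>
  define w where "w j = (2 powr (s + 1 + \<nu>)) ^ j" for j :: nat
  have w: "w j > 0" for j by (simp add: w_def)
  have pw: "((2::real) ^ j) powr x = (2 powr x) ^ j" for x and j :: nat
    by (simp add: powr_realpow[symmetric] powr_powr powr_power mult.commute)
  define K where "K = remainder_const (2 / bump_mass) (length (coord_list :: 'n list)) * (2 * B)"
  have K: "K \<ge> 0" unfolding K_def using bump_mass_pos B by (intro mult_nonneg_nonneg remainder_const_nonneg) auto
  have Gbd: "Lp_bound p (cube (2 ^ j)) (G j) (K * w j)" for j
  proof -
    have "Lp_bound p (cube (2 ^ j)) (G j)
        (remainder_const (2 / bump_mass) (length (coord_list :: 'n list)) * (2 * 2 ^ j * (B * (2 ^ j) powr (s + \<nu>))))"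
      unfolding G_def using B by (intro remainder_Lp_bound[OF p _ f] bd) auto
    moreover have "w j = 2 ^ j * (2 ^ j) powr (s + \<nu>)"
      unfolding w_def pw[symmetric] by (simp add: powr_add)
    ultimately show ?thesis by (simp add: K_def mult_ac)
  qed
  \<comment> \<open>All scales represent the same \<open>u\<close>, so by the fundamental lemma the
    functions \<open>C j - G j\<close> agree almost everywhere.\<close>
  have AE0: "AE x in lborel. C j - G j x = C 0 - G 0 x" for j
  proof -
    have "AE x in lborel. (C j - G j x) - (C 0 - G 0 x) = 0"
    proof (rule AE_eq_0_if_orthogonal_test_functions)
      show "locally_integrable (\<lambda>x. (C j - G j x) - (C 0 - G 0 x))"
        by (intro locally_integrable_diff locally_integrable_const Gl)
      fix \<phi> :: "real ^ 'n \<Rightarrow> complex" assume \<phi>: "\<phi> \<in> test_functions"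
      have int: "integrable lborel (\<lambda>x. (C j - G j x) * \<phi> x)" for j
        by (intro integrable_locally_integrable_mult_test locally_integrable_diff locally_integrable_const Gl \<phi>)
      show "(LINT x|lborel. ((C j - G j x) - (C 0 - G 0 x)) * \<phi> x) = 0"
        unfolding left_diff_distrib[of "C j - G j _" "C 0 - G 0 _"]
        using C[OF \<phi>, of j] C[OF \<phi>, of 0] int by (subst Bochner_Integration.integral_diff) auto
    qed
    then show ?thesis by simp
  qed
  \<comment> \<open>On the cube of scale \<open>2 ^ j\<close> the terms \<open>G (Suc j)\<close> and
    \<open>G j\<close> are bounded by \<open>K * w (Suc j)\<close> and \<open>K * w j\<close>; the
    weights have ratio \<open>2 powr (s + 1 + \<nu>)\<close>, and 4 comes from
    \<open>Lp_bound_add\<close>.\<close>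
  define K1 where "K1 = 4 * K * (2 powr (s + 1 + \<nu>) + 1)"
  have K1: "K1 \<ge> 0" using K by (simp add: K1_def)
  \<comment> \<open>A constant already has norm of order \<open>(2 ^ j) powr \<nu>\<close> on the
    cube. Dividing the weight by this leaves \<open>q ^ j\<close>, and \<open>s > -1\<close> is what
    makes \<open>q > 1\<close>.\<close>
  define q where "q = (2::real) powr (s + 1)"
  have q: "q > 1" unfolding q_def using s by simp
  have wq: "w j = q ^ j * (2 ^ j) powr \<nu>" for j
    unfolding w_def q_def pw by (simp add: powr_add power_mult_distrib)
  have step: "cmod (C (Suc j) - C j) \<le> K1 * q ^ j" for j
  proof -
    have "Lp_bound p (cube (2 ^ j)) (\<lambda>x. - G j x) (1 * (K * w j))"
      by (rule Lp_bound_mono_AE[OF p _ _ Gbd]) (use K w[of j] in auto)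
    moreover have "Lp_bound p (cube (2 ^ j)) (G (Suc j)) (K * w (Suc j))"
      by (rule Lp_bound_subset[OF Gbd]) (intro cube_mono, simp)
    ultimately have "Lp_bound p (cube (2 ^ j)) (\<lambda>x. G (Suc j) x + - G j x) (4 * (K * w (Suc j) + 1 * (K * w j)))"
      using K w[of j] w[of "Suc j"] by (intro Lp_bound_add[OF p]) auto
    also have "4 * (K * w (Suc j) + 1 * (K * w j)) = K1 * w j"
      by (simp add: K1_def w_def algebra_simps)
    finally have 1: "Lp_bound p (cube (2 ^ j)) (\<lambda>x. G (Suc j) x + - G j x) (K1 * w j)" .
    \<comment> \<open>The difference of the constants equals \<open>G (Suc j) - G j\<close> almost
      everywhere and so inherits its norm bound.\<close>
    have "AE x in lborel. x \<in> cube (2 ^ j) \<longrightarrow> cmod (C (Suc j) - C j) \<le> 1 * cmod (G (Suc j) x + - G j x)"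
      using AE0[of j] AE0[of "Suc j"]
    proof eventually_elim
      fix x assume "C j - G j x = C 0 - G 0 x" "C (Suc j) - G (Suc j) x = C 0 - G 0 x"
      then have "C j = C 0 - G 0 x + G j x" "C (Suc j) = C 0 - G 0 x + G (Suc j) x"
        by (simp_all add: diff_eq_eq)
      then have "C (Suc j) - C j = G (Suc j) x + - G j x" by simp
      then show "x \<in> cube (2 ^ j) \<longrightarrow> cmod (C (Suc j) - C j) \<le> 1 * cmod (G (Suc j) x + - G j x)" by simp
    qed
    from Lp_bound_mono_AE[OF p this _ 1]
    have "Lp_bound p (cube (2 ^ j) :: (real ^ 'n) set) (\<lambda>x. C (Suc j) - C j) (1 * (K1 * w j))"
      using K1 w[of j] by auto
    then have "cmod (C (Suc j) - C j) * (2 * 2 ^ j) powr \<nu> \<le> K1 * w j"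
      using Lp_bound_const_iff[OF p, of "2 ^ j" "K1 * w j" "C (Suc j) - C j", where 'n='n] K1 w[of j]
      by (simp add: \<nu>_def)
    moreover have "cmod (C (Suc j) - C j) * (2 ^ j) powr \<nu> \<le> cmod (C (Suc j) - C j) * (2 * 2 ^ j) powr \<nu>"
      using \<nu> by (intro mult_left_mono powr_mono2) auto
    ultimately have "cmod (C (Suc j) - C j) * (2 ^ j) powr \<nu> \<le> K1 * w j" by linarith
    also have "K1 * w j = (K1 * q ^ j) * (2 ^ j) powr \<nu>" by (simp only: wq mult.assoc)
    finally show ?thesis by (rule mult_right_le_imp_le) simp
  qed
  define K2 where "K2 = cmod (C 0) + K1 / (q - 1)"
  have K2: "K2 \<ge> 0" using K1 q by (simp add: K2_def)
  have Cbd: "Lp_bound p (cube (2 ^ j) :: (real ^ 'n) set) (\<lambda>x. C j) (K2 * 2 powr \<nu> * w j)" for j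
  proof -
    have "cmod (C j) * (2 * 2 ^ j) powr \<nu> \<le> K2 * q ^ j * (2 * 2 ^ j) powr \<nu>"
      unfolding K2_def by (intro mult_right_mono geometric_bound[OF q K1 step]) simp
    also have "\<dots> = K2 * 2 powr \<nu> * w j" unfolding wq by (simp add: powr_mult)
    finally show ?thesis
      using K2 w[of j] by (subst Lp_bound_const_iff[OF p]) (auto simp: \<nu>_def)
  qed
  define K3 where "K3 = 4 * (K2 * 2 powr \<nu> + K)"
  have K3: "K3 \<ge> 0" using K K2 by (simp add: K3_def)
  \<comment> \<open>Any index would give the same function almost everywhere, so this single
    \<open>g\<close> obeys the bounds of all dyadic scales.\<close>
  define g where "g x = C 0 - G 0 x" for x
  have g [measurable]: "g \<in> borel_measurable borel" unfolding g_def by measurable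
  have gbd: "Lp_bound p (cube (2 ^ j)) g (K3 * w j)" for j
  proof -
    have "Lp_bound p (cube (2 ^ j)) (\<lambda>x. - G j x) (1 * (K * w j))"
      by (rule Lp_bound_mono_AE[OF p _ _ Gbd]) (use K w[of j] in auto)
    then have "Lp_bound p (cube (2 ^ j)) (\<lambda>x. C j + - G j x) (4 * (K2 * 2 powr \<nu> * w j + 1 * (K * w j)))"
      using K K2 w[of j] by (intro Lp_bound_add[OF p Cbd]) auto
    also have "4 * (K2 * 2 powr \<nu> * w j + 1 * (K * w j)) = K3 * w j" by (simp add: K3_def algebra_simps)
    finally have 1: "Lp_bound p (cube (2 ^ j)) (\<lambda>x. C j + - G j x) (K3 * w j)" .
    have "AE x in lborel. x \<in> cube (2 ^ j) \<longrightarrow> cmod (g x) \<le> 1 * cmod (C j + - G j x)"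
      using AE0[of j] by eventually_elim (simp add: g_def)
    from Lp_bound_mono_AE[OF p this _ 1] show ?thesis using K3 w[of j] by auto
  qed
  show ?thesis
  \<comment> \<open>The factor \<open>2 powr (s + 1 + \<nu>)\<close> pays for rounding
    \<open>\<rho>\<close> up to a power of two that is at most \<open>2 * \<rho>\<close>.\<close>
  proof (rule that[of g "K3 * 2 powr (s + 1 + \<nu>)"])
    show "u \<phi> = (LINT x|lborel. g x * \<phi> x)" if "\<phi> \<in> test_functions" for \<phi>
      using C[OF that, of 0] by (simp add: g_def)
    fix \<rho> :: real assume \<rho>: "\<rho> \<ge> 1"
    obtain j where j: "\<rho> \<le> 2 ^ j" "2 ^ j \<le> 2 * \<rho>" using \<rho> by (rule dyadic_bracket)
    have 1: "Lp_bound p (cube \<rho>) g (K3 * w j)" by (rule Lp_bound_subset[OF gbd cube_mono[OF j(1)]])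
    have "w j \<le> (2 * \<rho>) powr (s + 1 + \<nu>)"
      unfolding w_def pw[symmetric] using j s \<nu> by (intro powr_mono2) auto
    then have "K3 * w j \<le> K3 * (2 * \<rho>) powr (s + 1 + \<nu>)" using K3 by (rule mult_left_mono)
    also have "\<dots> = K3 * 2 powr (s + 1 + \<nu>) * \<rho> powr (s + 1 + \<nu>)" by (simp only: powr_mult mult.assoc)
    finally have 2: "K3 * w j \<le> K3 * 2 powr (s + 1 + \<nu>) * \<rho> powr (s + 1 + \<nu>)" .
    show "Lp_bound p (cube \<rho>) g (K3 * 2 powr (s + 1 + \<nu>) * \<rho> powr (s + 1 + \<nu>))"
      by (rule Lp_bound_mono[OF 1 _ 2]) (use K3 w[of j] in simp)
  qed (use K3 in auto)
qed

section \<open>From Lebesgue to Borel measurable functions, and induction on the order\<close>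

text \<open>Members of \<open>Lp p\<close> are only Lebesgue measurable, while the kernel operators
  work with Borel functions.\<close>

lemma borel_representative:
  fixes f :: "'a::euclidean_space \<Rightarrow> complex"
  assumes [measurable]: "f \<in> borel_measurable lebesgue"
  obtains g where "g \<in> borel_measurable borel" "AE x in lborel. f x = g x"
proof -
  obtain a where a: "a \<in> borel_measurable lborel" "AE x in lborel. Re (f x) = a x"
    using completion_ex_borel_measurable_real[of "\<lambda>x. Re (f x)" lborel] by auto
  obtain b where b: "b \<in> borel_measurable lborel" "AE x in lborel. Im (f x) = b x"
    using completion_ex_borel_measurable_real[of "\<lambda>x. Im (f x)" lborel] by auto
  show ?thesis
  proof (rule that[of "\<lambda>x. Complex (a x) (b x)"])
    have "(\<lambda>x. complex_of_real (a x) + \<i> * complex_of_real (b x)) \<in> borel_measurable borel"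
      using a(1) b(1) by measurable
    then show "(\<lambda>x. Complex (a x) (b x)) \<in> borel_measurable borel"
      by (simp add: Complex_eq)
    show "AE x in lborel. f x = Complex (a x) (b x)"
      using a(2) b(2) by eventually_elim (simp add: complex_eq_iff)
  qed
qed

lemma dist_of_AE_cong:
  fixes f g :: "real ^ 'n::finite \<Rightarrow> complex"
  assumes f [measurable]: "f \<in> borel_measurable lebesgue" and g [measurable]: "g \<in> borel_measurable borel"
    and eq: "AE x in lborel. f x = g x"
  shows "dist_of f = dist_of g"
proof -
  have "(LINT x|lebesgue. f x * \<phi> x) = (LINT x|lebesgue. g x * \<phi> x)" if "\<phi> \<in> test_functions" for \<phi>
  proof (rule integral_cong_AE)
    have "smooth \<phi>" using that by (elim test_functionE)
    then have \<phi> [measurable]: "\<phi> \<in> borel_measurable borel" by (rule smooth_measurable)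
    have [measurable]: "\<phi> \<in> borel_measurable lebesgue" "g \<in> borel_measurable lebesgue"
      by (auto intro!: measurable_completion)
    show "(\<lambda>x. f x * \<phi> x) \<in> borel_measurable lebesgue" "(\<lambda>x. g x * \<phi> x) \<in> borel_measurable lebesgue"
      by measurable
    show "AE x in lebesgue. f x * \<phi> x = g x * \<phi> x"
      unfolding AE_completion_iff using eq by eventually_elim simp
  qed
  then show ?thesis by (auto simp: dist_of_def restrict_def)
qed

lemma Lp_borel_representative:
  fixes f :: "real ^ 'n::finite \<Rightarrow> complex"
  assumes p: "1 \<le> p" and f: "f \<in> Lp p"
  obtains g B where "g \<in> borel_measurable borel" "B \<ge> 0" "dist_of f = dist_of g"
    "\<And>\<rho>. Lp_bound p (cube \<rho>) g B"
proof -
  have fm: "f \<in> borel_measurable lebesgue" and "Lp_norm p UNIV f < \<infinity>"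
    using f by (auto simp: Lp_def)
  then obtain B where B: "B \<ge> 0" "Lp_norm p UNIV f = ennreal B"
    by (cases "Lp_norm p UNIV f") auto
  then have fb: "Lp_bound p UNIV f B" using Lp_norm_le_iff[OF p fm, of UNIV B] by simp
  obtain g where g: "g \<in> borel_measurable borel" and eq: "AE x in lborel. f x = g x"
    using fm by (rule borel_representative)
  have "Lp_bound p UNIV g B"
  proof (cases "p = \<infinity>")
    case True
    have "AE x in lborel. cmod (f x) \<le> B" using fb True by (simp add: Lp_bound_def)
    then have "AE x in lborel. cmod (g x) \<le> B" using eq by eventually_elim simp
    then show ?thesis using True by (simp add: Lp_bound_def)
  next
    case False
    have "(\<integral>\<^sup>+x. ennreal (cmod (f x) powr enn2real p) \<partial>lborel) = (\<integral>\<^sup>+x. ennreal (cmod (g x) powr enn2real p) \<partial>lborel)"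
      by (rule nn_integral_cong_AE) (use eq in eventually_elim, simp)
    then show ?thesis using fb False by (simp add: Lp_bound_def)
  qed
  then have "Lp_bound p (cube \<rho>) g B" for \<rho> by (rule Lp_bound_subset) simp
  then show ?thesis using that g B(1) dist_of_AE_cong[OF fm g eq] by blast
qed

lemma linear_functional_dist_deriv_unit:
  assumes "linear_functional u"
  shows "linear_functional (dist_deriv (unit_mi i) u)"
proof -
  have add: "partial_deriv i (\<lambda>x. \<phi> x + \<psi> x) = (\<lambda>x. partial_deriv i \<phi> x + partial_deriv i \<psi> x)"
    if "\<phi> \<in> test_functions" "\<psi> \<in> test_functions" for \<phi> \<psi> :: "real ^ 'a \<Rightarrow> complex"
    using that by (intro ext partial_deriv_add smooth_differentiable) (auto simp: test_functions_iff)
  have cm: "partial_deriv i (\<lambda>x. c * \<phi> x) = (\<lambda>x. c * partial_deriv i \<phi> x)"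
    if "\<phi> \<in> test_functions" for \<phi> :: "real ^ 'a \<Rightarrow> complex" and c
    using that by (intro partial_deriv_cmult) (auto simp: test_functions_iff)
  show ?thesis
    using assms unfolding linear_functional_def
    by (auto simp: dist_deriv_unit test_function_add test_function_cmult add cm test_function_partial_deriv)
qed

text \<open>Turns the hypothesis on derivatives of order \<open>k + 1\<close> of \<open>u\<close>
  into one on derivatives of order \<open>k\<close> of its first derivatives.\<close>

lemma dist_deriv_dist_deriv_unit:
  "dist_deriv \<alpha> (dist_deriv (unit_mi i) u) = dist_deriv (\<lambda>j. \<alpha> j + unit_mi i j) u"
proof -
  have "(- 1) ^ mi_order \<alpha> * dist_deriv (unit_mi i) u (multi_deriv \<alpha> \<phi>) =
      (- 1) ^ mi_order (\<lambda>j. \<alpha> j + unit_mi i j) * u (multi_deriv (\<lambda>j. \<alpha> j + unit_mi i j) \<phi>)"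
    if "\<phi> \<in> test_functions" for \<phi>
    using that by (simp add: dist_deriv_unit test_function_multi_deriv multi_deriv_add_unit mi_order_add mi_order_unit)
  then show ?thesis unfolding dist_deriv_def[of \<alpha>] dist_deriv_def[of "\<lambda>j. \<alpha> j + unit_mi i j"]
    by (auto simp: restrict_def)
qed

lemma dist_deriv_zero:
  assumes "u \<in> extensional test_functions"
  shows "dist_deriv (\<lambda>_. 0) u = u"
  using assms by (auto simp: dist_deriv_def multi_deriv_zero mi_order_def restrict_def extensional_def)

lemma growth_of_iterated_antiderivative:
  fixes u :: "'n::finite functional" and p :: ennreal
  defines "\<nu> \<equiv> enn2real (of_nat CARD('n) / p)"
  assumes p: "1 \<le> p" and s: "s > -1" "s \<ge> - \<nu>"
    and u: "linear_functional u" "u \<in> extensional test_functions"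
    and deriv: "\<And>\<alpha>. mi_order \<alpha> = k \<Longrightarrow> dist_deriv \<alpha> u \<in> dist_of ` Lp p"
  shows "\<exists>g B. g \<in> borel_measurable borel \<and> B \<ge> 0 \<and> u = dist_of g \<and>
    (\<forall>\<rho>\<ge>1. Lp_bound p (cube \<rho>) g (B * \<rho> powr (s + real k + \<nu>)))"
  using u deriv
proof (induction k arbitrary: u)
  case 0
  have "dist_deriv (\<lambda>_. 0) u \<in> dist_of ` Lp p" by (rule 0(3)) (simp add: mi_order_def)
  then obtain f where f: "f \<in> Lp p" "u = dist_of f" using dist_deriv_zero[OF 0(2)] by auto
  obtain g B where g: "g \<in> borel_measurable borel" "B \<ge> 0" "dist_of f = dist_of g"
    "\<And>\<rho>. Lp_bound p (cube \<rho>) g B"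
    using Lp_borel_representative[OF p f(1)] by blast
  have "Lp_bound p (cube \<rho>) g (B * \<rho> powr (s + real 0 + \<nu>))" if "\<rho> \<ge> 1" for \<rho>
  proof (rule Lp_bound_mono[OF g(4) g(2)])
    \<comment> \<open>Here \<open>s >= - \<nu>\<close> enters: the weight is at least 1, so it
      dominates the constant norm bound of a function in \<open>Lp p\<close>.\<close>
    have "1 \<le> \<rho> powr (s + real 0 + \<nu>)" using that s(2) by (intro ge_one_powr_ge_zero) auto
    then show "B \<le> B * \<rho> powr (s + real 0 + \<nu>)" using g(2) by (simp add: mult_le_cancel_left1)
  qed
  then show ?case using g f by (intro exI[of _ g] exI[of _ B]) simp
next
  case (Suc k)
  define Q where "Q i g B \<longleftrightarrow> g \<in> borel_measurable borel \<and> B \<ge> 0 \<and> dist_deriv (unit_mi i) u = dist_of g \<and>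
    (\<forall>\<rho>\<ge>1. Lp_bound p (cube \<rho>) g (B * \<rho> powr (s + real k + \<nu>)))" for i g B
  have ex: "\<exists>g B. Q i g B" for i
    unfolding Q_def
  proof (rule Suc.IH)
    show "linear_functional (dist_deriv (unit_mi i) u)"
      by (rule linear_functional_dist_deriv_unit[OF Suc.prems(1)])
    show "dist_deriv (unit_mi i) u \<in> extensional test_functions" by (simp add: dist_deriv_def)
    show "dist_deriv \<alpha> (dist_deriv (unit_mi i) u) \<in> dist_of ` Lp p" if "mi_order \<alpha> = k" for \<alpha>
      unfolding dist_deriv_dist_deriv_unit using that
      by (intro Suc.prems(3)) (simp add: mi_order_add mi_order_unit)
  qed
  obtain f where "\<forall>i. \<exists>B. Q i (f i) B"  using choice[of "\<lambda>i g. \<exists>B. Q i g B"] ex by auto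
  then obtain B where Q: "\<forall>i. Q i (f i) (B i)" using choice[of "\<lambda>i. Q i (f i)"] by auto
  have f: "\<And>i. f i \<in> borel_measurable borel" and B: "\<And>i. B i \<ge> 0"
    and du: "\<And>i. dist_deriv (unit_mi i) u = dist_of (f i)"
    and bd: "\<And>i \<rho>. \<rho> \<ge> 1 \<Longrightarrow> Lp_bound p (cube \<rho>) (f i) (B i * \<rho> powr (s + real k + \<nu>))"
    using Q by (simp_all add: Q_def)
  \<comment> \<open>All coordinates must share one constant; the sum of the finitely many
    \<open>B i\<close> dominates each of them.\<close>
  have bd': "Lp_bound p (cube \<rho>) (f i) (sum B UNIV * \<rho> powr (s + real k + \<nu>))" if "\<rho> \<ge> 1" for i \<rho>
    using B by (intro Lp_bound_mono[OF bd[OF that]] mult_right_mono member_le_sum) auto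
  have sk: "s + real k > -1" using s(1) by simp
  have B': "sum B UNIV \<ge> 0" using B by (simp add: sum_nonneg)
  show ?case
  proof (rule growth_of_antiderivative[OF p sk Suc.prems(1) f du bd'[unfolded \<nu>_def] B', folded \<nu>_def])
    fix g B' assume g: "g \<in> borel_measurable borel" "B' \<ge> 0"
      "\<And>\<phi>. \<phi> \<in> test_functions \<Longrightarrow> u \<phi> = (LINT x|lborel. g x * \<phi> x)"
      "\<And>\<rho>. \<rho> \<ge> 1 \<Longrightarrow> Lp_bound p (cube \<rho>) g (B' * \<rho> powr (s + real k + 1 + \<nu>))"
    have "u = dist_of g"
    proof (rule extensionalityI[of _ test_functions])
      show "u \<in> extensional test_functions" by (rule Suc.prems(2))
      show "dist_of g \<in> extensional test_functions" by (simp add: dist_of_def)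
      show "u \<phi> = dist_of g \<phi>" if "\<phi> \<in> test_functions" for \<phi>
        using g(3)[OF that] dist_of_eq_lborel[OF that g(1)] by simp
    qed
    then show "\<exists>g B. g \<in> borel_measurable borel \<and> B \<ge> 0 \<and> u = dist_of g \<and>
        (\<forall>\<rho>\<ge>1. Lp_bound p (cube \<rho>) g (B * \<rho> powr (s + real (Suc k) + \<nu>)))"
      using g(1,2,4) by (intro exI[of _ g] exI[of _ B']) (simp add: add_ac)
  qed
qed

section \<open>From cube bounds to the growth spaces\<close>

lemma Lp_growth_in_Lp_loc:
  fixes g :: "real ^ 'n::finite \<Rightarrow> complex"
  assumes p: "1 \<le> p" and g: "g \<in> borel_measurable borel" and w: "\<And>\<rho>. \<rho> \<ge> 1 \<Longrightarrow> 0 \<le> w \<rho>"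
    and bd: "\<And>\<rho>. \<rho> \<ge> 1 \<Longrightarrow> Lp_bound p (cube \<rho>) g (w \<rho>)"
  shows "g \<in> Lp_loc p"
proof -
  have gl: "g \<in> borel_measurable lebesgue" using g by (simp add: measurable_completion)
  have "Lp_norm p K g < \<infinity>" if K: "compact K" for K
  proof -
    obtain L where L: "K \<subseteq> cube L" using compact_imp_bounded[OF K] bounded_support_imp_cube by blast
    have "Lp_bound p (cube (max L 1)) g (w (max L 1))" by (rule bd) simp
    then have "Lp_bound p K g (w (max L 1))"
      by (rule Lp_bound_subset) (use L cube_mono[of L "max L 1"] in auto)
    then have "Lp_norm p K g \<le> ennreal (w (max L 1))"
      using Lp_norm_le_iff[OF p gl, of K "w (max L 1)"] compact_imp_closed[OF K] w by simp
    then show ?thesis by (rule le_less_trans) simp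
  qed
  then show ?thesis using gl by (simp add: Lp_loc_def)
qed

text \<open>The ball lies in the cube of the same radius, and the dimensional terms
  \<open>\<nu>\<close> cancel when the powers of \<open>R\<close> are multiplied.\<close>

lemma growth_quot_le:
  fixes g :: "real ^ 'n::finite \<Rightarrow> complex" and p :: ennreal
  defines "\<nu> \<equiv> enn2real (of_nat CARD('n) / p)"
  assumes p: "1 \<le> p" and g: "g \<in> borel_measurable borel" and R: "R \<ge> 1" and B: "B \<ge> 0"
    and bd: "Lp_bound p (cube R) g (B * R powr (e + \<nu>))"
  shows "growth_quot s p g R \<le> ennreal (B * R powr (e - s))"
proof -
  have gl: "g \<in> borel_measurable lebesgue" using g by (simp add: measurable_completion)
  have "ball 0 R \<subseteq> (cube R :: (real ^ 'n) set)" using ball_subset_cball cball_subset_cube by blast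
  then have "Lp_bound p (ball 0 R) g (B * R powr (e + \<nu>))" by (rule Lp_bound_subset[OF bd])
  then have "Lp_norm p (ball 0 R) g \<le> ennreal (B * R powr (e + \<nu>))"
    using Lp_norm_le_iff[OF p gl, of "ball 0 R" "B * R powr (e + \<nu>)"] B by simp
  then have "growth_quot s p g R \<le> ennreal (R powr (- s - \<nu>)) * ennreal (B * R powr (e + \<nu>))"
    unfolding growth_quot_def \<nu>_def by (intro mult_left_mono) auto
  also have "\<dots> = ennreal (B * (R powr (- s - \<nu>) * R powr (e + \<nu>)))"
    using B by (simp add: ennreal_mult'[symmetric] mult_ac)
  also have "R powr (- s - \<nu>) * R powr (e + \<nu>) = R powr (e - s)"
    by (simp add: powr_add[symmetric])
  finally show ?thesis .
qed

lemma
  fixes g :: "real ^ 'n::finite \<Rightarrow> complex" and p :: ennreal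
  defines "\<nu> \<equiv> enn2real (of_nat CARD('n) / p)"
  assumes p: "1 \<le> p" and g: "g \<in> borel_measurable borel" and B: "B \<ge> 0"
    and bd: "\<And>\<rho>. \<rho> \<ge> 1 \<Longrightarrow> Lp_bound p (cube \<rho>) g (B * \<rho> powr (e + \<nu>))"
  shows growth_in_M_space: "e \<le> s \<Longrightarrow> g \<in> M_space s p"
    and growth_in_M0_space: "e < s \<Longrightarrow> g \<in> M0_space s p"
proof -
  have loc: "g \<in> Lp_loc p"
    by (rule Lp_growth_in_Lp_loc[OF p g, of "\<lambda>\<rho>. B * \<rho> powr (e + \<nu>)"]) (use B bd in auto)
  have le: "growth_quot s p g R \<le> ennreal (B * R powr (e - s))" if "R \<ge> 1" for R
    using growth_quot_le[OF p g that B] bd[OF that] by (simp add: \<nu>_def)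
  show "g \<in> M_space s p" if "e \<le> s"
  proof -
    have "(SUP R\<in>{1..}. growth_quot s p g R) \<le> ennreal B"
    proof (rule SUP_least)
      fix R :: real assume "R \<in> {1..}"
      then have R: "R \<ge> 1" by simp
      have "R powr (e - s) \<le> R powr 0" using R that by (intro powr_mono) auto
      then have "B * R powr (e - s) \<le> B * 1" using B R by (intro mult_left_mono) auto
      then show "growth_quot s p g R \<le> ennreal B"
        using le[OF R] ennreal_leI order_trans by fastforce
    qed
    then have "(SUP R\<in>{1..}. growth_quot s p g R) < \<infinity>" by (rule le_less_trans) simp
    then show ?thesis using loc by (simp add: M_space_def)
  qed
  show "g \<in> M0_space s p" if "e < s"
  proof -
    have "((\<lambda>R. R powr (e - s)) \<longlongrightarrow> 0) at_top"
      using that by (intro tendsto_neg_powr filterlim_ident) simp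
    then have "((\<lambda>R. B * R powr (e - s)) \<longlongrightarrow> B * 0) at_top" by (intro tendsto_intros)
    then have "((\<lambda>R. ennreal (B * R powr (e - s))) \<longlongrightarrow> 0) at_top"
      using tendsto_ennrealI by fastforce
    then have "(growth_quot s p g \<longlongrightarrow> 0) at_top"
      by (rule tendsto_sandwich[OF _ _ tendsto_const, rotated 2])
        (auto intro!: eventually_mono[OF eventually_ge_at_top[of 1]] le)
    then show ?thesis using loc by (simp add: M0_space_def)
  qed
qed

lemma D_space_growth:
  fixes u :: "'n::finite functional" and p :: ennreal
  defines "\<nu> \<equiv> enn2real (of_nat CARD('n) / p)"
  assumes "1 \<le> p" "s > -1" "s \<ge> - \<nu>" "u \<in> D_space k p"
  obtains g B where "g \<in> borel_measurable borel" "B \<ge> 0" "u = dist_of g"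
    "\<And>\<rho>. \<rho> \<ge> 1 \<Longrightarrow> Lp_bound p (cube \<rho>) g (B * \<rho> powr (s + real k + \<nu>))"
proof -
  have "u \<in> distributions" and d: "\<And>\<alpha>. mi_order \<alpha> = k \<Longrightarrow> dist_deriv \<alpha> u \<in> dist_of ` Lp p"
    using assms(5) by (auto simp: D_space_def)
  then have "linear_functional u" "u \<in> extensional test_functions"
    by (auto simp: distributions_def linear_functional_def)
  from growth_of_iterated_antiderivative[OF assms(2,3) _ this d] show ?thesis
    using assms(4) that unfolding \<nu>_def by blast
qed

theorem theorem3p3:
  fixes k :: nat and p :: ennreal
  shows
    "(of_nat CARD('n) < p \<longrightarrow>
        (\<forall>s. s \<ge> real k - enn2real (of_nat CARD('n) / p) \<longrightarrow>
           (D_space k p :: 'n::finite functional set) \<subseteq> dist_of ` M_space s p) \<and>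
        (\<forall>s. s > real k - enn2real (of_nat CARD('n) / p) \<longrightarrow>
           (D_space k p :: 'n functional set) \<subseteq> dist_of ` M0_space s p)) \<and>
     (1 \<le> p \<and> p \<le> of_nat CARD('n) \<longrightarrow>
        (\<forall>s. s > real k - 1 \<longrightarrow>
           (D_space k p :: 'n functional set) \<subseteq> dist_of ` M0_space s p))"
proof -
  let ?\<nu> = "enn2real (of_nat CARD('n) / p)"
  \<comment> \<open>\<open>s0\<close> is the exponent at which the induction starts,
    \<open>s0 + real k\<close> the one it delivers.\<close>
  have M: "u \<in> dist_of ` M_space s p"
    if p: "1 \<le> p" and s: "s0 > -1" "s0 \<ge> - ?\<nu>" "s0 + real k \<le> s" and u: "u \<in> D_space k p"
    for s s0 :: real and u :: "'n functional"
  proof (rule D_space_growth[OF p s(1,2) u])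
    fix g B assume g: "g \<in> borel_measurable borel" "B \<ge> 0" "u = dist_of g"
      "\<And>\<rho>. \<rho> \<ge> 1 \<Longrightarrow> Lp_bound p (cube \<rho>) g (B * \<rho> powr (s0 + real k + ?\<nu>))"
    show ?thesis
      unfolding g(3) by (rule imageI[OF growth_in_M_space[OF p g(1,2,4) s(3)]])
  qed
  have M0: "u \<in> dist_of ` M0_space s p"
    if p: "1 \<le> p" and s: "s0 > -1" "s0 \<ge> - ?\<nu>" "s0 + real k < s" and u: "u \<in> D_space k p"
    for s s0 :: real and u :: "'n functional"
  proof (rule D_space_growth[OF p s(1,2) u])
    fix g B assume g: "g \<in> borel_measurable borel" "B \<ge> 0" "u = dist_of g"
      "\<And>\<rho>. \<rho> \<ge> 1 \<Longrightarrow> Lp_bound p (cube \<rho>) g (B * \<rho> powr (s0 + real k + ?\<nu>))"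
    show ?thesis
      unfolding g(3) by (rule imageI[OF growth_in_M0_space[OF p g(1,2,4) s(3)]])
  qed
  have N1: "(1::ennreal) \<le> of_nat CARD('n)" using of_nat_mono[of 1 "CARD('n)", where 'a=ennreal] by (simp add: Suc_leI)
  \<comment> \<open>For \<open>p > N\<close> the natural exponent \<open>-N/p\<close> of functions
    in \<open>Lp p\<close> exceeds -1, so the induction may start exactly there.\<close>
  have gt: "1 \<le> p \<and> ?\<nu> < 1" if N: "of_nat CARD('n) < p"
  proof -
    have p: "1 \<le> p" by (rule order_trans[OF N1 less_imp_le[OF N]])
    have "?\<nu> < 1"
      using p
    proof (cases rule: exponent_cases)
      case infinite
      then show ?thesis using dim_over_exponent(1)[where 'n='n] by simp
    next
      case (finite r)
      then have "real CARD('n) < r" using N by (simp add: ennreal_of_nat_eq_real_of_nat ennreal_less_iff)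
      then show ?thesis using finite dim_over_exponent(2)[of r, where 'n='n] by simp
    qed
    then show ?thesis using p by blast
  qed
  \<comment> \<open>For \<open>p <= N\<close> one has \<open>-N/p <= -1\<close>, so
    \<open>s0 > -1\<close> is the only effective restriction on the start.\<close>
  have le: "1 \<le> ?\<nu>" if "1 \<le> p" "p \<le> of_nat CARD('n)"
    using that(1)
  proof (cases rule: exponent_cases)
    case infinite
    then show ?thesis using that(2) by (simp add: top_unique)
  next
    case (finite r)
    then have "r \<le> real CARD('n)" using that(2) by (simp add: ennreal_of_nat_eq_real_of_nat)
    then show ?thesis using finite dim_over_exponent(2)[of r, where 'n='n] by simp
  qed
  show ?thesis
  proof (intro conjI impI allI subsetI)
    fix s and u :: "'n functional"
    assume *: "of_nat CARD('n) < p" "s \<ge> real k - ?\<nu>" "u \<in> D_space k p"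
    show "u \<in> dist_of ` M_space s p"
      by (rule M[of "- ?\<nu>"]) (use * gt[OF *(1)] in auto)
  next
    fix s and u :: "'n functional"
    assume *: "of_nat CARD('n) < p" "s > real k - ?\<nu>" "u \<in> D_space k p"
    show "u \<in> dist_of ` M0_space s p"
      by (rule M0[of "- ?\<nu>"]) (use * gt[OF *(1)] in auto)
  next
    fix s and u :: "'n functional"
    assume p: "1 \<le> p \<and> p \<le> of_nat CARD('n)" and *: "s > real k - 1" "u \<in> D_space k p"
    show "u \<in> dist_of ` M0_space s p"
      \<comment> \<open>The start is the midpoint of \<open>-1\<close> and
        \<open>s - real k\<close>: above -1, yet \<open>s0 + real k\<close> is still strictly below
        \<open>s\<close>.\<close>
      by (rule M0[of "(s - real k - 1) / 2"]) (use p * le in \<open>auto simp: field_simps\<close>)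
  qed
qed

end
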